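(* Let $\Lambda_{\mathbf A,\mathbf B}$ be the free $\lambda$-ring over $\mathbb Q$ with generators $A_\lambda,B_\lambda$ ($\lambda$ running over non-empty partitions), and let $L(\mathbf A,\mathbf B)=\sum_{n\ge1}L_n(\mathbf A,\mathbf B)$, with $L_n(\mathbf A,\mathbf B)\in\Lambda_{\mathbf A,\mathbf B}$ homogeneous of bidegree $(n,n)$, be defined by $$\left(\mathrm{Exp}\Big[\sum_{\lambda\ne()}A_\lambda p_\lambda[X]\Big],\ \mathrm{Exp}\Big[\sum_{\lambda\neq()}B_\lambda p_\lambda[X]\Big]\right)_X=\mathrm{Exp}[L(\mathbf A,\mathbf B)],$$ where $(\cdot,\cdot)_X$ is the Hall inner product in $X$. Then $$L(\mathbf A,\mathbf B)=\sum_{\Gamma}\phi_{b(\Gamma)}(g(\Gamma))\,\frac{w(\Gamma)(\mathbf A,\mathbf B)}{\#\mathrm{Aut}(\Gamma)},$$ where the sum is over isomorphism classes of connected bipartite admissible$^*$ colored graphs $\Gamma$, $g(\Gamma)$ is the greatest common divisor of all the values of the coloring, $b(\Gamma)$ is the first Betti number, and $\phi_k(n)=\prod_{p\mid n,\ p\text{ prime}}(1-p^{-k})$.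
   Context: A $\lambda$-ring is a $\mathbb Q$-algebra with an action $F[G]$ of the ring of symmetric functions over $\mathbb Q$ in which the power sums $p_n$ act by ring endomorphisms, $p_1=\mathrm{id}$, $p_mp_n=p_{mn}$. Thus $\Lambda_{\mathbf A,\mathbf B}$ is the polynomial ring over $\mathbb Q$ in the symbols $p_k[A_\lambda],p_k[B_\lambda]$ ($k\ge1$, $\lambda$ a non-empty partition); it is bigraded with $p_k[A_\lambda]$ in degree $(k|\lambda|,0)$ and $p_k[B_\lambda]$ in degree $(0,k|\lambda|)$, and identities hold in the degree completion. $X$ is a further free $\lambda$-ring generator, i.e. $p_k[X]$ is the $k$-th power sum in an infinite alphabet, and $p_\lambda[X]=\prod_ip_{\lambda_i}[X]$. The plethystic exponential is $\mathrm{Exp}[G]=\exp\left(\sum_{k\ge1}p_k[G]/k\right)$. Graphs: a colored bipartite graph $\Gamma=(V,E,m)$ is a finite bipartite graph with vertex set $V=V_1\sqcup V_2$ (the ordered decomposition is part of the data), multiple edges allowed, each edge joining $V_1$ to $V_2$, together with a coloring $m:V\cup E\to\mathbb Z_{>0}$. It is admissible if $m(v)\mid m(e)$ whenever the edge $e$ is incident to the vertex $v$; admissible$^*$ means admissible without isolated vertices. The empty graph is not considered connected. $b(\Gamma)=\#E-\#V+1$ for connected $\Gamma$. $\mathrm{Aut}(\Gamma)$ is the group of permutations of vertices and edges preserving incidence, the coloring, and the decomposition $V=V_1\sqcup V_2$. For a vertex $v$, $\lambda^{(v)}$ is the partition whose parts are $m(e)/m(v)$, $e$ running over the edges incident to $v$.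 For a partition $\lambda$ of length $l$, $\mathrm{Aut}(\lambda)=\{\pi\in S_l:\lambda_{\pi(i)}=\lambda_i\ \forall i\}$. The weight is $$w(\Gamma)(\mathbf A,\mathbf B)=\frac{\prod_{v\in V}\#\mathrm{Aut}(\lambda^{(v)})\ \prod_{e\in E}m(e)}{\prod_{v\in V}m(v)}\ \prod_{v\in V_1}p_{m(v)}[A_{\lambda^{(v)}}]\ \prod_{v\in V_2}p_{m(v)}[B_{\lambda^{(v)}}].$$ *)

theory Defs
  imports
    Complex_Main
    "HOL-Library.Multiset"
    "HOL-Computational_Algebra.Primes"
    "HOL-Combinatorics.Permutations"
begin

section \<open>Formal power series with rational coefficients in arbitrarily many variables\<close>

text \<open>
  A monomial in the variables \<^typ>\<open>'v\<close> is a finite multiset of variables, and a formal power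
  series is an arbitrary rational function on monomials.  If the polynomial ring in \<^typ>\<open>'v\<close> is
  graded by positive degrees with finitely many variables in each degree, this is its degree
  completion; polynomials are the series of finite support.
\<close>

typedef 'v mps = "UNIV :: ('v multiset \<Rightarrow> rat) set"
  morphisms coeff Abs_mps
  by simp

setup_lifting type_definition_mps

lemma mps_eqI: "(\<And>m. coeff F m = coeff G m) \<Longrightarrow> F = G"
  by (metis coeff_inverse ext)

lemma finite_submultisets: "finite {a. a \<subseteq># (m :: 'v multiset)}"
proof (induction m)
  case empty
  then show ?case by simp
next
  case (add x m)
  have "{a. a \<subseteq># add_mset x m} \<subseteq> {a. a \<subseteq># m} \<union> add_mset x ` {a. a \<subseteq># m}"
  proof
    fix a assume a: "a \<in> {a. a \<subseteq># add_mset x m}"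
    show "a \<in> {a. a \<subseteq># m} \<union> add_mset x ` {a. a \<subseteq># m}"
    proof (cases "x \<in># a")
      case True
      then obtain b where "a = add_mset x b" by (meson mset_add)
      with a show ?thesis by auto
    next
      case False
      with a have "a \<subseteq># m"
        by (metis Diff_eq_empty_iff_mset add_mset_diff_bothsides diff_single_trivial mem_Collect_eq
            minus_add_mset_if_not_in_lhs)
      then show ?thesis by simp
    qed
  qed
  then show ?case using add.IH by (meson finite_UnI finite_imageI finite_subset)
qed

lemma finite_decompositions [simp]: "finite {(a, b). a + b = (m :: 'v multiset)}"
proof (rule finite_subset)
  show "{(a, b). a + b = m} \<subseteq> {a. a \<subseteq># m} \<times> {a. a \<subseteq># m}" by auto
  show "finite ({a. a \<subseteq># m} \<times> {a. a \<subseteq># m})" by (simp add: finite_submultisets)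
qed

instantiation mps :: (type) comm_ring_1
begin

lift_definition zero_mps :: "'v mps" is "\<lambda>m. 0" .
lift_definition one_mps :: "'v mps" is "\<lambda>m. if m = {#} then 1 else 0" .
lift_definition plus_mps :: "'v mps \<Rightarrow> 'v mps \<Rightarrow> 'v mps" is "\<lambda>F G m. F m + G m" .
lift_definition uminus_mps :: "'v mps \<Rightarrow> 'v mps" is "\<lambda>F m. - F m" .
lift_definition minus_mps :: "'v mps \<Rightarrow> 'v mps \<Rightarrow> 'v mps" is "\<lambda>F G m. F m - G m" .
lift_definition times_mps :: "'v mps \<Rightarrow> 'v mps \<Rightarrow> 'v mps" is
  "\<lambda>F G m. \<Sum>(a, b)\<in>{(a, b). a + b = m}. F a * G b" .

instance
proof
  fix F G H :: "'v mps"
  show "F + G + H = F + (G + H)" "F + G = G + F" "0 + F = F" "- F + F = 0" "F - G = F + - G"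
    by (transfer; simp add: fun_eq_iff)+
  show "(0 :: 'v mps) \<noteq> 1"
    by transfer (auto simp: fun_eq_iff)
  show "(F + G) * H = F * H + G * H"
    by transfer (simp add: fun_eq_iff sum.distrib[symmetric] distrib_right case_prod_unfold)
  show "F * G = G * F"
  proof (rule mps_eqI)
    fix m
    have "(\<Sum>(a, b)\<in>{(a, b). a + b = m}. coeff F a * coeff G b)
        = (\<Sum>(a, b)\<in>{(a, b). a + b = m}. coeff G a * coeff F b)"
      by (rule sum.reindex_bij_witness[where i = prod.swap and j = prod.swap])
        (auto simp: add.commute)
    then show "coeff (F * G) m = coeff (G * F) m" by (simp add: times_mps.rep_eq)
  qed
  show "1 * F = F"
  proof (rule mps_eqI)
    fix m
    have "coeff (1 * F) m = (\<Sum>(a, b)\<in>{({#}, m)}. coeff (1 :: 'v mps) a * coeff F b)"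
      unfolding times_mps.rep_eq
      by (rule sum.mono_neutral_right) (auto simp: one_mps.rep_eq split: if_splits)
    then show "coeff (1 * F) m = coeff F m" by (simp add: one_mps.rep_eq)
  qed
  show "F * G * H = F * (G * H)"
  proof (rule mps_eqI)
    fix m
    have "coeff (F * G * H) m = (\<Sum>x\<in>{(a, b). a + b = m}. \<Sum>y\<in>{(a, b). a + b = fst x}.
        coeff F (fst y) * coeff G (snd y) * coeff H (snd x))"
      by (simp add: times_mps.rep_eq case_prod_unfold sum_distrib_right)
    also have "\<dots> = (\<Sum>(x, y)\<in>(SIGMA x:{(a, b). a + b = m}. {(a, b). a + b = fst x}).
        coeff F (fst y) * coeff G (snd y) * coeff H (snd x))"
      by (subst sum.Sigma) (auto simp: finite_decompositions)
    also have "\<dots> = (\<Sum>(x, y)\<in>(SIGMA x:{(a, b). a + b = m}. {(a, b). a + b = snd x}).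
        coeff F (fst x) * (coeff G (fst y) * coeff H (snd y)))"
      by (rule sum.reindex_bij_witness[where
            j = "\<lambda>(x, y). ((fst y, snd y + snd x), (snd y, snd x))" and
            i = "\<lambda>(x, y). ((fst x + fst y, snd y), (fst x, fst y))"])
        (auto simp: ac_simps)
    also have "\<dots> = (\<Sum>x\<in>{(a, b). a + b = m}. \<Sum>y\<in>{(a, b). a + b = snd x}.
        coeff F (fst x) * (coeff G (fst y) * coeff H (snd y)))"
      by (subst sum.Sigma) (auto simp: finite_decompositions)
    also have "\<dots> = coeff (F * (G * H)) m"
      by (simp add: times_mps.rep_eq case_prod_unfold sum_distrib_left)
    finally show "coeff (F * G * H) m = coeff (F * (G * H)) m" .
  qed
qed

end

lift_definition mps_const :: "rat \<Rightarrow> 'v mps" is "\<lambda>c m. if m = {#} then c else 0" .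

lift_definition mps_var :: "'v \<Rightarrow> 'v mps" is "\<lambda>v m. if m = {#v#} then 1 else 0" .

definition mps_polynomial :: "'v mps \<Rightarrow> bool" where
  "mps_polynomial F \<longleftrightarrow> finite {m. coeff F m \<noteq> 0}"

text \<open>
  Convergence of an infinite sum in the degree completion: every coefficient receives only
  finitely many non-zero contributions.  \<open>mps_Sum\<close> is the sum of such a family (a coefficient
  with infinitely many contributions would get the junk value \<open>0\<close>).
\<close>

definition mps_summable :: "('i \<Rightarrow> 'v mps) \<Rightarrow> 'i set \<Rightarrow> bool" where
  "mps_summable f I \<longleftrightarrow> (\<forall>m. finite {i \<in> I. coeff (f i) m \<noteq> 0})"

lift_definition mps_Sum :: "('i \<Rightarrow> 'v mps) \<Rightarrow> 'i set \<Rightarrow> 'v mps" is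
  "\<lambda>f I m. \<Sum>i\<in>{i \<in> I. f i m \<noteq> 0}. f i m" .

definition mps_has_sum :: "('i \<Rightarrow> 'v mps) \<Rightarrow> 'i set \<Rightarrow> 'v mps \<Rightarrow> bool" where
  "mps_has_sum f I S \<longleftrightarrow> mps_summable f I \<and> mps_Sum f I = S"

text \<open>Used only for series without constant term, where the sum converges.\<close>

definition mps_exp :: "'v mps \<Rightarrow> 'v mps" where
  "mps_exp F = mps_Sum (\<lambda>n. mps_const (1 / fact n) * F ^ n) (UNIV :: nat set)"


section \<open>Completed free \<open>\<lambda>\<close>-rings over the rationals\<close>

text \<open>
  The completed free \<open>\<lambda>\<close>-ring on a set of generators \<^typ>\<open>'g\<close>: the variable \<open>(k, g)\<close> is the symbol
  \<open>p\<^sub>k[g]\<close>.  The index \<open>k\<close> has type \<^typ>\<open>num\<close>, the type of positive integers; \<open>numeral k\<close> is \<open>k\<close>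
  as an element of any numeric type, and \<^const>\<open>num_of_nat\<close> goes back from positive naturals.
\<close>

type_synonym 'g lring = "(num \<times> 'g) mps"

definition psym :: "num \<Rightarrow> 'g \<Rightarrow> 'g lring" where
  "psym k g = mps_var (k, g)"

text \<open>
  The action of \<open>p\<^sub>n\<close>, i.e. the substitution \<open>p\<^sub>k[g] \<mapsto> p\<^bsub>nk\<^esub>[g]\<close>.  The substitution is injective on
  monomials, so the sum below has at most one term.
\<close>

definition pscale :: "num \<Rightarrow> (num \<times> 'g) multiset \<Rightarrow> (num \<times> 'g) multiset" where
  "pscale n = image_mset (\<lambda>(k, g). (n * k, g))"

lift_definition adams :: "num \<Rightarrow> 'g lring \<Rightarrow> 'g lring" is
  "\<lambda>n F m. \<Sum>m' | pscale n m' = m. F m'" .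

definition Exp :: "'g lring \<Rightarrow> 'g lring" where
  "Exp G = mps_exp (mps_Sum (\<lambda>k. mps_const (1 / numeral k) * adams k G) UNIV)"

lemma num_mult_left_cancel: "(n :: num) * k = n * l \<longleftrightarrow> k = l"
  using nat_of_num_pos[of n] by (simp add: num_eq_iff nat_of_num_mult)

lemma num_mult_assoc: "(n :: num) * (k * l) = (n * k) * l"
  by (simp add: num_eq_iff nat_of_num_mult)

lemma num_One_mult: "num.One * k = k"
  by (simp add: num_eq_iff nat_of_num_mult)

lemma pscale_inj: "pscale n a = pscale n b \<longleftrightarrow> a = b"
proof -
  have "inj (\<lambda>(k, g :: 'g). (n * k, g))"
    by (auto simp: inj_def num_mult_left_cancel)
  then have "inj (pscale n :: (num \<times> 'g) multiset \<Rightarrow> _)"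
    unfolding pscale_def by (rule multiset.inj_map)
  then show ?thesis by (auto dest: injD)
qed

lemma pscale_add: "pscale n (a + b) = pscale n a + pscale n b"
  by (simp add: pscale_def)

lemma coeff_adams_pscale: "coeff (adams n F) (pscale n m) = coeff F m"
  by (simp add: adams.rep_eq pscale_inj)

lemma coeff_adams_outside: "m \<notin> range (pscale n) \<Longrightarrow> coeff (adams n F) m = 0"
proof -
  assume "m \<notin> range (pscale n)"
  then have "{m'. pscale n m' = m} = {}" by auto
  then show ?thesis by (simp add: adams.rep_eq)
qed

lemma pscale_eq_add:
  assumes "pscale n m = a + b"
  shows "\<exists>a' b'. a = pscale n a' \<and> b = pscale n b' \<and> m = a' + b'"
proof -
  from assms[unfolded pscale_def] have "image_mset (\<lambda>(k, g). (n * k, g)) m = a + b" .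
  from image_mset_eq_plusD[OF this] obtain a' b'
    where "m = a' + b'" "a = image_mset (\<lambda>(k, g). (n * k, g)) a'"
      "b = image_mset (\<lambda>(k, g). (n * k, g)) b'" by blast
  then show ?thesis unfolding pscale_def by blast
qed

lemma adams_psym: "adams n (psym k g) = psym (n * k) g"
proof (rule mps_eqI)
  fix m
  have eq: "{#(n * k, g)#} = pscale n {#(k, g)#}" by (simp add: pscale_def)
  show "coeff (adams n (psym k g)) m = coeff (psym (n * k) g) m"
  proof (cases "m \<in> range (pscale n)")
    case True
    then obtain m' where "m = pscale n m'" by auto
    then show ?thesis
      by (simp add: coeff_adams_pscale psym_def mps_var.rep_eq eq pscale_inj)
  next
    case False
    with eq have "m \<noteq> {#(n * k, g)#}" by auto
    with False show ?thesis
      by (simp add: coeff_adams_outside psym_def mps_var.rep_eq)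
  qed
qed

lemma adams_const: "adams n (mps_const c) = mps_const c"
proof (rule mps_eqI)
  fix m
  have eq: "{#} = pscale n {#}" by (simp add: pscale_def)
  show "coeff (adams n (mps_const c)) m = coeff (mps_const c) m"
  proof (cases "m \<in> range (pscale n)")
    case True
    then obtain m' where "m = pscale n m'" by auto
    then show ?thesis
      by (simp add: coeff_adams_pscale mps_const.rep_eq) (simp add: pscale_def)
  next
    case False
    with eq have "m \<noteq> {#}" by auto
    with False show ?thesis
      by (simp add: coeff_adams_outside mps_const.rep_eq)
  qed
qed

lemma adams_add: "adams n (F + G) = adams n F + adams n G"
  by (rule mps_eqI) (simp add: adams.rep_eq plus_mps.rep_eq sum.distrib)

lemma adams_mult: "adams n (F * G) = adams n F * adams n G"
proof (rule mps_eqI)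
  fix m
  show "coeff (adams n (F * G)) m = coeff (adams n F * adams n G) m"
  proof (cases "m \<in> range (pscale n)")
    case True
    then obtain m' where m: "m = pscale n m'" by auto
    have dec: "{(a, b). a + b = m} = (\<lambda>(a, b). (pscale n a, pscale n b)) ` {(a, b). a + b = m'}"
    proof (intro set_eqI iffI)
      fix x assume "x \<in> {(a, b). a + b = m}"
      then have "pscale n m' = fst x + snd x" using m by auto
      from pscale_eq_add[OF this] obtain a b
        where "fst x = pscale n a" "snd x = pscale n b" "m' = a + b" by blast
      then show "x \<in> (\<lambda>(a, b). (pscale n a, pscale n b)) ` {(a, b). a + b = m'}"
        by (intro image_eqI[of _ _ "(a, b)"]) (simp_all add: prod_eq_iff)
    next
      fix x assume "x \<in> (\<lambda>(a, b). (pscale n a, pscale n b)) ` {(a, b). a + b = m'}"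
      then show "x \<in> {(a, b). a + b = m}" by (auto simp: m pscale_add)
    qed
    have inj: "inj_on (\<lambda>(a, b). (pscale n a, pscale n b)) {(a, b). a + b = m'}"
      by (rule inj_onI) (simp add: case_prod_unfold pscale_inj prod_eq_iff)
    have "coeff (adams n F * adams n G) m =
        (\<Sum>x\<in>{(a, b). a + b = m}. coeff (adams n F) (fst x) * coeff (adams n G) (snd x))"
      by (simp add: times_mps.rep_eq case_prod_unfold)
    also have "\<dots> = (\<Sum>x\<in>{(a, b). a + b = m'}. coeff F (fst x) * coeff G (snd x))"
      unfolding dec by (subst sum.reindex[OF inj]) (simp add: case_prod_unfold coeff_adams_pscale)
    finally show ?thesis
      by (simp add: m coeff_adams_pscale times_mps.rep_eq case_prod_unfold)
  next
    case False
    then have "a \<notin> range (pscale n) \<or> b \<notin> range (pscale n)" if "a + b = m" for a b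
      using that by (auto simp: pscale_add[symmetric])
    then have "coeff (adams n F * adams n G) m = 0"
      unfolding times_mps.rep_eq by (intro sum.neutral) (auto dest: coeff_adams_outside)
    with False show ?thesis by (simp add: coeff_adams_outside)
  qed
qed

lemma adams_One: "adams num.One (F :: 'g lring) = F"
proof (rule mps_eqI)
  fix m :: "(num \<times> 'g) multiset"
  have "pscale num.One m = m" by (simp add: pscale_def num_One_mult case_prod_unfold)
  then show "coeff (adams num.One F) m = coeff F m" by (metis coeff_adams_pscale)
qed

lemma adams_adams: "adams n (adams k (F :: 'g lring)) = adams (n * k) F"
proof (rule mps_eqI)
  fix m
  have eq: "pscale (n * k) a = pscale n (pscale k a)" for a :: "(num \<times> 'g) multiset"
    by (simp add: pscale_def multiset.map_comp comp_def case_prod_unfold num_mult_assoc)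
  show "coeff (adams n (adams k F)) m = coeff (adams (n * k) F) m"
  proof (cases "m \<in> range (pscale (n * k))")
    case True
    then show ?thesis by (auto simp: coeff_adams_pscale) (auto simp: eq coeff_adams_pscale)
  next
    case False
    show ?thesis
    proof (cases "m \<in> range (pscale n)")
      case True
      then obtain m' where m: "m = pscale n m'" by auto
      with False have "m' \<notin> range (pscale k)" by (auto simp: eq)
      with False show ?thesis by (simp add: m coeff_adams_pscale coeff_adams_outside)
    qed (use False in \<open>simp add: coeff_adams_outside\<close>)
  qed
qed


section \<open>Partitions, the generators, and the Hall inner product\<close>

text \<open>A partition is the finite multiset of its (positive) parts.\<close>

type_synonym partition = "num multiset"

typedef nepartition = "{l :: partition. l \<noteq> {#}}"
  morphisms parts nepartition
  by (intro exI[of _ "{#num.One#}"]) simp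

definition psize :: "partition \<Rightarrow> nat" where
  "psize l = (\<Sum>i\<in>#l. numeral i)"

text \<open>The centraliser order \<open>\<Prod>\<^sub>i i\<^bsup>m\<^sub>i\<^esup> m\<^sub>i!\<close>, where \<open>m\<^sub>i\<close> is the multiplicity of the part \<open>i\<close>.\<close>

definition zee :: "partition \<Rightarrow> nat" where
  "zee l = (\<Prod>i\<in>set_mset l. numeral i ^ count l i * fact (count l i))"

definition partition_aut :: "partition \<Rightarrow> (nat \<Rightarrow> nat) set" where
  "partition_aut l = (let ps = rev (sorted_list_of_multiset l) in
     {\<pi>. \<pi> permutes {..<size l} \<and> (\<forall>i<size l. ps ! \<pi> i = ps ! i)})"

datatype gen = GenA nepartition | GenB nepartition

fun degA_sym :: "num \<times> gen \<Rightarrow> nat" where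
  "degA_sym (k, GenA l) = numeral k * psize (parts l)"
| "degA_sym (k, GenB l) = 0"

fun degB_sym :: "num \<times> gen \<Rightarrow> nat" where
  "degB_sym (k, GenA l) = 0"
| "degB_sym (k, GenB l) = numeral k * psize (parts l)"

definition bihomogeneous :: "nat \<Rightarrow> nat \<Rightarrow> gen lring \<Rightarrow> bool" where
  "bihomogeneous i j F \<longleftrightarrow>
     (\<forall>m. coeff F m \<noteq> 0 \<longrightarrow> (\<Sum>s\<in>#m. degA_sym s) = i \<and> (\<Sum>s\<in>#m. degB_sym s) = j)"

text \<open>Adjoining one further free generator \<open>X\<close>.\<close>

datatype 'g adjoin_X = Gen 'g | GenX

definition pX :: "partition \<Rightarrow> 'g adjoin_X lring" where
  "pX l = (\<Prod>i\<in>#l. psym i GenX)"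

text \<open>The coefficient of \<open>p\<^sub>\<mu>[X]\<close>.\<close>

lift_definition X_coeff :: "partition \<Rightarrow> 'g adjoin_X lring \<Rightarrow> 'g lring" is
  "\<lambda>\<mu> F m. F (image_mset (\<lambda>(k, g). (k, Gen g)) m + image_mset (\<lambda>k. (k, GenX)) \<mu>)" .

text \<open>
  The Hall inner product in \<open>X\<close>: the extension, linear in the remaining generators and continuous,
  of \<open>(p\<^sub>\<mu>[X], p\<^sub>\<nu>[X]) = z\<^sub>\<mu> \<delta>\<^bsub>\<mu>\<nu>\<^esub>\<close>.
\<close>

definition hall_X :: "'g adjoin_X lring \<Rightarrow> 'g adjoin_X lring \<Rightarrow> 'g lring" where
  "hall_X F G =
     mps_Sum (\<lambda>\<mu>. mps_const (of_nat (zee \<mu>)) * (X_coeff \<mu> F * X_coeff \<mu> G)) UNIV"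

definition generic_series :: "(nepartition \<Rightarrow> gen) \<Rightarrow> gen adjoin_X lring" where
  "generic_series C = mps_Sum (\<lambda>l. psym num.One (Gen (C l)) * pX (parts l)) UNIV"

definition is_L :: "gen lring \<Rightarrow> bool" where
  "is_L L \<longleftrightarrow>
     (\<exists>Ln. (\<forall>n\<ge>1. mps_polynomial (Ln n) \<and> bihomogeneous n n (Ln n)) \<and>
           mps_has_sum Ln {n :: nat. n \<ge> 1} L) \<and>
     hall_X (Exp (generic_series GenA)) (Exp (generic_series GenB)) = Exp L"


section \<open>Colored bipartite graphs\<close>

text \<open>
  The edge \<open>e\<close> joins \<open>end1 e\<close>, in the first vertex class, to \<open>end2 e\<close>, in the second.  The values of
  the four functions outside the vertices and edges of the graph are irrelevant.
\<close>

record ('v, 'e) cbgraph =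
  verts1 :: "'v set"
  verts2 :: "'v set"
  edges :: "'e set"
  end1 :: "'e \<Rightarrow> 'v"
  end2 :: "'e \<Rightarrow> 'v"
  vcol :: "'v \<Rightarrow> nat"
  ecol :: "'e \<Rightarrow> nat"

definition verts :: "('v, 'e) cbgraph \<Rightarrow> 'v set" where
  "verts \<Gamma> = verts1 \<Gamma> \<union> verts2 \<Gamma>"

definition colored_bipartite :: "('v, 'e) cbgraph \<Rightarrow> bool" where
  "colored_bipartite \<Gamma> \<longleftrightarrow>
     finite (verts \<Gamma>) \<and> finite (edges \<Gamma>) \<and> verts1 \<Gamma> \<inter> verts2 \<Gamma> = {} \<and>
     (\<forall>e\<in>edges \<Gamma>. end1 \<Gamma> e \<in> verts1 \<Gamma> \<and> end2 \<Gamma> e \<in> verts2 \<Gamma>) \<and>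
     (\<forall>v\<in>verts \<Gamma>. vcol \<Gamma> v > 0) \<and> (\<forall>e\<in>edges \<Gamma>. ecol \<Gamma> e > 0)"

definition incident_edges :: "('v, 'e) cbgraph \<Rightarrow> 'v \<Rightarrow> 'e set" where
  "incident_edges \<Gamma> v = {e \<in> edges \<Gamma>. end1 \<Gamma> e = v \<or> end2 \<Gamma> e = v}"

definition admissible :: "('v, 'e) cbgraph \<Rightarrow> bool" where
  "admissible \<Gamma> \<longleftrightarrow> (\<forall>v\<in>verts \<Gamma>. \<forall>e\<in>incident_edges \<Gamma> v. vcol \<Gamma> v dvd ecol \<Gamma> e)"

definition admissible_star :: "('v, 'e) cbgraph \<Rightarrow> bool" where
  "admissible_star \<Gamma> \<longleftrightarrow> admissible \<Gamma> \<and> (\<forall>v\<in>verts \<Gamma>. incident_edges \<Gamma> v \<noteq> {})"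

definition adjacency :: "('v, 'e) cbgraph \<Rightarrow> ('v \<times> 'v) set" where
  "adjacency \<Gamma> =
     {(u, v). \<exists>e\<in>edges \<Gamma>. (end1 \<Gamma> e = u \<and> end2 \<Gamma> e = v) \<or> (end1 \<Gamma> e = v \<and> end2 \<Gamma> e = u)}"

definition connected_graph :: "('v, 'e) cbgraph \<Rightarrow> bool" where
  "connected_graph \<Gamma> \<longleftrightarrow>
     verts \<Gamma> \<noteq> {} \<and> (\<forall>u\<in>verts \<Gamma>. \<forall>v\<in>verts \<Gamma>. (u, v) \<in> (adjacency \<Gamma>)\<^sup>*)"

definition betti :: "('v, 'e) cbgraph \<Rightarrow> int" where
  "betti \<Gamma> = int (card (edges \<Gamma>)) - int (card (verts \<Gamma>)) + 1"

definition color_gcd :: "('v, 'e) cbgraph \<Rightarrow> nat" where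
  "color_gcd \<Gamma> = Gcd (vcol \<Gamma> ` verts \<Gamma> \<union> ecol \<Gamma> ` edges \<Gamma>)"

definition graph_iso ::
  "('v, 'e) cbgraph \<Rightarrow> ('w, 'f) cbgraph \<Rightarrow> ('v \<Rightarrow> 'w) \<Rightarrow> ('e \<Rightarrow> 'f) \<Rightarrow> bool" where
  "graph_iso \<Gamma> \<Delta> \<sigma> \<tau> \<longleftrightarrow>
     bij_betw \<sigma> (verts \<Gamma>) (verts \<Delta>) \<and> bij_betw \<tau> (edges \<Gamma>) (edges \<Delta>) \<and>
     \<sigma> ` verts1 \<Gamma> = verts1 \<Delta> \<and> \<sigma> ` verts2 \<Gamma> = verts2 \<Delta> \<and>
     (\<forall>e\<in>edges \<Gamma>. end1 \<Delta> (\<tau> e) = \<sigma> (end1 \<Gamma> e) \<and> end2 \<Delta> (\<tau> e) = \<sigma> (end2 \<Gamma> e)) \<and>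
     (\<forall>v\<in>verts \<Gamma>. vcol \<Delta> (\<sigma> v) = vcol \<Gamma> v) \<and> (\<forall>e\<in>edges \<Gamma>. ecol \<Delta> (\<tau> e) = ecol \<Gamma> e)"

definition graph_aut :: "('v, 'e) cbgraph \<Rightarrow> (('v \<Rightarrow> 'v) \<times> ('e \<Rightarrow> 'e)) set" where
  "graph_aut \<Gamma> =
     {(\<sigma>, \<tau>). \<sigma> permutes verts \<Gamma> \<and> \<tau> permutes edges \<Gamma> \<and> graph_iso \<Gamma> \<Gamma> \<sigma> \<tau>}"

text \<open>The partition \<open>\<lambda>\<^sup>(\<^sup>v\<^sup>)\<close>; the quotients are exact for admissible graphs.\<close>

definition vpartition :: "('v, 'e) cbgraph \<Rightarrow> 'v \<Rightarrow> partition" where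
  "vpartition \<Gamma> v =
     image_mset (\<lambda>e. num_of_nat (ecol \<Gamma> e div vcol \<Gamma> v)) (mset_set (incident_edges \<Gamma> v))"

definition weight :: "('v, 'e) cbgraph \<Rightarrow> gen lring" where
  "weight \<Gamma> =
     mps_const
       ((\<Prod>v\<in>verts \<Gamma>. of_nat (card (partition_aut (vpartition \<Gamma> v)))) *
        (\<Prod>e\<in>edges \<Gamma>. of_nat (ecol \<Gamma> e)) / (\<Prod>v\<in>verts \<Gamma>. of_nat (vcol \<Gamma> v))) *
     (\<Prod>v\<in>verts1 \<Gamma>. psym (num_of_nat (vcol \<Gamma> v)) (GenA (nepartition (vpartition \<Gamma> v)))) *
     (\<Prod>v\<in>verts2 \<Gamma>. psym (num_of_nat (vcol \<Gamma> v)) (GenB (nepartition (vpartition \<Gamma> v))))"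

definition phi :: "int \<Rightarrow> nat \<Rightarrow> rat" where
  "phi k n = (\<Prod>p\<in>{p. prime p \<and> p dvd n}. 1 - of_nat p powi (- k))"

definition graph_term :: "('v, 'e) cbgraph \<Rightarrow> gen lring" where
  "graph_term \<Gamma> =
     mps_const (phi (betti \<Gamma>) (color_gcd \<Gamma>) / of_nat (card (graph_aut \<Gamma>))) * weight \<Gamma>"

text \<open>
  Every finite graph is isomorphic to one whose vertices and edges are natural numbers, so the
  isomorphism classes may be formed among these.
\<close>

definition conn_graphs :: "(nat, nat) cbgraph set" where
  "conn_graphs = {\<Gamma>. colored_bipartite \<Gamma> \<and> connected_graph \<Gamma> \<and> admissible_star \<Gamma>}"

definition iso_rel :: "((nat, nat) cbgraph \<times> (nat, nat) cbgraph) set" where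
  "iso_rel = {(\<Gamma>, \<Delta>). \<Gamma> \<in> conn_graphs \<and> \<Delta> \<in> conn_graphs \<and> (\<exists>\<sigma> \<tau>. graph_iso \<Gamma> \<Delta> \<sigma> \<tau>)}"

definition iso_classes :: "(nat, nat) cbgraph set set" where
  "iso_classes = conn_graphs // iso_rel"

text \<open>\<^const>\<open>graph_term\<close> is invariant under isomorphism, so any representative may be used.\<close>

definition class_term :: "(nat, nat) cbgraph set \<Rightarrow> gen lring" where
  "class_term C = graph_term (SOME \<Gamma>. \<Gamma> \<in> C)"

end

(*
  Taking logarithms with the Euler derivation, Exp of the generic series expands over multisets of
  symbols p_k[A_l] (resp. p_k[B_l]) with explicit coefficients, so the Hall product of the two
  generic series has as coefficient of a monomial m the number of gluings (color-preserving
  matchings of the half-edges of labelled vertices with symbols m) times an explicit factor.  The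
  exponential formula then identifies its logarithm with the series of connected gluings.  Dividing
  all colors by k multiplies the coefficient of that series by a power of k governed by the Betti
  number, and the divisor sum of d^(-b) phi_b(n/d) being 1 inverts the sum over Adams operations.
  Finally, a double count of isomorphisms between a graph and the graphs of gluings (an
  orbit-stabilizer argument) turns connected gluings into isomorphism classes weighted by 1/#Aut.
*)
theory Submission
  imports Defs
begin

text \<open>Automorphisms of graphs are awkward to follow through a formal logarithm, so the
  logarithm is taken while vertices and half-edges are still labelled. What permits this is the
  factorization of \<open>zee\<close> into the product of the parts and \<open>mfact\<close>: when
  both sides have the same colors, \<open>mfact\<close> of the color multiset is the number of
  matchings, and the product of the parts becomes the product of the edge colors. The labels are
  paid for by \<open>mfact m\<close> (vertices with equal symbols) and \<open>aut_prod m\<close>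
  (half-edges with equal parts at a vertex).

  A monomial alone fixes the number of vertices, the number of edges and the gcd of the colors of
  every connected graph contributing to it. Hence phi can be inserted coefficientwise, before any
  graph is mentioned. Its origin is arithmetic: passing back from the k-fold multiple of a monomial
  costs k^(#V - #E), and Exp contributes 1/k, together k^(-b); phi_b solves the resulting divisor
  equation, which for a prime power is a telescoping geometric sum.\<close>

section \<open>Multisets\<close>

text \<open>The order of the stabilizer of a word with value multiset \<open>M\<close> under
  permutations of the positions. It serves both as the denominator of coefficients of exponentials
  and as a count of matchings.\<close>

definition mfact :: "'a multiset \<Rightarrow> nat" where
  "mfact M = (\<Prod>x\<in>set_mset M. fact (count M x))"

lemma mfact_empty [simp]: "mfact {#} = 1"
  by (simp add: mfact_def)

lemma mfact_eq_prod: "finite A \<Longrightarrow> set_mset M \<subseteq> A \<Longrightarrow> mfact M = (\<Prod>x\<in>A. fact (count M x))"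
  unfolding mfact_def by (rule prod.mono_neutral_left) (auto simp: not_in_iff)

lemma mfact_add_mset: "mfact (add_mset x M) = Suc (count M x) * mfact M"
proof -
  let ?A = "insert x (set_mset M)"
  have "mfact (add_mset x M) = (\<Prod>y\<in>?A. fact (count (add_mset x M) y))"
    by (rule mfact_eq_prod) auto
  also have "\<dots> = fact (Suc (count M x)) * (\<Prod>y\<in>?A - {x}. fact (count M y))"
    by (subst prod.remove[of _ x], simp, simp, rule arg_cong2[of _ _ _ _ "(*)"], simp, rule prod.cong) auto
  also have "\<dots> = Suc (count M x) * (\<Prod>y\<in>?A. fact (count M y))"
    by (subst (2) prod.remove[of _ x]) (auto simp: algebra_simps)
  also have "(\<Prod>y\<in>?A. fact (count M y)) = mfact M"
    by (rule mfact_eq_prod[symmetric]) auto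
  finally show ?thesis .
qed

lemma mfact_pos [simp]: "mfact M > 0"
  by (simp add: mfact_def prod_pos)

lemma mfact_image_inj: "inj f \<Longrightarrow> mfact (image_mset f M) = mfact M"
proof (induction M)
  case (add x M)
  have "count (image_mset f M) (f x) = count M x"
    using add.prems by (simp add: count_image_mset vimage_def inj_eq not_in_iff Int_insert_left)
  then show ?case using add by (simp add: mfact_add_mset)
qed simp

lemma sum_mset_eq_sum_count: "(\<Sum>x\<in>#M. g x) = (\<Sum>x\<in>set_mset M. count M x * (g x :: nat))"
proof (induction M)
  case (add y M)
  have "(\<Sum>x\<in>set_mset (add_mset y M). count (add_mset y M) x * g x) =
      (\<Sum>x\<in>insert y (set_mset M). count M x * g x + (if x = y then g y else 0))"
    by (intro sum.cong) auto
  also have "(\<Sum>x\<in>insert y (set_mset M). count M x * g x) = (\<Sum>x\<in>set_mset M. count M x * g x)"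
    by (rule sum.mono_neutral_right) (auto simp: not_in_iff)
  then have "(\<Sum>x\<in>insert y (set_mset M). count M x * g x + (if x = y then g y else 0)) =
      (\<Sum>x\<in>set_mset M. count M x * g x) + g y"
    by (simp add: sum.distrib)
  finally show ?case using add by simp
qed simp

section \<open>Exponentials and logarithms over multiset monomials\<close>

section \<open>Arithmetic of formal power series\<close>

lemma coeff_add [simp]: "coeff (F + G) m = coeff F m + coeff G m"
  by (simp add: plus_mps.rep_eq)

lemma coeff_1: "coeff 1 m = (if m = {#} then 1 else 0)"
  by (simp add: one_mps.rep_eq)

text \<open>A decomposition of \<open>m\<close> is determined by one summand. This is the form in
  which the recursions below are written.\<close>

lemma coeff_mult: "coeff (F * G) m = (\<Sum>b | b \<subseteq># m. coeff F (m - b) * coeff G b)"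
  unfolding times_mps.rep_eq case_prod_unfold
  by (rule sum.reindex_bij_witness[where i = "\<lambda>b. (m - b, b)" and j = snd]) auto

lemma coeff_mult_swap: "coeff (F * G) m = (\<Sum>b | b \<subseteq># m. coeff F b * coeff G (m - b))"
  using coeff_mult[of G F m] by (simp add: mult.commute)

lemma coeff_const_mult [simp]: "coeff (mps_const c * F) m = c * coeff F m"
proof -
  have "coeff (mps_const c * F) m = (\<Sum>b\<in>{{#}}. coeff (mps_const c) b * coeff F (m - b))"
    unfolding coeff_mult_swap
    by (rule sum.mono_neutral_right) (auto simp: mps_const.rep_eq finite_submultisets)
  then show ?thesis by (simp add: mps_const.rep_eq)
qed

lemma mps_const_1 [simp]: "mps_const 1 = 1"
  by (rule mps_eqI) (simp add: mps_const.rep_eq coeff_1)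

lemma mps_const_add: "mps_const a + mps_const b = mps_const (a + b)"
  by (rule mps_eqI) (simp add: mps_const.rep_eq)

lemma coeff_mps_Sum: "coeff (mps_Sum f I) m = (\<Sum>i\<in>{i \<in> I. coeff (f i) m \<noteq> 0}. coeff (f i) m)"
  by (simp add: mps_Sum.rep_eq)

lemma coeff_mps_Sum_finite:
  assumes "finite A" "A \<subseteq> I" "\<And>i. i \<in> I - A \<Longrightarrow> coeff (f i) m = 0"
  shows "coeff (mps_Sum f I) m = (\<Sum>i\<in>A. coeff (f i) m)"
  unfolding coeff_mps_Sum by (rule sum.mono_neutral_left) (use assms in auto)

lemma coeff_mps_var_mult:
  "coeff (mps_var v * F) m = (if v \<in># m then coeff F (m - {#v#}) else 0)"
proof -
  have "coeff (mps_var v * F) m =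
      (\<Sum>b\<in>(if v \<in># m then {{#v#}} else {}). coeff (mps_var v) b * coeff F (m - b))"
    unfolding coeff_mult_swap
    by (rule sum.mono_neutral_right)
      (auto simp: mps_var.rep_eq finite_submultisets split: if_splits)
  then show ?thesis by (simp add: mps_var.rep_eq)
qed

lemma coeff_prod_mset_var:
  "coeff (\<Prod>x\<in>#N. mps_var (f x)) m = (if m = image_mset f N then 1 else 0)"
proof (induction N arbitrary: m)
  case (add x N)
  show ?case
    by (auto simp: coeff_mps_var_mult add.IH) (metis insert_DiffM)
qed (simp add: coeff_1)

section \<open>The exponential of a formal power series\<close>

text \<open>The Euler derivation; it turns \<open>F = exp P\<close> into the recursion \<open>E F = F \<sqdot> E P\<close> on coefficients.\<close>

lift_definition mps_euler :: "'v mps \<Rightarrow> 'v mps" is "\<lambda>F m. of_nat (size m) * F m" .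

lemma mps_euler_mult: "mps_euler (F * G) = mps_euler F * G + F * mps_euler G"
proof (rule mps_eqI)
  fix m
  have "of_nat (size m) * coeff F (m - b) * coeff G b =
      of_nat (size (m - b)) * coeff F (m - b) * coeff G b +
      coeff F (m - b) * (of_nat (size b) * coeff G b)" if "b \<subseteq># m" for b
  proof -
    have "(of_nat (size m) :: rat) = of_nat (size (m - b)) + of_nat (size b)"
      using that by (metis of_nat_add size_union subset_mset.diff_add)
    then show ?thesis by (simp add: algebra_simps)
  qed
  then show "coeff (mps_euler (F * G)) m = coeff (mps_euler F * G + F * mps_euler G) m"
    by (simp add: mps_euler.rep_eq coeff_mult sum_distrib_left sum.distrib[symmetric] mult.assoc)
qed

lemma mps_euler_power:
  "mps_euler (P ^ Suc n) = mps_const (of_nat (Suc n)) * (P ^ n * mps_euler P)"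
proof (induction n)
  case (Suc n)
  have "mps_euler (P ^ Suc (Suc n)) =
      mps_euler P * P ^ Suc n + P * (mps_const (of_nat (Suc n)) * (P ^ n * mps_euler P))"
    by (subst power_Suc, subst mps_euler_mult, subst Suc.IH) simp
  also have "\<dots> = (mps_const 1 + mps_const (of_nat (Suc n))) * (P ^ Suc n * mps_euler P)"
    by (simp add: algebra_simps)
  finally show ?case unfolding mps_const_add by (simp only: of_nat_Suc of_nat_1 add.commute)
qed simp

text \<open>Without constant term, every factor raises the order by at least one. Hence the
  exponential series is a finite sum in each coefficient.\<close>

lemma coeff_power_eq_0:
  assumes "coeff P {#} = 0" and "size m < n"
  shows "coeff (P ^ n) m = 0"
  using assms(2)
proof (induction n arbitrary: m)
  case (Suc n)
  have "coeff P (m - b) * coeff (P ^ n) b = 0" if "b \<subseteq># m" for b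
  proof (cases "b = m")
    case False
    then have "size b < size m"
      using that by (simp add: mset_subset_size subset_mset.le_neq_trans)
    with Suc show ?thesis by simp
  qed (use assms in simp)
  then show ?case unfolding power_Suc coeff_mult by (intro sum.neutral) auto
qed simp

text \<open>The cutoff \<open>N\<close> is left free so that a monomial and all its submonomials can
  share one.\<close>

lemma coeff_mps_exp:
  assumes "coeff P {#} = 0" and "size m < N"
  shows "coeff (mps_exp P) m = (\<Sum>n<N. coeff (P ^ n) m / fact n)"
proof -
  have "coeff (mps_exp P) m = (\<Sum>n<N. coeff (mps_const (1 / fact n) * P ^ n) m)"
    unfolding mps_exp_def
    by (rule coeff_mps_Sum_finite) (use assms in \<open>auto intro!: coeff_power_eq_0\<close>)
  then show ?thesis by simp
qed

lemma coeff_mps_exp_empty: "coeff P {#} = 0 \<Longrightarrow> coeff (mps_exp P) {#} = 1"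
  by (simp add: coeff_mps_exp[where N = 1] coeff_1)

text \<open>This is the coefficient of \<open>m\<close> in E (exp P) = exp P * E P for the Euler
  derivation E. It replaces the exponential series by a recursion in which no powers of
  \<open>P\<close> occur.\<close>

lemma coeff_mps_exp_rec:
  assumes "coeff P {#} = 0"
  shows "of_nat (size m) * coeff (mps_exp P) m =
    (\<Sum>b | b \<subseteq># m. coeff (mps_exp P) (m - b) * (of_nat (size b) * coeff P b))"
proof -
  have exp_upto: "coeff (mps_exp P) a = (\<Sum>n<Suc (size m). coeff (P ^ n) a / fact n)"
    if "a \<subseteq># m" for a
    using that by (intro coeff_mps_exp assms) (simp add: size_mset_mono le_imp_less_Suc)
  have "of_nat (size m) * coeff (mps_exp P) m =
      (\<Sum>n<Suc (Suc (size m)). coeff (mps_euler (P ^ n)) m / fact n)"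
    by (subst coeff_mps_exp[OF assms, of m "Suc (Suc (size m))"])
      (simp_all add: sum_distrib_left mps_euler.rep_eq algebra_simps)
  \<comment> \<open>The term n = 0 drops out because the derivation kills 1; the preceding cutoff is
    one larger to leave room for this shift.\<close>
  also have "\<dots> = (\<Sum>n<Suc (size m). coeff (mps_euler (P ^ Suc n)) m / fact (Suc n))"
    by (subst sum.lessThan_Suc_shift) (simp add: mps_euler.rep_eq coeff_1)
  also have "\<dots> = (\<Sum>n<Suc (size m). coeff (P ^ n * mps_euler P) m / fact n)"
    unfolding mps_euler_power coeff_const_mult by (intro sum.cong refl) (simp add: field_simps del: of_nat_Suc)
  also have "\<dots> = (\<Sum>b | b \<subseteq># m. \<Sum>n<Suc (size m).
      coeff (P ^ n) (m - b) / fact n * (of_nat (size b) * coeff P b))"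
    by (subst sum.swap) (simp add: coeff_mult mps_euler.rep_eq sum_divide_distrib)
  also have "\<dots> = (\<Sum>b | b \<subseteq># m. coeff (mps_exp P) (m - b) * (of_nat (size b) * coeff P b))"
    by (intro sum.cong refl) (simp only: exp_upto sum_distrib_right diff_subset_eq_self)
  finally show ?thesis .
qed

text \<open>The term for empty \<open>b\<close> has the factor \<open>size b = 0\<close>, so the
  recursion at \<open>m\<close> involves \<open>F\<close> only at strictly smaller monomials, and
  \<open>size m\<close> is invertible over the rationals.\<close>

lemma mps_exp_eqI:
  assumes "coeff P {#} = 0" and "coeff F {#} = 1"
    and rec: "\<And>m. m \<noteq> {#} \<Longrightarrow> of_nat (size m) * coeff F m =
      (\<Sum>b | b \<subseteq># m. coeff F (m - b) * (of_nat (size b) * coeff P b))"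
  shows "mps_exp P = F"
proof (rule mps_eqI)
  fix m
  show "coeff (mps_exp P) m = coeff F m"
  proof (induction m rule: measure_induct_rule[of size])
    case (less m)
    show ?case
    proof (cases "m = {#}")
      case False
      have "coeff (mps_exp P) (m - b) * (of_nat (size b) * coeff P b) =
          coeff F (m - b) * (of_nat (size b) * coeff P b)" if "b \<subseteq># m" for b
      proof (cases "b = {#}")
        case False
        with that have "size (m - b) < size m"
          by (metis add_diff_cancel_right' diff_less nonempty_has_size size_Diff_submset
              size_mset_mono subset_mset.le_zero_eq zero_less_iff_neq_zero)
        then show ?thesis by (simp add: less)
      qed simp
      then have "of_nat (size m) * coeff (mps_exp P) m = of_nat (size m) * coeff F m"
        unfolding rec[OF False] coeff_mps_exp_rec[OF assms(1)] by (intro sum.cong) auto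
      with False show ?thesis by simp
    qed (simp add: assms coeff_mps_exp_empty)
  qed
qed

lemma sum_submultisets_remove:
  "(\<Sum>b | b \<subseteq># m. g b) = g m + (\<Sum>b | b \<subset># m. (g b :: 'b :: comm_monoid_add))"
proof -
  have "{b. b \<subseteq># m} = insert m {b. b \<subset># m}" by auto
  moreover have "finite {b. b \<subset># m}"
    by (rule finite_subset[OF _ finite_submultisets[of m]]) auto
  ultimately show ?thesis by simp
qed

text \<open>The term \<open>b = m\<close> of the recursion is \<open>size m * coeff P m\<close>, as
  an exponential has constant term 1; the other terms involve \<open>P\<close> only at proper
  submultisets. So the recursion can be solved for \<open>P\<close>.\<close>

lemma mps_exp_inj:
  assumes "coeff P {#} = 0" "coeff Q {#} = 0" "mps_exp P = mps_exp Q"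
  shows "P = Q"
proof (rule mps_eqI)
  fix m
  show "coeff P m = coeff Q m"
  proof (induction m rule: measure_induct_rule[of size])
    case (less m)
    let ?s = "\<lambda>P b. coeff (mps_exp P) (m - b) * (of_nat (size b) * coeff P b)"
    have "(\<Sum>b | b \<subset># m. ?s P b) = (\<Sum>b | b \<subset># m. ?s Q b)"
      by (intro sum.cong refl) (simp add: less assms mset_subset_size)
    moreover have "(\<Sum>b | b \<subseteq># m. ?s P b) = (\<Sum>b | b \<subseteq># m. ?s Q b)"
      using coeff_mps_exp_rec[OF assms(1), of m] coeff_mps_exp_rec[OF assms(2), of m] assms(3)
      by simp
    ultimately have "of_nat (size m) * coeff P m = of_nat (size m) * coeff Q m"
      using assms by (simp add: sum_submultisets_remove coeff_mps_exp_empty)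
    then show ?case using assms by (cases "m = {#}") auto
  qed
qed

text \<open>The Euler recursion solved for its term \<open>b = m\<close>. At the empty monomial
  division by zero leaves the junk value \<open>coeff F {#}\<close>; it enters the recursion only
  with the factor \<open>size b = 0\<close>, and \<open>mps_log_exists\<close> puts 0 in its
  place.\<close>

function mps_log_coeff :: "'v mps \<Rightarrow> 'v multiset \<Rightarrow> rat" where
  "mps_log_coeff F m = coeff F m -
     (\<Sum>b | b \<subset># m. coeff F (m - b) * (of_nat (size b) * mps_log_coeff F b)) / of_nat (size m)"
  by auto
termination
  by (relation "measure (\<lambda>(F, m). size m)") (auto simp: mset_subset_size)

declare mps_log_coeff.simps [simp del]

lemma mps_log_exists:
  assumes "coeff F {#} = 1"
  shows "\<exists>P. coeff P {#} = 0 \<and> mps_exp P = F"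
proof -
  define P where "P = Abs_mps (\<lambda>m. if m = {#} then 0 else mps_log_coeff F m)"
  have P: "coeff P m = (if m = {#} then 0 else mps_log_coeff F m)" for m
    by (simp add: P_def Abs_mps_inverse)
  have "mps_exp P = F"
  proof (rule mps_exp_eqI)
    fix m :: "'a multiset"
    assume m: "m \<noteq> {#}"
    have "(\<Sum>b | b \<subset># m. coeff F (m - b) * (of_nat (size b) * mps_log_coeff F b)) =
        (\<Sum>b | b \<subset># m. coeff F (m - b) * (of_nat (size b) * coeff P b))"
      by (intro sum.cong) (auto simp: P)
    with m show "of_nat (size m) * coeff F m =
        (\<Sum>b | b \<subseteq># m. coeff F (m - b) * (of_nat (size b) * coeff P b))"
      by (simp add: sum_submultisets_remove assms P mps_log_coeff.simps[of F m] field_simps)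
  qed (simp_all add: P assms)
  then show ?thesis by (intro exI[of _ P]) (simp add: P)
qed

text \<open>The exponential of a sum of terms c x * u^(f x) is the product of their exponentials,
  each contributing (c x)^n / n!. Injectivity on multisets says that the monomials
  \<open>f x\<close> are independent, so a product of them arises from one choice of exponents. The
  proof verifies the Euler recursion for this closed form, which avoids infinite products.\<close>

lemma coeff_mps_exp_monomials:
  fixes f :: "'x \<Rightarrow> 'v multiset"
  assumes inj: "\<And>M N. (\<Sum>x\<in>#M. f x) = (\<Sum>x\<in>#N. f x) \<Longrightarrow> M = N"
    and P: "\<And>x. coeff P (f x) = c x" "\<And>m. m \<notin> range f \<Longrightarrow> coeff P m = 0"
  shows "coeff (mps_exp P) (\<Sum>x\<in>#M. f x) = (\<Prod>x\<in>#M. c x) / of_nat (mfact M)"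
    and "m \<notin> range (\<lambda>M. \<Sum>x\<in>#M. f x) \<Longrightarrow> coeff (mps_exp P) m = 0"
proof -
  let ?f = "\<lambda>M. \<Sum>x\<in>#M. f x"
  have inj_f: "inj ?f" by (rule injI) (rule inj)
  then have inv_f [simp]: "inv ?f (?f M) = M" for M by (rule inv_f_f)
  define F where "F = Abs_mps (\<lambda>m. if m \<in> range ?f
    then (\<Prod>x\<in>#inv ?f m. c x) / of_nat (mfact (inv ?f m)) else 0)"
  have coeff_F: "coeff F m = (if m \<in> range ?f
    then (\<Prod>x\<in>#inv ?f m. c x) / of_nat (mfact (inv ?f m)) else 0)" for m
    by (simp add: F_def Abs_mps_inverse)
  have F: "coeff F (?f M) = (\<Prod>x\<in>#M. c x) / of_nat (mfact M)" for M
    by (simp add: coeff_F)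
  have F0: "coeff F m = 0" if "m \<notin> range ?f" for m
    using that by (simp add: coeff_F)
  have ne: "f x \<noteq> {#}" for x
    using inj[of "{#x#}" "{#}"] by auto
  have inj_single: "inj f"
    by (rule injI) (use inj[of "{#_#}" "{#_#}"] in auto)
  have "mps_exp P = F"
  proof (rule mps_exp_eqI)
    have "{#} \<notin> range f" using ne by (metis rangeE)
    then show "coeff P {#} = 0" by (rule P(2))
    show "coeff F {#} = 1" using F[of "{#}"] by simp
  next
    fix m :: "'v multiset"
    let ?s = "\<lambda>b. coeff F (m - b) * (of_nat (size b) * coeff P b)"
    \<comment> \<open>A nonzero term must split off one monomial \<open>b = f x\<close> from
      \<open>m\<close> and leave a product of such monomials.\<close>
    have vanish: "?s b = 0" if "b \<subseteq># m" "\<And>x N. b = f x \<Longrightarrow> m \<noteq> ?f (add_mset x N)" for b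
    proof (rule ccontr)
      assume nz: "?s b \<noteq> 0"
      then obtain x where x: "b = f x" using P(2)[of b] by auto
      from nz obtain N where N: "m - b = ?f N" using F0[of "m - b"] by auto
      have "m = ?f (add_mset x N)"
        using that(1) x N by (metis image_mset_add_mset subset_mset.add_diff_inverse sum_mset.add_mset)
      with that(2) x show False by blast
    qed
    show "of_nat (size m) * coeff F m = (\<Sum>b | b \<subseteq># m. ?s b)"
    proof (cases "m \<in> range ?f")
      case True
      then obtain M where M: "m = ?f M" by auto
      have sub: "f ` set_mset M \<subseteq> {b. b \<subseteq># m}"
        unfolding M by (auto dest!: multi_member_split)
      have "(\<Sum>b | b \<subseteq># m. ?s b) = (\<Sum>b\<in>f ` set_mset M. ?s b)"
      proof (rule sum.mono_neutral_right[OF finite_submultisets sub], safe)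
        fix b assume b: "b \<notin> f ` set_mset M" "b \<subseteq># m"
        show "?s b = 0"
        proof (rule vanish[OF b(2)])
          fix x N assume x: "b = f x"
          show "m \<noteq> ?f (add_mset x N)"
          proof
            assume "m = ?f (add_mset x N)"
            then have "M = add_mset x N" unfolding M by (rule inj)
            with b(1) x show False by auto
          qed
        qed
      qed
      also have "\<dots> = (\<Sum>x\<in>set_mset M. ?s (f x))"
        by (subst sum.reindex) (auto intro: inj_on_subset[OF inj_single])
      \<comment> \<open>Removing one copy of \<open>x\<close> divides the factorial denominator by
        \<open>count M x\<close>. Weighting by \<open>size (f x)\<close> and summing over
        \<open>x\<close> then rebuilds \<open>size m\<close>.\<close>
      also have "\<dots> = (\<Sum>x\<in>set_mset M. of_nat (count M x) * (of_nat (size (f x)) * coeff F m))"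
      proof (rule sum.cong[OF refl])
        fix x assume "x \<in># M"
        then obtain N where N: "M = add_mset x N" by (meson multi_member_split)
        have "coeff F m = c x * (\<Prod>y\<in>#N. c y) / (of_nat (Suc (count N x)) * of_nat (mfact N))"
          using F[of M] unfolding M N mfact_add_mset of_nat_mult by (simp del: of_nat_Suc)
        moreover have "m - f x = ?f N" by (simp add: M N)
        ultimately
        show "?s (f x) = of_nat (count M x) * (of_nat (size (f x)) * coeff F m)"
          by (simp add: F P N del: of_nat_Suc)
      qed
      also have "\<dots> = of_nat (\<Sum>x\<in>#M. size (f x)) * coeff F m"
        by (simp add: sum_mset_eq_sum_count sum_distrib_right mult.assoc)
      also have "(\<Sum>x\<in>#M. size (f x)) = size m"
        unfolding M by (induction M) auto
      finally show ?thesis by simp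
    next
      case False
      then have "m \<noteq> ?f N" for N by auto
      then have "(\<Sum>b | b \<subseteq># m. ?s b) = 0"
        by (intro sum.neutral ballI vanish) (simp, rule \<open>m \<noteq> ?f _\<close>)
      with False show ?thesis by (simp add: F0)
    qed
  qed
  then show "coeff (mps_exp P) (?f M) = (\<Prod>x\<in>#M. c x) / of_nat (mfact M)"
    and "m \<notin> range ?f \<Longrightarrow> coeff (mps_exp P) m = 0"
    by (simp_all add: F F0)
qed

section \<open>Coefficients of the Hall product\<close>

section \<open>The plethystic exponential of the generic series\<close>

text \<open>The ordinary exponent inside \<open>Exp\<close>. Splitting it off separates a plethystic
  logarithm into an ordinary logarithm and the inversion of this sum over Adams operations.\<close>

definition Exp_log :: "'g lring \<Rightarrow> 'g lring" where
  "Exp_log G = mps_Sum (\<lambda>k. mps_const (1 / numeral k) * adams k G) UNIV"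

lemma Exp_eq: "Exp G = mps_exp (Exp_log G)"
  by (simp add: Exp_def Exp_log_def)

lemma pscale_empty_iff [simp]: "pscale n m = {#} \<longleftrightarrow> m = {#}"
  by (simp add: pscale_def)

lemma coeff_Exp_log_empty: "coeff G {#} = 0 \<Longrightarrow> coeff (Exp_log G) {#} = 0"
  using coeff_adams_pscale[of _ G "{#}"]
  by (simp add: Exp_log_def coeff_mps_Sum pscale_def)

text \<open>Under the hypothesis no other Adams operation reaches this monomial from the support of
  \<open>G\<close>, so a single term survives.\<close>

lemma coeff_Exp_log_pscale:
  assumes "\<And>k' m'. pscale k' m' = pscale k m \<Longrightarrow> coeff G m' \<noteq> 0 \<Longrightarrow> k' = k"
  shows "coeff (Exp_log G) (pscale k m) = coeff G m / numeral k"
proof -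
  have "coeff (Exp_log G) (pscale k m) =
      (\<Sum>k'\<in>{k}. coeff (mps_const (1 / numeral k') * adams k' G) (pscale k m))"
    unfolding Exp_log_def
  proof (rule coeff_mps_Sum_finite)
    fix k' :: num
    assume k': "k' \<in> UNIV - {k}"
    have "coeff (adams k' G) (pscale k m) = 0"
    proof (cases "pscale k m \<in> range (pscale k')")
      case True
      then obtain m' where m': "pscale k m = pscale k' m'" by auto
      then have "coeff G m' = 0" using assms[of k' m'] k' by auto
      then show ?thesis by (simp add: m' coeff_adams_pscale)
    qed (rule coeff_adams_outside)
    then show "coeff (mps_const (1 / numeral k') * adams k' G) (pscale k m) = 0" by simp
  qed auto
  then show ?thesis by (simp add: coeff_adams_pscale)
qed

lemma coeff_Exp_log_outside:
  assumes "\<And>k m'. m = pscale k m' \<Longrightarrow> coeff G m' = 0"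
  shows "coeff (Exp_log G) m = 0"
proof -
  have "coeff (adams k G) m = 0" for k
    by (cases "m \<in> range (pscale k)") (auto simp: coeff_adams_pscale coeff_adams_outside assms)
  then show ?thesis by (simp add: Exp_log_def coeff_mps_Sum)
qed

definition X_mono :: "partition \<Rightarrow> (num \<times> 'g adjoin_X) multiset" where
  "X_mono \<mu> = image_mset (\<lambda>k. (k, GenX)) \<mu>"

definition Gen_mono :: "(num \<times> 'g) multiset \<Rightarrow> (num \<times> 'g adjoin_X) multiset" where
  "Gen_mono m = image_mset (\<lambda>(k, g). (k, Gen g)) m"

lemma filter_Gen_mono:
  "filter_mset (\<lambda>s. snd s \<noteq> GenX) (Gen_mono m + X_mono \<mu>) = Gen_mono m"
  "filter_mset (\<lambda>s. snd s = GenX) (Gen_mono m + X_mono \<mu>) = X_mono \<mu>"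
proof -
  have "filter_mset (\<lambda>s. snd s \<noteq> GenX) (Gen_mono m) = Gen_mono m"
    "filter_mset (\<lambda>s. snd s = GenX) (Gen_mono m) = {#}"
    by (induction m) (auto simp: Gen_mono_def)
  moreover have "filter_mset (\<lambda>s. snd s \<noteq> GenX) (X_mono \<mu> :: (num \<times> 'a adjoin_X) multiset) = {#}"
    "filter_mset (\<lambda>s. snd s = GenX) (X_mono \<mu> :: (num \<times> 'a adjoin_X) multiset) = X_mono \<mu>"
    by (induction \<mu>) (auto simp: X_mono_def)
  ultimately show "filter_mset (\<lambda>s. snd s \<noteq> GenX) (Gen_mono m + X_mono \<mu>) = Gen_mono m"
    "filter_mset (\<lambda>s. snd s = GenX) (Gen_mono m + X_mono \<mu>) = X_mono \<mu>"
    by (simp_all only: filter_union_mset add_0 add_0_right)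
qed

lemma Gen_X_mono_inj:
  "Gen_mono m + X_mono \<mu> = Gen_mono m' + X_mono \<mu>' \<longleftrightarrow> m = m' \<and> \<mu> = \<mu>'"
proof
  assume eq: "Gen_mono m + X_mono \<mu> = Gen_mono m' + X_mono \<mu>'"
  have "inj (\<lambda>(k :: num, g :: 'a). (k, Gen g))" "inj (\<lambda>k :: num. (k, GenX :: 'a adjoin_X))"
    by (auto simp: inj_def)
  from this[THEN multiset.inj_map] have "inj (Gen_mono :: (num \<times> 'a) multiset \<Rightarrow> _)"
      "inj (X_mono :: _ \<Rightarrow> (num \<times> 'a adjoin_X) multiset)"
    by (simp_all add: Gen_mono_def[abs_def] X_mono_def[abs_def])
  moreover have "Gen_mono m = Gen_mono m'" "X_mono \<mu> = (X_mono \<mu>' :: (num \<times> 'a adjoin_X) multiset)"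
    using filter_Gen_mono[of m \<mu>] filter_Gen_mono[of m' \<mu>'] eq by metis+
  ultimately show "m = m' \<and> \<mu> = \<mu>'" by (auto dest: injD)
qed simp

fun gen_parts :: "gen \<Rightarrow> partition" where
  "gen_parts (GenA l) = parts l"
| "gen_parts (GenB l) = parts l"

text \<open>The colors of the half-edges at a vertex with the symbol \<open>p\<^sub>k[A\<^sub>\<lambda>]\<close> or \<open>p\<^sub>k[B\<^sub>\<lambda>]\<close>.\<close>

definition sym_colors :: "num \<times> gen \<Rightarrow> partition" where
  "sym_colors s = image_mset ((*) (fst s)) (gen_parts (snd s))"

text \<open>For the monomial of a graph this is the product of the vertex colors. It enters through
  the factors 1/k of the plethystic exponential.\<close>

definition index_prod :: "(num \<times> 'g) multiset \<Rightarrow> rat" where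
  "index_prod m = (\<Prod>s\<in>#m. numeral (fst s))"

lemma coeff_generic_series:
  assumes "inj C"
  shows "coeff (generic_series C) m =
    (if \<exists>l. m = Gen_mono {#(num.One, C l)#} + X_mono (parts l) then 1 else 0)"
proof -
  have c: "coeff (psym num.One (Gen (C l)) * pX (parts l)) m =
      (if m = Gen_mono {#(num.One, C l)#} + X_mono (parts l) then 1 else 0)" for l
  proof -
    have "coeff (pX (parts l)) m' = (if m' = X_mono (parts l) then 1 else 0)" for m' :: "(num \<times> gen adjoin_X) multiset"
      unfolding pX_def psym_def X_mono_def by (rule coeff_prod_mset_var)
    then show ?thesis
      by (cases "(num.One, Gen (C l)) \<in># m")
        (auto simp: psym_def coeff_mps_var_mult Gen_mono_def dest!: multi_member_split)
  qed
  show ?thesis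
  proof (cases "\<exists>l. m = Gen_mono {#(num.One, C l)#} + X_mono (parts l)")
    case True
    then obtain l where l: "m = Gen_mono {#(num.One, C l)#} + X_mono (parts l)" by auto
    have "coeff (generic_series C) m =
        (\<Sum>l\<in>{l}. coeff (psym num.One (Gen (C l)) * pX (parts l)) m)"
      unfolding generic_series_def
    proof (rule coeff_mps_Sum_finite)
      fix l' assume "l' \<in> UNIV - {l}"
      then show "coeff (psym num.One (Gen (C l')) * pX (parts l')) m = 0"
        using assms unfolding c unfolding l by (auto simp: Gen_X_mono_inj inj_eq)
    qed auto
    with True show ?thesis unfolding c by (auto simp: l)
  next
    case False
    then show ?thesis unfolding generic_series_def by (simp add: coeff_mps_Sum c)
  qed
qed

lemma pscale_Gen_X_mono:
  "pscale k (Gen_mono m + X_mono \<mu>) = Gen_mono (pscale k m) + X_mono (image_mset ((*) k) \<mu>)"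
  by (simp add: pscale_def Gen_mono_def X_mono_def multiset.map_comp comp_def case_prod_unfold)

text \<open>The exponent is the sum over k and l of 1/k * p_k[C l] times the product of p_(k i)[X]
  over the parts i of l. Each term carries its own symbol p_k[C l], so these monomials are
  independent, and the symbols in \<open>m\<close> force the X-part to consist of their half-edge
  colors.\<close>

lemma X_coeff_Exp_generic_series:
  assumes C: "inj C" "\<And>l. gen_parts (C l) = parts l"
  shows "coeff (X_coeff \<mu> (Exp (generic_series C))) m =
    (if snd ` set_mset m \<subseteq> range C \<and> \<mu> = (\<Sum>s\<in>#m. sym_colors s)
     then 1 / (index_prod m * of_nat (mfact m)) else 0)"
proof -
  define f where "f = (\<lambda>(k, l). pscale k (Gen_mono {#(num.One, C l)#} + X_mono (parts l)))"
  have f: "f x = Gen_mono {#map_prod id C x#} + X_mono (sym_colors (map_prod id C x))" for x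
    unfolding f_def case_prod_unfold pscale_Gen_X_mono sym_colors_def
    using num_One_mult[of "fst x"]
    by (simp add: pscale_def C map_prod_def case_prod_unfold num_eq_iff nat_of_num_mult)
  have injC: "inj (map_prod id C :: num \<times> _ \<Rightarrow> _)"
    using C(1) by (simp add: map_prod_inj_on[of id UNIV C UNIV, simplified])
  have sum_f: "(\<Sum>x\<in>#M. f x) = Gen_mono (image_mset (map_prod id C) M) +
      X_mono (\<Sum>s\<in>#image_mset (map_prod id C) M. sym_colors s)" for M
    by (induction M) (auto simp: f Gen_mono_def X_mono_def)
  have inj: "M = N" if "(\<Sum>x\<in>#M. f x) = (\<Sum>x\<in>#N. f x)" for M N
    using that multiset.inj_map[OF injC] unfolding sum_f Gen_X_mono_inj by (auto dest: injD)
  have inj1: "k = k' \<and> l = l'" if "f (k, l) = f (k', l')" for k l k' l'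
    using inj[of "{#(k, l)#}" "{#(k', l')#}"] that by simp
  let ?P = "Exp_log (generic_series C)"
  have P: "coeff ?P (f x) = 1 / numeral (fst x)" for x
  proof -
    obtain k l where x: "x = (k, l)" by (cases x)
    have "coeff ?P (f x) = coeff (generic_series C) (Gen_mono {#(num.One, C l)#} + X_mono (parts l)) / numeral k"
      unfolding x f_def case_prod_conv
    proof (rule coeff_Exp_log_pscale)
      fix k' m'
      assume a: "pscale k' m' = pscale k (Gen_mono {#(num.One, C l)#} + X_mono (parts l))"
        "coeff (generic_series C) m' \<noteq> 0"
      then obtain l' where "m' = Gen_mono {#(num.One, C l')#} + X_mono (parts l')"
        by (auto simp: coeff_generic_series[OF C(1)] split: if_splits)
      with a(1) have "f (k', l') = f (k, l)" by (simp add: f_def)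
      then show "k' = k" by (auto dest: inj1)
    qed
    also have "\<dots> = 1 / numeral (fst x)"
      by (auto simp: coeff_generic_series[OF C(1)] x)
    finally show ?thesis .
  qed
  have P0: "coeff ?P m = 0" if m: "m \<notin> range f" for m
  proof (rule coeff_Exp_log_outside)
    fix k m' assume "m = pscale k m'"
    with m have "m' \<noteq> Gen_mono {#(num.One, C l)#} + X_mono (parts l)" for l
      by (auto simp: f_def image_iff split_paired_all)
    then show "coeff (generic_series C) m' = 0"
      by (auto simp: coeff_generic_series[OF C(1)])
  qed
  have E1: "coeff (Exp (generic_series C)) (\<Sum>x\<in>#M. f x) =
      (\<Prod>x\<in>#M. 1 / numeral (fst x)) / of_nat (mfact M)" for M
    unfolding Exp_eq by (rule coeff_mps_exp_monomials(1)) (use inj P P0 in blast)+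
  have E2: "coeff (Exp (generic_series C)) m = 0" if "m \<notin> range (\<lambda>M. \<Sum>x\<in>#M. f x)" for m
    unfolding Exp_eq by (rule coeff_mps_exp_monomials(2)[of f]) (use inj P P0 that in blast)+
  have X: "coeff (X_coeff \<mu> F) m = coeff F (Gen_mono m + X_mono \<mu>)" for F :: "gen adjoin_X lring"
    by (simp add: X_coeff.rep_eq Gen_mono_def X_mono_def)
  show ?thesis
  proof (cases "snd ` set_mset m \<subseteq> range C \<and> \<mu> = (\<Sum>s\<in>#m. sym_colors s)")
    case True
    define M where "M = image_mset (map_prod id (inv C)) m"
    have mM: "m = image_mset (map_prod id C) M"
      unfolding M_def multiset.map_comp
      by (rule multiset.map_ident_strong[symmetric]) (use True in \<open>auto simp: f_inv_into_f image_subset_iff\<close>)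
    have "coeff (X_coeff \<mu> (Exp (generic_series C))) m =
        (\<Prod>x\<in>#M. 1 / numeral (fst x)) / of_nat (mfact M)"
      using True E1[of M] unfolding X sum_f mM[symmetric] by simp
    also have "mfact M = mfact m" unfolding mM by (rule mfact_image_inj[OF injC, symmetric])
    also have "(\<Prod>x\<in>#M. 1 / numeral (fst x) :: rat) = 1 / index_prod m"
      unfolding mM index_prod_def by (induction M) auto
    finally show ?thesis using True by simp
  next
    case False
    have "Gen_mono m + X_mono \<mu> \<notin> range (\<lambda>M. \<Sum>x\<in>#M. f x)"
    proof
      assume "Gen_mono m + X_mono \<mu> \<in> range (\<lambda>M. \<Sum>x\<in>#M. f x)"
      then obtain M where "m = image_mset (map_prod id C) M" "\<mu> = (\<Sum>s\<in>#m. sym_colors s)"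
        unfolding sum_f by (auto simp: Gen_X_mono_inj)
      with False show False by auto
    qed
    from E2[OF this] False show ?thesis by (simp only: X if_False)
  qed
qed

lemma mfact_union_disjoint:
  assumes "set_mset a \<inter> set_mset b = {}"
  shows "mfact (a + b) = mfact a * mfact b"
proof -
  have [simp]: "count b x = 0" if "x \<in># a" for x
    using assms that by (auto simp: count_eq_zero_iff)
  have [simp]: "count a x = 0" if "x \<in># b" for x
    using assms that by (auto simp: count_eq_zero_iff)
  have "mfact (a + b) = (\<Prod>x\<in>set_mset a. fact (count (a + b) x)) * (\<Prod>x\<in>set_mset b. fact (count (a + b) x))"
    unfolding mfact_def using assms by (simp add: prod.union_disjoint)
  also have "(\<Prod>x\<in>set_mset a. fact (count (a + b) x)) = mfact a"
    unfolding mfact_def by (intro prod.cong) auto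
  also have "(\<Prod>x\<in>set_mset b. fact (count (a + b) x)) = mfact b"
    unfolding mfact_def by (intro prod.cong) auto
  finally show ?thesis .
qed

abbreviation sideA :: "num \<times> gen \<Rightarrow> bool" where
  "sideA s \<equiv> snd s \<in> range GenA"

definition colorsA :: "(num \<times> gen) multiset \<Rightarrow> partition" where
  "colorsA m = (\<Sum>s\<in>#filter_mset sideA m. sym_colors s)"

definition colorsB :: "(num \<times> gen) multiset \<Rightarrow> partition" where
  "colorsB m = (\<Sum>s\<in>#filter_mset (\<lambda>s. \<not> sideA s) m. sym_colors s)"

lemma not_sideA_iff: "\<not> sideA s \<longleftrightarrow> snd s \<in> range GenB"
  by (cases s; cases "snd s") auto

text \<open>A monomial splits uniquely into A-symbols and B-symbols, and each side fixes the
  X-monomial that accompanies it. So at most one summand of the Cauchy product and one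
  \<open>\<mu>\<close> survive, and they do so only if both sides have the same half-edge
  colors.\<close>

lemma coeff_hall_generic:
  "coeff (hall_X (Exp (generic_series GenA)) (Exp (generic_series GenB))) m =
    (if colorsA m = colorsB m
     then of_nat (zee (colorsA m)) / (index_prod m * of_nat (mfact m)) else 0)"
proof -
  let ?A = "\<lambda>\<mu>. coeff (X_coeff \<mu> (Exp (generic_series GenA)))"
  let ?B = "\<lambda>\<mu>. coeff (X_coeff \<mu> (Exp (generic_series GenB)))"
  let ?mA = "filter_mset sideA m" and ?mB = "filter_mset (\<lambda>s. \<not> sideA s) m"
  have A: "?A \<mu> a = (if snd ` set_mset a \<subseteq> range GenA \<and> \<mu> = (\<Sum>s\<in>#a. sym_colors s)
      then 1 / (index_prod a * of_nat (mfact a)) else 0)" for \<mu> a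
    by (rule X_coeff_Exp_generic_series) (auto simp: inj_def)
  have B: "?B \<mu> a = (if snd ` set_mset a \<subseteq> range GenB \<and> \<mu> = (\<Sum>s\<in>#a. sym_colors s)
      then 1 / (index_prod a * of_nat (mfact a)) else 0)" for \<mu> a
    by (rule X_coeff_Exp_generic_series) (auto simp: inj_def)
  have m: "m = ?mA + ?mB" by (rule multiset_partition)
  have mA: "m - ?mB = ?mA" using m by (metis add_diff_cancel_right')
  have split: "b = ?mB" if "b \<subseteq># m" "?A \<mu> (m - b) * ?B \<mu> b \<noteq> 0" for \<mu> b
  proof -
    from that(2) have "snd ` set_mset (m - b) \<subseteq> range GenA" "snd ` set_mset b \<subseteq> range GenB"
      by (auto simp: A B split: if_splits)
    then have "filter_mset (\<lambda>s. \<not> sideA s) (m - b) = {#}" "filter_mset (\<lambda>s. \<not> sideA s) b = b"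
      by (auto simp: filter_mset_eq_conv simp del: filter_diff_mset)
    moreover have "m = (m - b) + b" using that(1) by simp
    ultimately show "b = ?mB" by (metis filter_union_mset add_0)
  qed
  have c: "coeff (mps_const (of_nat (zee \<mu>)) * (X_coeff \<mu> (Exp (generic_series GenA)) *
      X_coeff \<mu> (Exp (generic_series GenB)))) m = of_nat (zee \<mu>) * (?A \<mu> ?mA * ?B \<mu> ?mB)" for \<mu>
  proof -
    have "(\<Sum>b | b \<subseteq># m. ?A \<mu> (m - b) * ?B \<mu> b) = (\<Sum>b\<in>{?mB}. ?A \<mu> (m - b) * ?B \<mu> b)"
      by (rule sum.mono_neutral_right) (use split in \<open>auto simp: finite_submultisets\<close>)
    then show ?thesis by (simp add: mA coeff_mult[of "X_coeff \<mu> (Exp (generic_series GenA))"])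
  qed
  have "coeff (hall_X (Exp (generic_series GenA)) (Exp (generic_series GenB))) m =
      (\<Sum>\<mu>\<in>{colorsA m}. of_nat (zee \<mu>) * (?A \<mu> ?mA * ?B \<mu> ?mB))"
    unfolding hall_X_def
    by (subst coeff_mps_Sum_finite[of "{colorsA m}"])
      (simp, simp, simp only: c, simp add: A colorsA_def, simp only: c)
  moreover have "snd ` set_mset ?mA \<subseteq> range GenA" "snd ` set_mset ?mB \<subseteq> range GenB"
    by (auto simp: not_sideA_iff)
  moreover have "index_prod m = index_prod ?mA * index_prod ?mB"
    by (subst m) (simp only: index_prod_def image_mset_union prod_mset_Un)
  moreover have "mfact m = mfact ?mA * mfact ?mB"
    by (subst m, rule mfact_union_disjoint) auto
  ultimately show ?thesis
    by (simp add: A B colorsA_def colorsB_def)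
qed

section \<open>Labelled enumeration and the exponential formula\<close>

section \<open>Color-preserving bijections\<close>

text \<open>The functions are extensional, so that each bijection is counted once and the set is
  finite for finite \<open>X\<close> and \<open>Y\<close>.\<close>

definition cbij :: "'x set \<Rightarrow> 'y set \<Rightarrow> ('x \<Rightarrow> 'c) \<Rightarrow> ('y \<Rightarrow> 'c) \<Rightarrow> ('x \<Rightarrow> 'y) set" where
  "cbij X Y c d = {f \<in> X \<rightarrow>\<^sub>E Y. bij_betw f X Y \<and> (\<forall>x\<in>X. d (f x) = c x)}"

lemma cbijD:
  assumes "f \<in> cbij X Y c d"
  shows "bij_betw f X Y" "\<And>x. x \<in> X \<Longrightarrow> f x \<in> Y" "\<And>x. x \<in> X \<Longrightarrow> d (f x) = c x"
    "\<And>x. x \<notin> X \<Longrightarrow> f x = undefined"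
  using assms by (auto simp: cbij_def PiE_def extensional_def)

lemma cbijI:
  assumes "bij_betw f X Y" "\<And>x. x \<in> X \<Longrightarrow> d (f x) = c x" "\<And>x. x \<notin> X \<Longrightarrow> f x = undefined"
  shows "f \<in> cbij X Y c d"
  using assms by (auto simp: cbij_def PiE_def extensional_def bij_betwE)

lemma finite_cbij: "finite X \<Longrightarrow> finite Y \<Longrightarrow> finite (cbij X Y c d)"
  by (rule finite_subset[OF _ finite_PiE[of X "\<lambda>_. Y"]]) (auto simp: cbij_def)

lemma count_image_mset_set: "finite A \<Longrightarrow> count (image_mset f (mset_set A)) y = card {x \<in> A. f x = y}"
proof (induction A rule: finite_induct)
  case (insert x F)
  have "{a \<in> insert x F. f a = y} = (if f x = y then insert x {a \<in> F. f a = y} else {a \<in> F. f a = y})"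
    by auto
  then show ?case using insert by simp
qed simp

text \<open>The image of a new element \<open>x\<close> is one of the elements of \<open>Y\<close>
  with its color; their number is the multiplicity of that color, which is the factor by which
  \<open>mfact\<close> grows.\<close>

lemma card_cbij:
  assumes "finite X" "finite Y"
  shows "card (cbij X Y c d) =
    (if image_mset c (mset_set X) = image_mset d (mset_set Y)
     then mfact (image_mset c (mset_set X)) else 0)"
  using assms
proof (induction X arbitrary: Y rule: finite_induct)
  case empty
  have "cbij {} Y c d = (if Y = {} then {\<lambda>_. undefined} else {})"
    by (auto simp: cbij_def bij_betw_def)
  with empty show ?case by (auto simp: mset_set_empty_iff)
next
  case (insert x X)
  let ?Y = "{y \<in> Y. d y = c x}"
  have bij: "bij_betw (\<lambda>f. (f x, restrict f X)) (cbij (insert x X) Y c d) (SIGMA y:?Y. cbij X (Y - {y}) c d)"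
  proof (rule bij_betw_byWitness[where f' = "\<lambda>(y, g). g(x := y)"])
    show "\<forall>f\<in>cbij (insert x X) Y c d. (case (f x, restrict f X) of (y, g) \<Rightarrow> g(x := y)) = f"
      by (auto simp: fun_eq_iff dest: cbijD(4))
    show "\<forall>p\<in>SIGMA y:?Y. cbij X (Y - {y}) c d.
        ((case p of (y, g) \<Rightarrow> g(x := y)) x, restrict (case p of (y, g) \<Rightarrow> g(x := y)) X) = p"
      using insert.hyps by (auto simp: fun_eq_iff dest: cbijD(4))
    show "(\<lambda>f. (f x, restrict f X)) ` cbij (insert x X) Y c d \<subseteq> (SIGMA y:?Y. cbij X (Y - {y}) c d)"
    proof (rule image_subsetI)
      fix f assume f: "f \<in> cbij (insert x X) Y c d"
      have fx: "f x \<in> Y" using cbijD(2)[OF f] by simp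
      have "bij_betw f (X \<union> {x}) ((Y - {f x}) \<union> {f x})"
        using cbijD(1)[OF f] fx by (simp add: insert_absorb)
      then have "bij_betw f X (Y - {f x})"
        using notIn_Un_bij_betw3[of x X f "Y - {f x}"] insert.hyps by simp
      then have "bij_betw (restrict f X) X (Y - {f x})"
        by (simp cong: bij_betw_cong)
      then show "(f x, restrict f X) \<in> (SIGMA y:?Y. cbij X (Y - {y}) c d)"
        using fx cbijD(3)[OF f] by (auto intro!: cbijI)
    qed
    show "(\<lambda>(y, g). g(x := y)) ` (SIGMA y:?Y. cbij X (Y - {y}) c d) \<subseteq> cbij (insert x X) Y c d"
    proof (clarify)
      fix y g assume y: "y \<in> Y" "d y = c x" and g: "g \<in> cbij X (Y - {y}) c d"
      have "bij_betw (g(x := y)) X (Y - {y})"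
        using cbijD(1)[OF g] insert.hyps by (subst bij_betw_cong[of _ _ g]) auto
      then have "bij_betw (g(x := y)) (X \<union> {x}) ((Y - {y}) \<union> {y})"
        using notIn_Un_bij_betw3[of x X "g(x := y)" "Y - {y}"] insert.hyps by simp
      then have "bij_betw (g(x := y)) (insert x X) Y"
        using y by (simp add: insert_absorb)
      then show "g(x := y) \<in> cbij (insert x X) Y c d"
        using y cbijD(3,4)[OF g] by (intro cbijI) auto
    qed
  qed
  have "card (cbij (insert x X) Y c d) = (\<Sum>y\<in>?Y. card (cbij X (Y - {y}) c d))"
    unfolding bij_betw_same_card[OF bij] using insert by (simp add: card_SigmaI finite_cbij)
  also have "\<dots> = (\<Sum>y\<in>?Y. if image_mset c (mset_set (insert x X)) = image_mset d (mset_set Y)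
      then mfact (image_mset c (mset_set X)) else 0)"
  proof (rule sum.cong[OF refl])
    fix y assume y: "y \<in> ?Y"
    have "mset_set Y = add_mset y (mset_set (Y - {y}))" "d y = c x"
      using y mset_set.remove[OF insert.prems] by blast+
    then have eq: "image_mset d (mset_set Y) = add_mset (c x) (image_mset d (mset_set (Y - {y})))"
      by (simp only: image_mset_add_mset)
    show "card (cbij X (Y - {y}) c d) =
        (if image_mset c (mset_set (insert x X)) = image_mset d (mset_set Y)
         then mfact (image_mset c (mset_set X)) else 0)"
      unfolding eq insert.IH[OF finite_Diff[OF insert.prems]] using insert.hyps by simp
  qed
  also have "\<dots> = (if image_mset c (mset_set (insert x X)) = image_mset d (mset_set Y)
     then mfact (image_mset c (mset_set (insert x X))) else 0)"
  proof (cases "image_mset c (mset_set (insert x X)) = image_mset d (mset_set Y)")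
    case True
    have "card ?Y = count (image_mset c (mset_set (insert x X))) (c x)"
      unfolding True by (rule count_image_mset_set[OF insert.prems, symmetric])
    then have "card ?Y = Suc (count (image_mset c (mset_set X)) (c x))"
      using insert.hyps by simp
    moreover have "mfact (image_mset c (mset_set (insert x X))) =
        Suc (count (image_mset c (mset_set X)) (c x)) * mfact (image_mset c (mset_set X))"
      using insert.hyps by (simp add: mfact_add_mset)
    ultimately show ?thesis using True by (simp only: if_True refl sum_constant) simp
  qed simp
  finally show ?case .
qed

section \<open>Sums over subsets of a labelled multiset\<close>

text \<open>The number of subfamilies of type \<open>b\<close> in a labelled family of type
  \<open>M\<close>. The product runs over \<open>M + b\<close> so that an element of
  \<open>b\<close> absent from \<open>M\<close> yields the factor 0.\<close>

definition mchoose :: "'a multiset \<Rightarrow> 'a multiset \<Rightarrow> nat" where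
  "mchoose M b = (\<Prod>y\<in>set_mset (M + b). count M y choose count b y)"

lemma mchoose_eq_prod:
  assumes "finite A" "set_mset M \<subseteq> A" "set_mset b \<subseteq> A"
  shows "mchoose M b = (\<Prod>y\<in>A. count M y choose count b y)"
  unfolding mchoose_def by (rule prod.mono_neutral_left) (use assms in \<open>auto simp: not_in_iff\<close>)

lemma mchoose_eq_0: "\<not> b \<subseteq># M \<Longrightarrow> mchoose M b = 0"
  unfolding mchoose_def subseteq_mset_def
  by (auto simp: not_le binomial_eq_0 intro!: prod_zero dest: count_greater_zero_iff[THEN iffD1, OF le_less_trans, rotated])

lemma mchoose_mfact:
  assumes "b \<subseteq># M"
  shows "mchoose M b * mfact b * mfact (M - b) = mfact M"
proof -
  let ?A = "set_mset M"
  have sub: "set_mset b \<subseteq> ?A" "set_mset (M - b) \<subseteq> ?A"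
    using assms set_mset_mono by (auto dest: in_diffD)
  have "mchoose M b * mfact b * mfact (M - b) =
      (\<Prod>y\<in>?A. (count M y choose count b y) * fact (count b y) * fact (count M y - count b y))"
    using sub by (simp add: mchoose_eq_prod[of ?A] mfact_eq_prod[of ?A] prod.distrib)
  also have "\<dots> = (\<Prod>y\<in>?A. fact (count M y))"
    using assms by (intro prod.cong refl)
      (metis binomial_fact_lemma mult.assoc mult.commute mset_subset_eq_count)
  finally show ?thesis by (simp add: mfact_def)
qed

text \<open>Pascal's rule in the factor of \<open>x\<close>: a subfamily avoids the new element or
  contains it.\<close>

lemma mchoose_add_mset:
  "mchoose (add_mset x M) b = mchoose M b + (if x \<in># b then mchoose M (b - {#x#}) else 0)"
proof -
  let ?A = "set_mset (add_mset x M + b)"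
  let ?R = "\<Prod>y\<in>?A - {x}. count M y choose count b y"
  have 1: "mchoose (add_mset x M) b = (Suc (count M x) choose count b x) * ?R"
  proof -
    have "mchoose (add_mset x M) b = (\<Prod>y\<in>?A. count (add_mset x M) y choose count b y)"
      by (rule mchoose_eq_prod) auto
    also have "\<dots> = (Suc (count M x) choose count b x) *
        (\<Prod>y\<in>?A - {x}. count (add_mset x M) y choose count b y)"
      by (subst prod.remove[of _ x]) auto
    also have "(\<Prod>y\<in>?A - {x}. count (add_mset x M) y choose count b y) = ?R"
      by (rule prod.cong) auto
    finally show ?thesis .
  qed
  have 2: "mchoose M b = (count M x choose count b x) * ?R"
    by (subst mchoose_eq_prod[of ?A], simp, force, force, subst prod.remove[of _ x]) simp_all
  have 3: "mchoose M (b - {#x#}) = (count M x choose (count b x - 1)) * ?R"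
  proof -
    have "mchoose M (b - {#x#}) = (\<Prod>y\<in>?A. count M y choose count (b - {#x#}) y)"
      by (rule mchoose_eq_prod) (auto dest: in_diffD)
    also have "\<dots> = (count M x choose (count b x - 1)) *
        (\<Prod>y\<in>?A - {x}. count M y choose count (b - {#x#}) y)"
      by (subst prod.remove[of _ x]) auto
    also have "(\<Prod>y\<in>?A - {x}. count M y choose count (b - {#x#}) y) = ?R"
      by (rule prod.cong) auto
    finally show ?thesis .
  qed
  show ?thesis
  proof (cases "x \<in># b")
    case True
    then obtain j where "count b x = Suc j" by (metis count_eq_zero_iff not0_implies_Suc)
    with True show ?thesis by (simp add: 1 2 3 distrib_right)
  next
    case False
    then have "count b x = 0" by (simp add: not_in_iff)
    with False show ?thesis by (simp add: 1 2)
  qed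
qed

text \<open>The bridge between the two kinds of recursion: those for series run over submultisets,
  while components of gluings are subsets of a labelled vertex set.\<close>

lemma sum_Pow_image_mset:
  fixes G :: "'a multiset \<Rightarrow> 'b :: comm_semiring_1"
  assumes "finite V"
  shows "(\<Sum>S\<in>Pow V. G (image_mset t (mset_set S))) =
    (\<Sum>b | b \<subseteq># image_mset t (mset_set V). of_nat (mchoose (image_mset t (mset_set V)) b) * G b)"
  using assms
proof (induction V arbitrary: G rule: finite_induct)
  case empty
  then show ?case by (simp add: mchoose_def)
next
  case (insert v V)
  let ?M = "image_mset t (mset_set V)" and ?M' = "image_mset t (mset_set (insert v V))"
  let ?x = "t v"
  have M': "?M' = add_mset ?x ?M" using insert by simp
  have fin: "finite S" if "S \<in> Pow V" for S using that insert finite_subset by auto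
  have "(\<Sum>S\<in>Pow (insert v V). G (image_mset t (mset_set S))) =
      (\<Sum>S\<in>Pow V. G (image_mset t (mset_set S))) +
      (\<Sum>S\<in>insert v ` Pow V. G (image_mset t (mset_set S)))"
    unfolding Pow_insert using insert by (intro sum.union_disjoint) auto
  also have "(\<Sum>S\<in>insert v ` Pow V. G (image_mset t (mset_set S))) =
      (\<Sum>S\<in>Pow V. G (add_mset ?x (image_mset t (mset_set S))))"
  proof -
    have "inj_on (insert v) (Pow V)"
      using insert.hyps by (intro inj_onI) (metis PowD insert_ident subsetD)
    moreover have "mset_set (insert v S) = add_mset v (mset_set S)" if "S \<in> Pow V" for S
      using fin[OF that] that insert.hyps by (intro mset_set.insert) auto
    ultimately show ?thesis by (simp add: sum.reindex)
  qed
  also have "(\<Sum>S\<in>Pow V. G (image_mset t (mset_set S))) =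
      (\<Sum>b | b \<subseteq># ?M. of_nat (mchoose ?M b) * G b)"
    by (rule insert.IH)
  also have "\<dots> = (\<Sum>b | b \<subseteq># ?M'. of_nat (mchoose ?M b) * G b)"
    unfolding M' by (rule sum.mono_neutral_left)
      (auto simp: finite_submultisets mchoose_eq_0 intro: subset_mset.order_trans)
  also have "(\<Sum>S\<in>Pow V. G (add_mset ?x (image_mset t (mset_set S)))) =
      (\<Sum>b | b \<subseteq># ?M. of_nat (mchoose ?M b) * G (add_mset ?x b))"
    by (rule insert.IH)
  also have "\<dots> = (\<Sum>b | b \<subseteq># ?M' \<and> ?x \<in># b. of_nat (mchoose ?M (b - {#?x#})) * G b)"
    unfolding M'
    by (rule sum.reindex_bij_witness[where i = "\<lambda>b. b - {#?x#}" and j = "add_mset ?x"])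
      (auto simp: subset_eq_diff_conv insert_subset_eq_iff)
  also have "\<dots> = (\<Sum>b | b \<subseteq># ?M'. of_nat (if ?x \<in># b then mchoose ?M (b - {#?x#}) else 0) * G b)"
    by (rule sum.mono_neutral_cong_left) (auto simp: finite_submultisets)
  finally show ?case
    unfolding sum.distrib[symmetric] M' mchoose_add_mset by (simp add: distrib_right)
qed

section \<open>Gluings of half-edges\<close>

text \<open>
  A family of labelled vertices is given by a map \<open>t\<close> sending a vertex to its symbol.  The vertex
  \<open>v\<close> has one half-edge \<open>(v, c, i)\<close> for each occurrence \<open>i\<close> of the part \<open>c\<close> in its partition, of
  color \<open>k \<sqdot> c\<close> where \<open>k\<close> is the color of \<open>v\<close>.  A gluing matches the half-edges on both sides.
\<close>

type_synonym 'v half_edge = "'v \<times> num \<times> nat"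

definition half_edges :: "(num \<times> gen \<Rightarrow> bool) \<Rightarrow> ('v \<Rightarrow> num \<times> gen) \<Rightarrow> 'v set \<Rightarrow> 'v half_edge set" where
  "half_edges P t S = {(v, c, i). v \<in> S \<and> P (t v) \<and> i < count (gen_parts (snd (t v))) c}"

abbreviation halfA :: "('v \<Rightarrow> num \<times> gen) \<Rightarrow> 'v set \<Rightarrow> 'v half_edge set" where
  "halfA \<equiv> half_edges sideA"

abbreviation halfB :: "('v \<Rightarrow> num \<times> gen) \<Rightarrow> 'v set \<Rightarrow> 'v half_edge set" where
  "halfB \<equiv> half_edges (\<lambda>s. \<not> sideA s)"

definition half_color :: "('v \<Rightarrow> num \<times> gen) \<Rightarrow> 'v half_edge \<Rightarrow> num" where
  "half_color t h = fst (t (fst h)) * fst (snd h)"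

definition glue :: "('v \<Rightarrow> num \<times> gen) \<Rightarrow> 'v set \<Rightarrow> ('v half_edge \<Rightarrow> 'v half_edge) set" where
  "glue t S = cbij (halfA t S) (halfB t S) (half_color t) (half_color t)"

text \<open>No glued pair leaves \<open>T\<close>; for a gluing on the half-edges \<open>H\<close>
  this says that \<open>T\<close> is a union of components.\<close>

definition glue_closed :: "('v half_edge \<Rightarrow> 'v half_edge) \<Rightarrow> 'v half_edge set \<Rightarrow> 'v set \<Rightarrow> bool" where
  "glue_closed \<sigma> H T \<longleftrightarrow> (\<forall>h\<in>H. fst h \<in> T \<longleftrightarrow> fst (\<sigma> h) \<in> T)"

text \<open>Connectedness by cuts instead of paths. Closed sets are stable under intersections and
  differences, which makes components and restrictions easy to handle.\<close>

definition glue_conn :: "('v half_edge \<Rightarrow> 'v half_edge) \<Rightarrow> 'v half_edge set \<Rightarrow> 'v set \<Rightarrow> bool" where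
  "glue_conn \<sigma> H S \<longleftrightarrow> S \<noteq> {} \<and> (\<forall>T\<subseteq>S. glue_closed \<sigma> H T \<longrightarrow> T = {} \<or> T = S)"

definition cglue :: "('v \<Rightarrow> num \<times> gen) \<Rightarrow> 'v set \<Rightarrow> ('v half_edge \<Rightarrow> 'v half_edge) set" where
  "cglue t S = {\<sigma> \<in> glue t S. glue_conn \<sigma> (halfA t S) S}"

lemma fst_half_edges: "h \<in> half_edges P t S \<Longrightarrow> fst h \<in> S"
  by (auto simp: half_edges_def)

lemma half_edges_empty [simp]: "half_edges P t {} = {}"
  by (auto simp: half_edges_def)

lemma half_edges_split:
  "S \<subseteq> V \<Longrightarrow> h \<in> half_edges P t V \<longleftrightarrow> h \<in> half_edges P t S \<or> h \<in> half_edges P t (V - S)"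
  by (auto simp: half_edges_def)

lemma half_edges_Un: "half_edges P t (S \<union> T) = half_edges P t S \<union> half_edges P t T"
  by (auto simp: half_edges_def)

lemma half_edges_sub_iff: "S \<subseteq> V \<Longrightarrow> h \<in> half_edges P t V \<Longrightarrow> h \<in> half_edges P t S \<longleftrightarrow> fst h \<in> S"
  by (auto simp: half_edges_def)

lemma half_edges_mono: "S \<subseteq> V \<Longrightarrow> half_edges P t S \<subseteq> half_edges P t V"
  by (auto simp: half_edges_def)

lemma half_edges_single:
  "half_edges P t {v} = (if P (t v)
    then Pair v ` (SIGMA c:set_mset (gen_parts (snd (t v))). {..<count (gen_parts (snd (t v))) c}) else {})"
  by (auto simp: half_edges_def dest: count_greater_zero_iff[THEN iffD1, OF le_less_trans[OF le0]])

lemma finite_half_edges: "finite S \<Longrightarrow> finite (half_edges P t S)"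
proof (induction S rule: finite_induct)
  case (insert v S)
  have "half_edges P t (insert v S) = half_edges P t {v} \<union> half_edges P t S"
    using half_edges_Un[of P t "{v}" S] by simp
  with insert show ?case by (simp add: half_edges_single)
qed simp

lemma image_fst_SIGMA_count:
  "image_mset fst (mset_set (SIGMA c:set_mset m. {..<count m c})) = m"
proof (rule multiset_eqI)
  fix c
  have "{x \<in> (SIGMA c:set_mset m. {..<count m c}). fst x = c} = {c} \<times> {..<count m c}"
    by (auto dest: count_greater_zero_iff[THEN iffD1, OF le_less_trans[OF le0]])
  then show "count (image_mset fst (mset_set (SIGMA c:set_mset m. {..<count m c}))) c = count m c"
    by (subst count_image_mset_set) (auto simp: card_cartesian_product)
qed

lemma half_colors:
  assumes "finite S"
  shows "image_mset (half_color t) (mset_set (half_edges P t S)) =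
    (\<Sum>s\<in>#filter_mset P (image_mset t (mset_set S)). sym_colors s)"
  using assms
proof (induction S rule: finite_induct)
  case (insert v S)
  have single: "image_mset (half_color t) (mset_set (half_edges P t {v})) =
      (if P (t v) then sym_colors (t v) else {#})"
  proof (cases "P (t v)")
    case True
    let ?m = "gen_parts (snd (t v))"
    let ?E = "SIGMA c:set_mset ?m. {..<count ?m c}"
    have "mset_set (half_edges P t {v}) = image_mset (Pair v) (mset_set ?E)"
      using True by (simp add: half_edges_single image_mset_mset_set inj_on_def)
    then have "image_mset (half_color t) (mset_set (half_edges P t {v})) =
        image_mset ((*) (fst (t v))) (image_mset fst (mset_set ?E))"
      by (simp add: multiset.map_comp comp_def half_color_def)
    then show ?thesis using True by (simp add: image_fst_SIGMA_count sym_colors_def)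
  qed (simp add: half_edges_single)
  have "half_edges P t (insert v S) = half_edges P t {v} \<union> half_edges P t S"
    using half_edges_Un[of P t "{v}" S] by simp
  moreover have "half_edges P t {v} \<inter> half_edges P t S = {}"
    using insert.hyps by (auto simp: half_edges_def)
  ultimately have "mset_set (half_edges P t (insert v S)) =
      mset_set (half_edges P t {v}) + mset_set (half_edges P t S)"
    by (simp add: mset_set_Union finite_half_edges insert.hyps)
  with insert single show ?case by simp
qed simp

lemma card_glue:
  assumes "finite S"
  shows "card (glue t S) =
    (if colorsA (image_mset t (mset_set S)) = colorsB (image_mset t (mset_set S))
     then mfact (colorsA (image_mset t (mset_set S))) else 0)"
  using assms
  by (simp add: glue_def card_cbij finite_half_edges half_colors colorsA_def colorsB_def)

lemma finite_glue: "finite S \<Longrightarrow> finite (glue t S)"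
  by (simp add: glue_def finite_cbij finite_half_edges)

lemma finite_cglue: "finite S \<Longrightarrow> finite (cglue t S)"
  by (simp add: cglue_def finite_glue)

lemma glueD:
  assumes "\<sigma> \<in> glue t V"
  shows "bij_betw \<sigma> (halfA t V) (halfB t V)" "h \<in> halfA t V \<Longrightarrow> \<sigma> h \<in> halfB t V"
    "h \<in> halfA t V \<Longrightarrow> half_color t (\<sigma> h) = half_color t h"
    "h \<notin> halfA t V \<Longrightarrow> \<sigma> h = undefined"
  using cbijD[OF assms[unfolded glue_def]] by blast+

text \<open>The partner of an A-half-edge at a closed set lies at that set, and so does the partner
  of a B-half-edge there. Hence the restriction stays a bijection.\<close>

lemma glue_restrict:
  assumes \<sigma>: "\<sigma> \<in> glue t V" and "S \<subseteq> V" and closed: "glue_closed \<sigma> (halfA t V) S"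
  shows "restrict \<sigma> (halfA t S) \<in> glue t S"
proof -
  have "\<sigma> ` halfA t S = halfB t S"
  proof (intro set_eqI iffI)
    fix y assume "y \<in> \<sigma> ` halfA t S"
    then obtain h where h: "h \<in> halfA t S" "y = \<sigma> h" by auto
    then have hV: "h \<in> halfA t V" using half_edges_mono[OF \<open>S \<subseteq> V\<close>] by auto
    then have "fst (\<sigma> h) \<in> S" using closed h(1) fst_half_edges unfolding glue_closed_def by blast
    then show "y \<in> halfB t S"
      using glueD(2)[OF \<sigma> hV] h(2) half_edges_sub_iff[OF \<open>S \<subseteq> V\<close>] by blast
  next
    fix y assume y: "y \<in> halfB t S"
    then have "y \<in> halfB t V" using half_edges_mono[OF \<open>S \<subseteq> V\<close>] by auto
    then obtain h where h: "h \<in> halfA t V" "y = \<sigma> h"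
      using glueD(1)[OF \<sigma>] unfolding bij_betw_def by blast
    then have "fst h \<in> S" using closed y fst_half_edges unfolding glue_closed_def by blast
    then show "y \<in> \<sigma> ` halfA t S"
      using h half_edges_sub_iff[OF \<open>S \<subseteq> V\<close>] by blast
  qed
  moreover have "inj_on \<sigma> (halfA t S)"
    using glueD(1)[OF \<sigma>] half_edges_mono[OF \<open>S \<subseteq> V\<close>] by (auto simp: bij_betw_def intro: inj_on_subset)
  ultimately have "bij_betw (restrict \<sigma> (halfA t S)) (halfA t S) (halfB t S)"
    by (simp add: bij_betw_def inj_on_def)
  then show ?thesis
    unfolding glue_def
  proof (rule cbijI)
    fix h assume h: "h \<in> halfA t S"
    then have "h \<in> halfA t V" using half_edges_mono[OF \<open>S \<subseteq> V\<close>] by blast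
    from glueD(3)[OF \<sigma> this] h show "half_color t (restrict \<sigma> (halfA t S) h) = half_color t h"
      by simp
  qed simp
qed

lemma glue_closed_Diff: "glue_closed \<sigma> (halfA t V) S \<Longrightarrow> \<sigma> \<in> glue t V \<Longrightarrow> glue_closed \<sigma> (halfA t V) (V - S)"
  unfolding glue_closed_def using fst_half_edges glueD(2) by blast

lemma glue_combine:
  assumes "f \<in> glue t S" "g \<in> glue t (V - S)" "S \<subseteq> V"
  defines "\<sigma> \<equiv> \<lambda>h. if h \<in> halfA t S then f h else g h"
  shows "\<sigma> \<in> glue t V" "glue_closed \<sigma> (halfA t V) S"
    "restrict \<sigma> (halfA t S) = f" "restrict \<sigma> (halfA t (V - S)) = g"
proof -
  have V: "V = S \<union> (V - S)" using assms by auto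
  have disj: "half_edges P t S \<inter> half_edges P t (V - S) = {}" for P
    by (auto simp: half_edges_def)
  have "bij_betw \<sigma> (halfA t S) (halfB t S)"
    using glueD(1)[OF assms(1)] by (subst bij_betw_cong[of _ _ f]) (auto simp: \<sigma>_def)
  moreover have "bij_betw \<sigma> (halfA t (V - S)) (halfB t (V - S))"
    using glueD(1)[OF assms(2)] disj by (subst bij_betw_cong[of _ _ g]) (auto simp: \<sigma>_def)
  ultimately have "bij_betw \<sigma> (halfA t V) (halfB t V)"
    by (subst (1 2) V, unfold half_edges_Un) (rule bij_betw_combine[OF _ _ disj])
  then show "\<sigma> \<in> glue t V"
    unfolding glue_def
  proof (rule cbijI)
    fix h assume "h \<in> halfA t V"
    then have "h \<in> halfA t S \<or> h \<in> halfA t (V - S)" by (simp add: half_edges_split[OF assms(3)])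
    then show "half_color t (\<sigma> h) = half_color t h"
      unfolding \<sigma>_def using glueD(3)[OF assms(1), of h] glueD(3)[OF assms(2), of h] by argo
  next
    fix h assume "h \<notin> halfA t V"
    then have "h \<notin> halfA t S \<and> h \<notin> halfA t (V - S)" by (simp add: half_edges_split[OF assms(3)])
    then show "\<sigma> h = undefined"
      using glueD(4)[OF assms(2)] by (auto simp: \<sigma>_def)
  qed
  show "glue_closed \<sigma> (halfA t V) S"
    unfolding glue_closed_def
  proof
    fix h assume "h \<in> halfA t V"
    then consider "h \<in> halfA t S" | "h \<in> halfA t (V - S)" by (auto simp: half_edges_split[OF assms(3)])
    then show "fst h \<in> S \<longleftrightarrow> fst (\<sigma> h) \<in> S"
    proof cases
      case 1
      then show ?thesis using glueD(2)[OF assms(1) 1] by (auto simp: \<sigma>_def dest: fst_half_edges)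
    next
      case 2
      then show ?thesis
        using glueD(2)[OF assms(2) 2] disj by (auto simp: \<sigma>_def dest: fst_half_edges)
    qed
  qed
  show "restrict \<sigma> (halfA t S) = f"
    using glueD(4)[OF assms(1)] by (auto simp: \<sigma>_def restrict_def fun_eq_iff)
  show "restrict \<sigma> (halfA t (V - S)) = g"
    unfolding \<sigma>_def restrict_def fun_eq_iff using glueD(4)[OF assms(2)] disj[of sideA] by (metis disjoint_iff)
qed

text \<open>For \<open>T\<close> inside the closed set \<open>S\<close>, a glued pair outside
  \<open>S\<close> has both ends outside \<open>T\<close> and imposes no condition.\<close>

lemma glue_closed_restrict_iff:
  assumes "\<sigma> \<in> glue t V" "S \<subseteq> V" "glue_closed \<sigma> (halfA t V) S" "T \<subseteq> S"
  shows "glue_closed (restrict \<sigma> (halfA t S)) (halfA t S) T \<longleftrightarrow> glue_closed \<sigma> (halfA t V) T"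
proof
  assume l: "glue_closed (restrict \<sigma> (halfA t S)) (halfA t S) T"
  show "glue_closed \<sigma> (halfA t V) T"
    unfolding glue_closed_def
  proof
    fix h assume h: "h \<in> halfA t V"
    show "fst h \<in> T \<longleftrightarrow> fst (\<sigma> h) \<in> T"
    proof (cases "fst h \<in> S")
      case True
      then have "h \<in> halfA t S" using half_edges_sub_iff[OF assms(2) h] by simp
      then show ?thesis using l by (simp add: glue_closed_def)
    next
      case False
      then have "fst (\<sigma> h) \<notin> S" using assms(3) h by (simp add: glue_closed_def)
      with False assms(4) show ?thesis by auto
    qed
  qed
next
  assume "glue_closed \<sigma> (halfA t V) T"
  then show "glue_closed (restrict \<sigma> (halfA t S)) (halfA t S) T"
    using half_edges_mono[OF assms(2)] by (auto simp: glue_closed_def)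
qed

text \<open>\<open>S\<close> is a connected component. Connectedness is tested with all half-edges
  in \<open>H\<close>; for closed \<open>S\<close> this agrees with testing the restricted
  gluing.\<close>

definition glue_comp :: "('v half_edge \<Rightarrow> 'v half_edge) \<Rightarrow> 'v half_edge set \<Rightarrow> 'v set \<Rightarrow> bool" where
  "glue_comp \<sigma> H S \<longleftrightarrow> glue_closed \<sigma> H S \<and> glue_conn \<sigma> H S"

text \<open>Cutting along a component yields a connected gluing of \<open>S\<close> and an arbitrary
  gluing of the rest, and any two such gluings can be put together again.\<close>

lemma card_glue_comp:
  assumes "finite V" "S \<subseteq> V"
  shows "card {\<sigma> \<in> glue t V. glue_comp \<sigma> (halfA t V) S} = card (cglue t S) * card (glue t (V - S))"
proof -
  have "bij_betw (\<lambda>\<sigma>. (restrict \<sigma> (halfA t S), restrict \<sigma> (halfA t (V - S))))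
      {\<sigma> \<in> glue t V. glue_comp \<sigma> (halfA t V) S} (cglue t S \<times> glue t (V - S))"
  proof (rule bij_betw_byWitness[where f' = "\<lambda>(f, g) h. if h \<in> halfA t S then f h else g h"])
    show "\<forall>\<sigma>\<in>{\<sigma> \<in> glue t V. glue_comp \<sigma> (halfA t V) S}.
        (case (restrict \<sigma> (halfA t S), restrict \<sigma> (halfA t (V - S))) of
          (f, g) \<Rightarrow> \<lambda>h. if h \<in> halfA t S then f h else g h) = \<sigma>"
      by (auto simp: fun_eq_iff restrict_def half_edges_split[OF assms(2)] dest!: glueD(4))
    show "\<forall>p\<in>cglue t S \<times> glue t (V - S).
        (restrict (case p of (f, g) \<Rightarrow> \<lambda>h. if h \<in> halfA t S then f h else g h) (halfA t S),
         restrict (case p of (f, g) \<Rightarrow> \<lambda>h. if h \<in> halfA t S then f h else g h) (halfA t (V - S))) = p"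
      using glue_combine(3,4)[OF _ _ assms(2)] by (auto simp: cglue_def)
    show "(\<lambda>\<sigma>. (restrict \<sigma> (halfA t S), restrict \<sigma> (halfA t (V - S)))) `
        {\<sigma> \<in> glue t V. glue_comp \<sigma> (halfA t V) S} \<subseteq> cglue t S \<times> glue t (V - S)"
    proof (clarsimp, intro conjI)
      fix \<sigma> assume \<sigma>: "\<sigma> \<in> glue t V" "glue_comp \<sigma> (halfA t V) S"
      then show "restrict \<sigma> (halfA t S) \<in> cglue t S"
        using glue_restrict[OF \<sigma>(1) assms(2)] glue_closed_restrict_iff[OF \<sigma>(1) assms(2)]
        by (auto simp: cglue_def glue_comp_def glue_conn_def)
      show "restrict \<sigma> (halfA t (V - S)) \<in> glue t (V - S)"
        using \<sigma> by (intro glue_restrict[OF \<sigma>(1)] glue_closed_Diff) (auto simp: glue_comp_def)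
    qed
    show "(\<lambda>(f, g) h. if h \<in> halfA t S then f h else g h) ` (cglue t S \<times> glue t (V - S)) \<subseteq>
        {\<sigma> \<in> glue t V. glue_comp \<sigma> (halfA t V) S}"
    proof clarify
      fix f g assume f: "f \<in> cglue t S" and g: "g \<in> glue t (V - S)"
      then have f': "f \<in> glue t S" by (simp add: cglue_def)
      note c = glue_combine[OF f' g assms(2)]
      show "(\<lambda>h. if h \<in> halfA t S then f h else g h) \<in> glue t V \<and>
          glue_comp (\<lambda>h. if h \<in> halfA t S then f h else g h) (halfA t V) S"
        using f c(1,2) glue_closed_restrict_iff[OF c(1) assms(2) c(2)] c(3)
        by (auto simp: glue_comp_def glue_conn_def cglue_def)
    qed
  qed
  then show ?thesis by (simp add: bij_betw_same_card card_cartesian_product)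
qed

text \<open>The component of \<open>v\<close> is the smallest closed set containing
  \<open>v\<close>. If a nonempty closed subset missed \<open>v\<close>, removing it would leave a
  smaller closed set that still contains \<open>v\<close>.\<close>

lemma glue_comp_unique:
  assumes "finite V" "\<sigma> \<in> glue t V" "v \<in> V"
  shows "\<exists>!S. S \<subseteq> V \<and> v \<in> S \<and> glue_comp \<sigma> (halfA t V) S"
proof -
  let ?C = "glue_closed \<sigma> (halfA t V)"
  define S where "S = \<Inter>{S. S \<subseteq> V \<and> v \<in> S \<and> ?C S}"
  have VC: "?C V" using glueD(2)[OF assms(2)] fst_half_edges unfolding glue_closed_def by blast
  have SV: "S \<subseteq> V" and vS: "v \<in> S" and SC: "?C S"
    using assms(3) VC by (auto simp: S_def glue_closed_def)
  have least: "S \<subseteq> T" if "T \<subseteq> V" "v \<in> T" "?C T" for T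
    using that unfolding S_def by blast
  have "T = {} \<or> T = S" if T: "T \<subseteq> S" "?C T" for T
  proof (cases "v \<in> T")
    case True
    then have "S \<subseteq> T" using T SV by (intro least) auto
    with T show ?thesis by auto
  next
    case False
    have "?C (S - T)" using T SC by (auto simp: glue_closed_def)
    then have "S \<subseteq> S - T" using False vS SV by (intro least) auto
    with T show ?thesis by auto
  qed
  then have "glue_comp \<sigma> (halfA t V) S" using SC vS by (auto simp: glue_comp_def glue_conn_def)
  moreover have "T = T'"
    if "v \<in> T" "glue_comp \<sigma> (halfA t V) T" "v \<in> T'" "glue_comp \<sigma> (halfA t V) T'" for T T'
  proof -
    have "?C (T \<inter> T')" using that by (auto simp: glue_comp_def glue_closed_def)
    then have "T \<inter> T' = T" "T \<inter> T' = T'"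
      using that by (auto simp: glue_comp_def glue_conn_def)
    then show ?thesis by simp
  qed
  ultimately show ?thesis using SV vS by blast
qed

text \<open>Pairs of a gluing and a marked vertex are sorted by the component of the mark;
  \<open>card S\<close> is the number of marks belonging to the component \<open>S\<close>. The
  factor \<open>card V\<close> is the labelled form of the Euler derivation.\<close>

lemma card_glue_decompose:
  assumes "finite V"
  shows "card V * card (glue t V) = (\<Sum>S\<in>Pow V. card S * (card (cglue t S) * card (glue t (V - S))))"
proof -
  have "card (glue t V) = (\<Sum>S\<in>Pow V. if v \<in> S then card (cglue t S) * card (glue t (V - S)) else 0)"
    if v: "v \<in> V" for v
  proof -
    have "card (glue t V) = (\<Sum>\<sigma>\<in>glue t V. card {S \<in> Pow V. v \<in> S \<and> glue_comp \<sigma> (halfA t V) S})"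
    proof -
      have "card {S \<in> Pow V. v \<in> S \<and> glue_comp \<sigma> (halfA t V) S} = 1" if "\<sigma> \<in> glue t V" for \<sigma>
        using glue_comp_unique[OF assms that v] by (auto simp: card_1_singleton_iff)
      then show ?thesis by simp
    qed
    also have "\<dots> = (\<Sum>\<sigma>\<in>glue t V. \<Sum>S\<in>Pow V. if v \<in> S \<and> glue_comp \<sigma> (halfA t V) S then 1 else 0)"
      using assms by (simp add: sum.If_cases Int_def)
    also have "\<dots> = (\<Sum>S\<in>Pow V. \<Sum>\<sigma>\<in>glue t V. if v \<in> S \<and> glue_comp \<sigma> (halfA t V) S then 1 else 0)"
      by (rule sum.swap)
    also have "\<dots> = (\<Sum>S\<in>Pow V. if v \<in> S then card (cglue t S) * card (glue t (V - S)) else 0)"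
      using assms
      by (intro sum.cong refl) (auto simp: sum.If_cases finite_glue Int_def card_glue_comp[symmetric])
    finally show ?thesis .
  qed
  then have "(\<Sum>v\<in>V. card (glue t V)) =
      (\<Sum>v\<in>V. \<Sum>S\<in>Pow V. if v \<in> S then card (cglue t S) * card (glue t (V - S)) else 0)"
    by (intro sum.cong refl)
  also have "\<dots> = (\<Sum>S\<in>Pow V. \<Sum>v\<in>V. if v \<in> S then card (cglue t S) * card (glue t (V - S)) else 0)"
    by (rule sum.swap)
  also have "\<dots> = (\<Sum>S\<in>Pow V. card S * (card (cglue t S) * card (glue t (V - S))))"
    using assms by (intro sum.cong refl) (auto simp: sum.If_cases Int_absorb1)
  finally show ?thesis by simp
qed

section \<open>The logarithm of the Hall product counts connected gluings\<close>

definition color_prod :: "partition \<Rightarrow> rat" where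
  "color_prod l = (\<Prod>i\<in>#l. numeral i)"

text \<open>The factor of the weight given by the edge colors over the vertex colors, read off from
  the monomial. It is multiplicative and therefore passes through the exponential formula.\<close>

definition color_ratio :: "(num \<times> gen) multiset \<Rightarrow> rat" where
  "color_ratio m = color_prod (colorsA m) / index_prod m"

definition hall_series :: "gen lring" where
  "hall_series = hall_X (Exp (generic_series GenA)) (Exp (generic_series GenB))"

lemma of_nat_zee: "of_nat (zee l) = color_prod l * of_nat (mfact l)"
proof -
  have "color_prod l = (\<Prod>i\<in>set_mset l. numeral i ^ count l i)"
    unfolding color_prod_def by (rule image_prod_mset_multiplicity)
  then show ?thesis by (simp add: zee_def mfact_def prod.distrib)
qed

lemma color_ratio_add: "color_ratio (a + b) = color_ratio a * color_ratio b"
  by (simp add: color_ratio_def colorsA_def index_prod_def color_prod_def)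

lemma color_prod_pos: "color_prod l > 0"
  unfolding color_prod_def by (induction l) auto

lemma index_prod_pos: "index_prod m > 0"
  unfolding index_prod_def by (induction m) auto

lemma color_ratio_pos: "color_ratio m > 0"
  by (simp add: color_ratio_def color_prod_pos index_prod_pos)

text \<open>The factor \<open>mfact\<close> of \<open>zee\<close> is the number of matchings; the
  product of the parts is left over and goes into \<open>color_ratio\<close>.\<close>

lemma coeff_hall_series_labelled:
  assumes "finite V" "m = image_mset t (mset_set V)"
  shows "of_nat (mfact m) * coeff hall_series m = of_nat (card (glue t V)) * color_ratio m"
proof -
  have "of_nat (mfact m) \<noteq> (0 :: rat)" by (simp add: mfact_pos[THEN gr_implies_not0])
  then show ?thesis
    unfolding hall_series_def coeff_hall_generic card_glue[OF assms(1)] assms(2)[symmetric]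
    by (simp add: color_ratio_def of_nat_zee)
qed

lemma image_mset_set_Diff:
  assumes "finite V" "S \<subseteq> V"
  shows "image_mset t (mset_set V) = image_mset t (mset_set S) + image_mset t (mset_set (V - S))"
proof -
  have "mset_set V = mset_set S + mset_set (V - S)"
    using assms by (metis Diff_disjoint Diff_partition finite_Diff finite_subset mset_set_Union)
  then show ?thesis by simp
qed

definition hall_log :: "gen lring" where
  "hall_log = (SOME P. coeff P {#} = 0 \<and> mps_exp P = hall_series)"

lemma hall_log: "coeff hall_log {#} = 0" "mps_exp hall_log = hall_series"
proof -
  have "coeff hall_series {#} = 1"
    by (simp add: hall_series_def coeff_hall_generic colorsA_def colorsB_def zee_def index_prod_def)
  from someI_ex[OF mps_log_exists[OF this]]
  show "coeff hall_log {#} = 0" "mps_exp hall_log = hall_series"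
    unfolding hall_log_def by blast+
qed

text \<open>
  Both sides satisfy the recursion of the exponential formula: on the left by splitting a gluing
  into the component of a marked vertex and the rest.
\<close>

lemma coeff_hall_log_labelled:
  assumes "finite V"
  shows "of_nat (mfact (image_mset t (mset_set V))) * coeff hall_log (image_mset t (mset_set V)) =
    of_nat (card (cglue t V)) * color_ratio (image_mset t (mset_set V))"
  using assms
proof (induction V rule: finite_psubset_induct)
  case (psubset V)
  let ?t = "\<lambda>S. image_mset t (mset_set S)"
  let ?m = "?t V"
  let ?H = "\<lambda>m. of_nat (mfact m) * coeff hall_series m"
  let ?P = "\<lambda>m. of_nat (mfact m) * coeff hall_log m"
  let ?C = "\<lambda>S. of_nat (card (cglue t S)) * color_ratio (?t S)"
  have fin: "finite S" if "S \<in> Pow V" for S using that psubset.hyps finite_subset by auto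
  have H: "?H (?t S) = of_nat (card (glue t S)) * color_ratio (?t S)" if "S \<in> Pow V" for S
    using coeff_hall_series_labelled[OF fin[OF that] refl] .
  have split: "?m = ?t S + ?t (V - S)" if "S \<in> Pow V" for S
    using image_mset_set_Diff[OF psubset.hyps] that by auto
  have "of_nat (card V) * ?H ?m =
      of_nat (card V * card (glue t V)) * color_ratio ?m"
    by (simp add: H)
  also have "\<dots> = (\<Sum>S\<in>Pow V. of_nat (card S) * (?C S * ?H (?t (V - S))))"
    unfolding card_glue_decompose[OF psubset.hyps] of_nat_sum sum_distrib_right
  proof (rule sum.cong[OF refl])
    fix S assume S: "S \<in> Pow V"
    have "color_ratio ?m = color_ratio (?t S) * color_ratio (?t (V - S))"
      using split[OF S] color_ratio_add by metis
    moreover have "?H (?t (V - S)) = of_nat (card (glue t (V - S))) * color_ratio (?t (V - S))"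
      by (rule H) auto
    ultimately show "of_nat (card S * (card (cglue t S) * card (glue t (V - S)))) * color_ratio ?m =
        of_nat (card S) * (?C S * ?H (?t (V - S)))"
      by simp
  qed
  finally have 1: "of_nat (card V) * ?H ?m = \<dots>" .
  \<comment> \<open>The analytic side: the Euler recursion, brought from submultisets to subsets of
    \<open>V\<close> by absorbing the factorials into binomial multiplicities.\<close>
  have "of_nat (card V) * ?H ?m = of_nat (mfact ?m) * (of_nat (size ?m) * coeff hall_series ?m)"
    by simp
  also have "\<dots> = (\<Sum>b | b \<subseteq># ?m. of_nat (mfact ?m) *
      (coeff hall_series (?m - b) * (of_nat (size b) * coeff hall_log b)))"
    using coeff_mps_exp_rec[OF hall_log(1), of ?m] by (simp add: hall_log(2) sum_distrib_left)
  also have "\<dots> = (\<Sum>b | b \<subseteq># ?m. of_nat (mchoose ?m b) * (of_nat (size b) * (?P b * ?H (?m - b))))"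
  proof (rule sum.cong[OF refl])
    fix b assume "b \<in> {b. b \<subseteq># ?m}"
    then have "mfact ?m = mchoose ?m b * mfact b * mfact (?m - b)" by (simp add: mchoose_mfact)
    then have eq: "(of_nat (mfact ?m) :: rat) = of_nat (mchoose ?m b) * of_nat (mfact b) * of_nat (mfact (?m - b))"
      by (metis of_nat_mult)
    show "of_nat (mfact ?m) * (coeff hall_series (?m - b) * (of_nat (size b) * coeff hall_log b)) =
        of_nat (mchoose ?m b) * (of_nat (size b) * (?P b * ?H (?m - b)))"
      unfolding eq by (simp only: ac_simps)
  qed
  also have "\<dots> = (\<Sum>S\<in>Pow V. of_nat (size (?t S)) * (?P (?t S) * ?H (?m - ?t S)))"
    by (rule sum_Pow_image_mset[OF psubset.hyps, symmetric])
  also have "\<dots> = (\<Sum>S\<in>Pow V. of_nat (card S) * (?P (?t S) * ?H (?t (V - S))))"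
  proof (rule sum.cong[OF refl])
    fix S assume "S \<in> Pow V"
    from split[OF this] have "?m - ?t S = ?t (V - S)" by (metis add_diff_cancel_left')
    then show "of_nat (size (?t S)) * (?P (?t S) * ?H (?m - ?t S)) =
        of_nat (card S) * (?P (?t S) * ?H (?t (V - S)))" by simp
  qed
  finally have "(\<Sum>S\<in>Pow V. of_nat (card S) * (?C S * ?H (?t (V - S)))) =
      (\<Sum>S\<in>Pow V. of_nat (card S) * (?P (?t S) * ?H (?t (V - S))))"
    using 1 by simp
  \<comment> \<open>Proper subsets agree by induction, so the terms for \<open>S = V\<close> agree
    as well; there the rest is the empty family, with coefficient 1.\<close>
  moreover have "(\<Sum>S\<in>Pow V - {V}. of_nat (card S) * (?C S * ?H (?t (V - S)))) =
      (\<Sum>S\<in>Pow V - {V}. of_nat (card S) * (?P (?t S) * ?H (?t (V - S))))"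
  proof (rule sum.cong[OF refl])
    fix S assume "S \<in> Pow V - {V}"
    then have "S \<subset> V" by blast
    from psubset.IH[OF this] show "of_nat (card S) * (?C S * ?H (?t (V - S))) =
        of_nat (card S) * (?P (?t S) * ?H (?t (V - S)))" by simp
  qed
  ultimately have "of_nat (card V) * (?C V * ?H (?t (V - V))) = of_nat (card V) * (?P (?t V) * ?H (?t (V - V)))"
    using psubset.hyps by (simp add: sum.remove[of "Pow V" V])
  moreover have "?H (?t (V - V)) = 1"
    using coeff_mps_exp_empty[OF hall_log(1)] by (simp add: hall_log(2))
  ultimately show ?case
  proof (cases "V = {}")
    case True
    then show ?thesis by (simp add: hall_log(1) cglue_def glue_conn_def)
  qed (use psubset.hyps in simp)
qed

text \<open>The labels are natural numbers because the isomorphism classes are formed among graphs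
  whose vertices are natural numbers.\<close>

lemma multiset_labelling:
  obtains V :: "nat set" and t where "finite V" "m = image_mset t (mset_set V)"
proof -
  obtain xs where xs: "mset xs = m" using ex_mset[of m] by (rule exE)
  have "m = mset (map ((!) xs) [0..<length xs])" by (simp only: map_nth xs)
  also have "\<dots> = image_mset ((!) xs) (mset_set {0..<length xs})" by (simp only: mset_map mset_upt)
  finally have "m = image_mset ((!) xs) (mset_set {0..<length xs})" .
  then show thesis by (rule that[of "{0..<length xs}" "(!) xs", OF finite_atLeastLessThan])
qed

lemma mfact_pscale [simp]: "mfact (pscale n m) = mfact m"
  unfolding pscale_def by (rule mfact_image_inj) (auto simp: inj_def num_mult_left_cancel)

lemma colorsA_pscale: "colorsA (pscale n m) = image_mset ((*) n) (colorsA m)"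
  unfolding colorsA_def
  by (induction m)
    (auto simp: pscale_def sym_colors_def multiset.map_comp comp_def num_mult_assoc)

lemma color_prod_scale: "color_prod (image_mset ((*) n) l) = numeral n ^ size l * color_prod l"
  unfolding color_prod_def by (induction l) (auto simp: numeral_mult simp del: numeral_times_numeral)

lemma index_prod_pscale: "index_prod (pscale n m) = numeral n ^ size m * index_prod m"
  unfolding index_prod_def pscale_def by (induction m) (auto simp: numeral_mult simp del: numeral_times_numeral)

text \<open>Multiplying every vertex color by \<open>n\<close> multiplies every half-edge color by
  \<open>n\<close>, so the connected gluings stay the same and only \<open>color_ratio\<close>
  changes. The identity is multiplied out to keep the exponents natural.\<close>

lemma coeff_hall_log_pscale:
  "coeff hall_log (pscale n m) * numeral n ^ size m = numeral n ^ size (colorsA m) * coeff hall_log m"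
proof -
  obtain V :: "nat set" and t where V: "finite V" "m = image_mset t (mset_set V)"
    by (rule multiset_labelling)
  define t' where "t' = (\<lambda>v. (n * fst (t v), snd (t v)))"
  have m': "pscale n m = image_mset t' (mset_set V)"
    by (simp add: V pscale_def t'_def multiset.map_comp comp_def case_prod_unfold)
  have half: "half_edges P t' V = half_edges Q t V" if "\<And>v. P (t' v) = Q (t v)" for P Q
    using that by (auto simp: half_edges_def t'_def)
  have A: "halfA t' V = halfA t V" "halfB t' V = halfB t V"
    by (rule half; simp add: t'_def)+
  have "half_color t' h = n * half_color t h" for h
    by (simp add: half_color_def t'_def num_mult_assoc)
  then have "glue t' V = glue t V"
    unfolding glue_def A by (simp add: cbij_def num_mult_left_cancel)
  then have "cglue t' V = cglue t V" by (simp add: cglue_def A)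
  then have "of_nat (mfact m) * coeff hall_log (pscale n m) / color_ratio (pscale n m) =
      of_nat (mfact m) * coeff hall_log m / color_ratio m"
    using coeff_hall_log_labelled[OF V(1), of t] coeff_hall_log_labelled[OF V(1), of t']
    unfolding m'[symmetric] V(2)[symmetric]
    by (simp add: color_ratio_pos[THEN less_imp_neq, symmetric])
  moreover have "(of_nat (mfact m) :: rat) > 0" by simp
  ultimately have "coeff hall_log (pscale n m) / color_ratio (pscale n m) = coeff hall_log m / color_ratio m"
    unfolding times_divide_eq_right[symmetric] mult_cancel_left by linarith
  then have eq: "coeff hall_log (pscale n m) = coeff hall_log m / color_ratio m * color_ratio (pscale n m)"
    using color_ratio_pos[of "pscale n m"] by (simp add: nonzero_divide_eq_eq)
  have "color_ratio (pscale n m) * numeral n ^ size m = numeral n ^ size (colorsA m) * color_ratio m"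
    using index_prod_pos[of m]
    by (simp add: color_ratio_def colorsA_pscale color_prod_scale index_prod_pscale)
  then show ?thesis
    unfolding eq mult.assoc using color_ratio_pos[of m] by simp
qed

section \<open>Inversion of the sum over Adams operations\<close>

section \<open>A divisor sum\<close>

text \<open>The exponent \<open>i\<close> is recovered as the multiplicity of \<open>p\<close>,
  which makes the factorization unique.\<close>

lemma divisors_prime_power_mult:
  fixes p m :: nat
  assumes p: "prime p" and m: "\<not> p dvd m"
  shows "bij_betw (\<lambda>(i, d). p ^ i * d) ({..a} \<times> {d. d dvd m}) {d. d dvd p ^ a * m}"
  unfolding bij_betw_def
proof
  have mult: "multiplicity p (p ^ i * d) = i" if "d dvd m" for i d
  proof -
    have "\<not> p dvd d" using m that dvd_trans by blast
    then show ?thesis using p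
      by (intro multiplicity_eqI) (auto simp: prime_gt_0_nat)
  qed
  show "inj_on (\<lambda>(i, d). p ^ i * d) ({..a} \<times> {d. d dvd m})"
  proof (rule inj_onI, clarify)
    fix i d j e assume "d dvd m" "e dvd m" and eq: "p ^ i * d = p ^ j * e"
    then have "i = j" using mult by metis
    with eq p show "i = j \<and> d = e" by (auto simp: prime_gt_0_nat)
  qed
  show "(\<lambda>(i, d). p ^ i * d) ` ({..a} \<times> {d. d dvd m}) = {d. d dvd p ^ a * m}"
  proof (intro set_eqI iffI)
    fix x assume "x \<in> {d. d dvd p ^ a * m}"
    then obtain b c where "x = b * c" "b dvd p ^ a" "c dvd m"
      using division_decomp[of x "p ^ a" m] by auto
    moreover from this obtain i where "i \<le> a" "b = p ^ i"
      using divides_primepow_nat[OF p] by blast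
    ultimately show "x \<in> (\<lambda>(i, d). p ^ i * d) ` ({..a} \<times> {d. d dvd m})" by force
  qed (auto intro: mult_dvd_mono le_imp_power_dvd)
qed

lemma phi_prime_power_mult:
  assumes p: "prime p" and m: "\<not> p dvd m" "m > 0"
  shows "phi b (p ^ k * m) = (if k = 0 then 1 else 1 - of_nat p powi (- b)) * phi b m"
proof (cases "k = 0")
  case False
  have "{q. prime q \<and> q dvd p ^ k * m} = insert p {q. prime q \<and> q dvd m}"
    using p False by (auto simp: prime_dvd_mult_iff prime_dvd_power_iff primes_dvd_imp_eq)
  moreover have "finite {q. prime q \<and> q dvd m}"
    using m(2) by (intro finite_subset[OF _ finite_atMost[of m]]) (auto dest: dvd_imp_le)
  ultimately show ?thesis using m False by (simp add: phi_def)
qed simp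

text \<open>The induction removes the full power p^a of one prime. With x = p^(-b), the divisors
  with p-part p^i contribute the factor x^i (1 - x) for i < a and x^a for i = a, since phi loses its
  factor at p exactly when the whole power is divided out. These factors telescope to 1.\<close>

lemma sum_divisors_phi:
  assumes "n > 0"
  shows "(\<Sum>d | d dvd n. of_nat d powi (- b) * phi b (n div d)) = 1"
  using assms
proof (induction n rule: less_induct)
  case (less n)
  show ?case
  proof (cases "n = 1")
    case True
    have "{d :: nat. d dvd 1} = {1}" by auto
    moreover have "phi b 1 = 1"
      unfolding phi_def by (rule prod.neutral) auto
    ultimately show ?thesis using True by simp
  next
    case False
    then obtain p where p: "prime p" "p dvd n" using prime_factor_nat by blast
    obtain m where m: "n = p ^ multiplicity p n * m" "\<not> p dvd m"
      using multiplicity_decompose'[of n p] less.prems p(1) by (metis not_prime_unit neq0_conv)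
    let ?a = "multiplicity p n"
    have a: "?a > 0" using p less.prems by (simp add: prime_multiplicity_gt_zero_iff)
    have m0: "m > 0" using m less.prems by (metis gr0I mult_0_right)
    have "p ^ ?a > 1" using a p(1) by (metis one_less_power prime_gt_1_nat)
    then have "m < n" using m(1) m0 by (metis mult.commute nat_mult_less_cancel1 mult_1_right mult_less_cancel1)
    define x where "x = (of_nat p :: rat) powi (- b)"
    have xi: "of_nat (p ^ i) powi (- b) = x ^ i" for i
      unfolding x_def by (induction i) (auto simp: power_int_mult_distrib)
    have term_eq: "of_nat (p ^ i * d) powi (- b) * phi b (n div (p ^ i * d)) =
        (x ^ i * (if i = ?a then 1 else 1 - x)) * (of_nat d powi (- b) * phi b (m div d))"
      if i: "i \<le> ?a" and d: "d dvd m" for i d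
    proof -
      have d0: "d > 0" using d m0 by (metis dvd_0_left gr0I)
      have "n = (p ^ i * d) * (p ^ (?a - i) * (m div d))"
        using m(1) i d by (metis (no_types, lifting) dvd_mult_div_cancel le_add_diff_inverse mult.assoc mult.left_commute power_add)
      then have "n div (p ^ i * d) = p ^ (?a - i) * (m div d)"
        using d0 prime_gt_0_nat[OF p(1)] by (metis nonzero_mult_div_cancel_left mult_pos_pos neq0_conv zero_less_power)
      moreover have "\<not> p dvd m div d" using m(2) d by (metis dvd_div_mult_self dvd_mult2)
      moreover have "m div d > 0" using d m0 by (metis dvd_div_eq_0_iff gr0I)
      ultimately have "phi b (n div (p ^ i * d)) = (if i = ?a then 1 else 1 - x) * phi b (m div d)"
        using i by (simp add: phi_prime_power_mult[OF p(1)] x_def)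
      moreover have "of_nat (p ^ i * d) powi (- b) = x ^ i * of_nat d powi (- b)"
        unfolding of_nat_mult power_int_mult_distrib xi ..
      ultimately show ?thesis by simp
    qed
    have "bij_betw (\<lambda>(i, d). p ^ i * d) ({..?a} \<times> {d. d dvd m}) {d. d dvd n}"
      using divisors_prime_power_mult[OF p(1) m(2), of ?a] by (simp only: m(1)[symmetric])
    from sum.reindex_bij_betw[OF this, of "\<lambda>d. of_nat d powi (- b) * phi b (n div d)"]
    have "(\<Sum>d | d dvd n. of_nat d powi (- b) * phi b (n div d)) =
        (\<Sum>(i, d)\<in>{..?a} \<times> {d. d dvd m}. of_nat (p ^ i * d) powi (- b) * phi b (n div (p ^ i * d)))"
      by (simp only: case_prod_unfold)
    also have "\<dots> = (\<Sum>(i, d)\<in>{..?a} \<times> {d. d dvd m}.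
        (x ^ i * (if i = ?a then 1 else 1 - x)) * (of_nat d powi (- b) * phi b (m div d)))"
      by (rule sum.cong[OF refl]) (use term_eq in force)
    also have "\<dots> = (\<Sum>i\<le>?a. x ^ i * (if i = ?a then 1 else 1 - x)) *
        (\<Sum>d | d dvd m. of_nat d powi (- b) * phi b (m div d))"
      by (simp add: sum_product sum.cartesian_product)
    also have "(\<Sum>d | d dvd m. of_nat d powi (- b) * phi b (m div d)) = 1"
      using less.IH[OF \<open>m < n\<close> m0] .
    also have "(\<Sum>i\<le>?a. x ^ i * (if i = ?a then 1 else 1 - x)) = 1"
    proof -
      have "(\<Sum>i<k. x ^ i * (1 - x)) + x ^ k = 1" for k
        by (induction k) (auto simp: algebra_simps)
      then show ?thesis by (simp add: lessThan_Suc_atMost[symmetric])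
    qed
    finally show ?thesis by simp
  qed
qed

section \<open>The series of connected gluings\<close>

text \<open>In the monomial of a connected graph the symbols are the vertices and the A-half-edges
  are the edges, so this is the first Betti number.\<close>

definition mono_betti :: "(num \<times> gen) multiset \<Rightarrow> int" where
  "mono_betti m = int (size (colorsA m)) - int (size m) + 1"

text \<open>The gcd of the vertex colors. For the graphs in question it equals the gcd of all
  colors, as each edge color is a multiple of the color of an end.\<close>

definition mono_gcd :: "(num \<times> gen) multiset \<Rightarrow> nat" where
  "mono_gcd m = Gcd ((\<lambda>s. numeral (fst s)) ` set_mset m)"

text \<open>The candidate for \<open>L\<close>; its expansion over graphs is the content of
  \<open>class_sum\<close>.\<close>

lift_definition gluing_series :: "gen lring" is
  "\<lambda>m. phi (mono_betti m) (mono_gcd m) * coeff hall_log m" .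

lemma mono_gcd_pos: "m \<noteq> {#} \<Longrightarrow> mono_gcd m > 0"
  unfolding mono_gcd_def by (rule gr0I) (auto simp: Gcd_0_iff elim!: multiset_nonemptyE)

lemma mono_gcd_pscale: "mono_gcd (pscale k m) = numeral k * mono_gcd m"
proof -
  have "(\<lambda>s. numeral (fst s)) ` set_mset (pscale k m) =
      (*) (numeral k) ` ((\<lambda>s. numeral (fst s) :: nat) ` set_mset m)"
    by (force simp: pscale_def numeral_mult image_image case_prod_unfold simp del: numeral_times_numeral)
  then show ?thesis by (simp add: mono_gcd_def Gcd_mult)
qed

lemma mono_betti_pscale: "mono_betti (pscale k m) = mono_betti m"
  by (simp add: mono_betti_def colorsA_pscale) (simp add: pscale_def)

lemma ex_numeral: "n > 0 \<Longrightarrow> \<exists>k. n = (numeral k :: nat)"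
  by (metis nat_of_num_numeral num_of_nat_inverse)

lemma pscale_divides:
  assumes "numeral k dvd mono_gcd m"
  shows "m \<in> range (pscale k)"
proof -
  have "\<exists>l. fst s = k * l" if "s \<in># m" for s
  proof -
    have "numeral k dvd (numeral (fst s) :: nat)"
      using assms that unfolding mono_gcd_def by (meson Gcd_dvd dvd_trans imageI)
    then obtain j where j: "(numeral (fst s) :: nat) = numeral k * j" by (auto simp: dvd_def)
    then have "j > 0" by (intro gr0I) simp
    then obtain l where "j = numeral l" using ex_numeral by blast
    with j have "(numeral (fst s) :: nat) = numeral (k * l)" by (simp add: numeral_mult del: numeral_times_numeral)
    then show ?thesis by auto
  qed
  then obtain f where f: "\<And>s. s \<in># m \<Longrightarrow> fst s = k * f s" by metis
  have "pscale k (image_mset (\<lambda>s. (f s, snd s)) m) = image_mset (\<lambda>s. s) m"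
    unfolding pscale_def multiset.map_comp
    by (rule image_mset_cong) (simp add: f[symmetric])
  then show ?thesis by (metis image_mset_cong multiset.map_ident rangeI)
qed

text \<open>Scaling by \<open>k\<close> multiplies the coefficient of \<open>hall_log\<close> by
  k^(b - 1). Expressing the old coefficient by the new one and including 1/k leaves k^(-b).\<close>

lemma coeff_gluing_series_pscale:
  "coeff gluing_series m / numeral k = numeral k powi (- mono_betti m) *
     phi (mono_betti m) (mono_gcd m) * coeff hall_log (pscale k m)"
proof -
  have "coeff hall_log (pscale k m) =
      numeral k ^ size (colorsA m) / numeral k ^ size m * coeff hall_log m"
    using coeff_hall_log_pscale[of k m] by (simp add: eq_divide_eq)
  moreover have "numeral k powi (int (size (colorsA m)) - int (size m)) =
      (numeral k ^ size (colorsA m) / numeral k ^ size m :: rat)"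
    by (simp add: power_int_diff)
  ultimately have "coeff hall_log (pscale k m) = numeral k powi (mono_betti m - 1) * coeff hall_log m"
    by (simp add: mono_betti_def)
  moreover have "numeral k powi (- mono_betti m) * numeral k powi (mono_betti m - 1) = (1 / numeral k :: rat)"
    by (subst power_int_add[symmetric]) (auto simp: power_int_minus inverse_eq_divide)
  ultimately show ?thesis
    by (simp add: gluing_series.rep_eq mult_ac)
qed

lemma coeff_gluing_series_empty: "coeff gluing_series {#} = 0"
  by (simp add: gluing_series.rep_eq hall_log(1))

lemma numeral_image_dvd:
  assumes "(g :: nat) > 0"
  shows "(numeral :: num \<Rightarrow> nat) ` {k. numeral k dvd g} = {d. d dvd g}"
proof (intro set_eqI iffI)
  fix d assume d: "d \<in> {d. d dvd g}"
  then have "d > 0" using assms by (auto intro: gr0I)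
  then obtain k where "d = numeral k" using ex_numeral by blast
  with d show "d \<in> numeral ` {k. numeral k dvd g}" by auto
qed auto

lemma finite_num_dvd: "(g :: nat) > 0 \<Longrightarrow> finite {k :: num. numeral k dvd g}"
  using numeral_image_dvd[of g] by (intro finite_imageD[of "numeral :: num \<Rightarrow> nat"]) (auto simp: inj_on_def)

text \<open>The Adams operation of index \<open>k\<close> reaches \<open>m\<close> only if
  \<open>k\<close> divides all indices occurring in \<open>m\<close>.\<close>

lemma coeff_Exp_log:
  assumes "m \<noteq> {#}"
  shows "coeff (Exp_log G) m = (\<Sum>k | numeral k dvd mono_gcd m. coeff (adams k G) m / numeral k)"
proof -
  have "coeff (Exp_log G) m =
      (\<Sum>k | numeral k dvd mono_gcd m. coeff (mps_const (1 / numeral k) * adams k G) m)"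
    unfolding Exp_log_def
  proof (rule coeff_mps_Sum_finite[OF finite_num_dvd[OF mono_gcd_pos[OF assms]]])
    fix k :: num assume "k \<in> UNIV - {k. numeral k dvd mono_gcd m}"
    then have "m \<notin> range (pscale k)" by (auto simp: mono_gcd_pscale)
    then show "coeff (mps_const (1 / numeral k) * adams k G) m = 0"
      by (simp add: coeff_adams_outside)
  qed simp
  then show ?thesis by simp
qed

lemma Exp_log_gluing_series: "Exp_log gluing_series = hall_log"
proof (rule mps_eqI)
  fix m
  show "coeff (Exp_log gluing_series) m = coeff hall_log m"
  proof (cases "m = {#}")
    case True
    then show ?thesis by (simp add: coeff_Exp_log_empty coeff_gluing_series_empty hall_log(1))
  next
    case False
    let ?b = "mono_betti m" and ?g = "mono_gcd m"
    let ?K = "{k :: num. numeral k dvd ?g}"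
    have g: "?g > 0" by (rule mono_gcd_pos[OF False])
    \<comment> \<open>Dividing the indices by \<open>k\<close> keeps the Betti number and divides
      the gcd by \<open>k\<close>, so all terms are multiples of the same coefficient of
      \<open>hall_log\<close>.\<close>
    have trm: "coeff (adams k gluing_series) m / numeral k =
        of_nat (numeral k) powi (- ?b) * phi ?b (?g div numeral k) * coeff hall_log m"
      if "k \<in> ?K" for k
    proof -
      from that pscale_divides obtain m' where m': "m = pscale k m'" by blast
      have "?b = mono_betti m'" "?g div numeral k = mono_gcd m'"
        by (simp_all add: m' mono_betti_pscale mono_gcd_pscale)
      then show ?thesis
        using coeff_gluing_series_pscale[of m' k] by (simp add: m' coeff_adams_pscale mono_betti_pscale mono_gcd_pscale)
    qed
    have "coeff (Exp_log gluing_series) m = (\<Sum>k\<in>?K. coeff (adams k gluing_series) m / numeral k)"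
      by (rule coeff_Exp_log[OF False])
    also have "\<dots> = (\<Sum>k\<in>?K. of_nat (numeral k) powi (- ?b) * phi ?b (?g div numeral k) * coeff hall_log m)"
      by (rule sum.cong[OF refl trm])
    also have "\<dots> = (\<Sum>d\<in>numeral ` ?K. of_nat d powi (- ?b) * phi ?b (?g div d) * coeff hall_log m)"
      by (subst sum.reindex) (auto simp: inj_on_def)
    also have "\<dots> = (\<Sum>d | d dvd ?g. of_nat d powi (- ?b) * phi ?b (?g div d)) * coeff hall_log m"
      by (simp only: numeral_image_dvd[OF g] sum_distrib_right)
    finally show ?thesis by (simp add: sum_divisors_phi[OF g])
  qed
qed

lemma Exp_gluing_series:
  "Exp gluing_series = hall_X (Exp (generic_series GenA)) (Exp (generic_series GenB))"
  by (simp add: Exp_eq Exp_log_gluing_series hall_log(2) hall_series_def)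

section \<open>Homogeneity, finiteness and uniqueness of the plethystic logarithm\<close>

section \<open>Existence and uniqueness of the logarithm\<close>

text \<open>The total weight bounds both the size of the multiset and the weight of its elements.
  Applied to degrees, this makes the homogeneous parts of \<open>L\<close> polynomials.\<close>

lemma finite_mset_weight_le:
  fixes w :: "'a \<Rightarrow> nat"
  assumes "\<And>x. w x \<ge> 1" and "\<And>N. finite {x. w x \<le> N}"
  shows "finite {m. (\<Sum>x\<in>#m. w x) \<le> N}"
proof (rule finite_subset)
  have "size m \<le> (\<Sum>x\<in>#m. w x)" for m
    by (induction m) (auto intro: add_mono order_trans[OF _ add_mono[OF assms(1)]])
  moreover have "w x \<le> (\<Sum>x\<in>#m. w x)" if "x \<in># m" for x m
    using that by (auto dest!: multi_member_split)
  ultimately show "{m. (\<Sum>x\<in>#m. w x) \<le> N} \<subseteq> mset ` {xs. set xs \<subseteq> {x. w x \<le> N} \<and> length xs \<le> N}"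
  proof (intro subsetI)
    fix m assume m: "m \<in> {m. (\<Sum>x\<in>#m. w x) \<le> N}"
    obtain xs where xs: "mset xs = m" using ex_mset[of m] by (rule exE)
    have "set xs \<subseteq> {x. w x \<le> N}"
      using m \<open>\<And>x m. x \<in># m \<Longrightarrow> w x \<le> (\<Sum>x\<in>#m. w x)\<close>[of _ m] xs
      by (metis (mono_tags, lifting) mem_Collect_eq order_trans set_mset_mset subsetI)
    moreover have "length xs \<le> N"
      using m \<open>\<And>m. size m \<le> (\<Sum>x\<in>#m. w x)\<close>[of m] xs by (metis le_trans mem_Collect_eq size_mset)
    ultimately show "m \<in> mset ` {xs. set xs \<subseteq> {x. w x \<le> N} \<and> length xs \<le> N}"
      using xs by blast
  qed
  show "finite (mset ` {xs. set xs \<subseteq> {x. w x \<le> N} \<and> length xs \<le> N})"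
    by (intro finite_imageI finite_lists_length_le assms(2))
qed

lemma finite_num_le: "finite {k :: num. numeral k \<le> (N :: nat)}"
  by (rule finite_imageD[of "numeral :: num \<Rightarrow> nat"]) (auto intro: finite_subset[of _ "{..N}"] simp: inj_on_def)

lemma finite_psize_le: "finite {l. psize l \<le> N}"
  unfolding psize_def by (rule finite_mset_weight_le) (auto simp: finite_num_le)

lemma psize_parts_pos: "psize (parts l) > 0"
proof -
  obtain i where "i \<in># parts l" using parts[of l] by (auto elim: multiset_nonemptyE)
  then show ?thesis by (auto simp: psize_def dest!: multi_member_split)
qed

definition sym_deg :: "num \<times> gen \<Rightarrow> nat" where
  "sym_deg s = degA_sym s + degB_sym s"

lemma sym_deg_eq: "sym_deg s = numeral (fst s) * psize (gen_parts (snd s))"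
  by (cases s; cases "snd s") (auto simp: sym_deg_def)

lemma psize_gen_parts_pos: "psize (gen_parts g) > 0"
  by (cases g) (auto simp: psize_parts_pos)

lemma finite_sym_deg_le: "finite {s. sym_deg s \<le> N}"
proof (rule finite_subset)
  have fin: "finite {l. psize (parts l) \<le> N}"
    using finite_vimageI[OF finite_psize_le[of N], of parts] by (simp add: vimage_def inj_def parts_inject)
  show "{s. sym_deg s \<le> N} \<subseteq> {k. numeral k \<le> N} \<times>
      (GenA ` {l. psize (parts l) \<le> N} \<union> GenB ` {l. psize (parts l) \<le> N})"
  proof
    fix s assume s: "s \<in> {s. sym_deg s \<le> N}"
    have "numeral (fst s) \<le> sym_deg s" "psize (gen_parts (snd s)) \<le> sym_deg s"
      unfolding sym_deg_eq using psize_gen_parts_pos[of "snd s"] by simp_all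
    with s have "numeral (fst s) \<le> N" "psize (gen_parts (snd s)) \<le> N" by auto
    then show "s \<in> {k. numeral k \<le> N} \<times>
        (GenA ` {l. psize (parts l) \<le> N} \<union> GenB ` {l. psize (parts l) \<le> N})"
      by (cases s; cases "snd s") auto
  qed
  show "finite ({k :: num. numeral k \<le> N} \<times>
      (GenA ` {l. psize (parts l) \<le> N} \<union> GenB ` {l. psize (parts l) \<le> N}))"
    using fin by (simp add: finite_num_le)
qed

lemma sym_deg_pos: "sym_deg s > 0"
  by (simp add: sym_deg_eq psize_gen_parts_pos)

lemma finite_degree_le: "finite {m. (\<Sum>s\<in>#m. sym_deg s) \<le> N}"
  by (rule finite_mset_weight_le) (simp_all add: finite_sym_deg_le sym_deg_pos Suc_le_eq)

lemma psize_scale: "psize (image_mset ((*) k) l) = numeral k * psize l"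
  unfolding psize_def
  by (induction l) (auto simp: numeral_mult distrib_left simp del: numeral_times_numeral)

text \<open>The degree of a symbol is the sum of the colors of its half-edges. Matching colors on
  both sides therefore force equal A-degree and B-degree.\<close>

lemma degree_colors:
  "(\<Sum>s\<in>#m. degA_sym s) = psize (colorsA m)" "(\<Sum>s\<in>#m. degB_sym s) = psize (colorsB m)"
proof -
  have add: "psize (a + b) = psize a + psize b" for a b by (simp add: psize_def)
  have A: "degA_sym s = (if sideA s then psize (sym_colors s) else 0)"
    "degB_sym s = (if sideA s then 0 else psize (sym_colors s))" for s
    by (cases s; cases "snd s"; auto simp: sym_colors_def psize_scale)+
  have z: "psize {#} = 0" by (simp add: psize_def)
  show "(\<Sum>s\<in>#m. degA_sym s) = psize (colorsA m)" "(\<Sum>s\<in>#m. degB_sym s) = psize (colorsB m)"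
    unfolding colorsA_def colorsB_def A by (induction m) (auto simp: add z)
qed

lemma coeff_gluing_series_nonzero:
  assumes "coeff gluing_series m \<noteq> 0"
  shows "colorsA m = colorsB m"
proof -
  obtain V :: "nat set" and t where V: "finite V" "m = image_mset t (mset_set V)"
    by (rule multiset_labelling)
  have "coeff hall_log m \<noteq> 0" using assms by (simp add: gluing_series.rep_eq)
  then have "card (cglue t V) \<noteq> 0"
    using coeff_hall_log_labelled[OF V(1), of t] unfolding V(2)[symmetric]
    by (intro notI) (simp add: mfact_pos[THEN gr_implies_not0])
  then have "cglue t V \<noteq> {}" by (intro notI) simp
  then have "card (glue t V) \<noteq> 0" using finite_glue[OF V(1)] by (auto simp: cglue_def)
  then show ?thesis by (auto simp: card_glue[OF V(1)] V(2)[symmetric] split: if_splits)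
qed

lemma is_L_gluing_series: "is_L gluing_series"
proof -
  \<comment> \<open>Sorting by A-degree already gives bihomogeneous parts, because the B-degree
    equals it on the support.\<close>
  define Ln where "Ln n = Abs_mps (\<lambda>m. if (\<Sum>s\<in>#m. degA_sym s) = n then coeff gluing_series m else 0)" for n
  have Ln: "coeff (Ln n) m = (if (\<Sum>s\<in>#m. degA_sym s) = n then coeff gluing_series m else 0)" for n m
    by (simp add: Ln_def Abs_mps_inverse)
  have bi: "bihomogeneous n n (Ln n)" for n
    using coeff_gluing_series_nonzero by (auto simp: bihomogeneous_def Ln degree_colors)
  have "mps_polynomial (Ln n)" for n
    unfolding mps_polynomial_def
  proof (rule finite_subset[OF _ finite_degree_le[of "n + n"]], safe)
    fix m assume "coeff (Ln n) m \<noteq> 0"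
    then show "(\<Sum>s\<in>#m. sym_deg s) \<le> n + n"
      using bi[of n] by (simp add: bihomogeneous_def sym_deg_def sum_mset.distrib)
  qed
  moreover have "mps_has_sum Ln {n. n \<ge> 1} gluing_series"
    unfolding mps_has_sum_def
  proof
    show "mps_summable Ln {n. n \<ge> 1}"
      unfolding mps_summable_def
    proof
      fix m
      show "finite {i \<in> {n. n \<ge> 1}. coeff (Ln i) m \<noteq> 0}"
        by (rule finite_subset[of _ "{\<Sum>s\<in>#m. degA_sym s}"]) (auto simp: Ln)
    qed
    show "mps_Sum Ln {n. n \<ge> 1} = gluing_series"
    proof (rule mps_eqI)
      fix m
      let ?d = "\<Sum>s\<in>#m. degA_sym s"
      show "coeff (mps_Sum Ln {n. n \<ge> 1}) m = coeff gluing_series m"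
      proof (cases "?d \<ge> 1")
        case True
        then have "coeff (mps_Sum Ln {n. n \<ge> 1}) m = (\<Sum>n\<in>{?d}. coeff (Ln n) m)"
          by (intro coeff_mps_Sum_finite) (auto simp: Ln)
        then show ?thesis by (simp add: Ln)
      next
        case False
        \<comment> \<open>On the support, A-degree 0 forces B-degree 0; since every symbol has
          positive total degree, only the empty monomial could remain, and its coefficient is
          0.\<close>
        have "coeff gluing_series m = 0"
        proof (rule ccontr)
          assume "coeff gluing_series m \<noteq> 0"
          then have "(\<Sum>s\<in>#m. sym_deg s) = 0"
            using False coeff_gluing_series_nonzero[of m]
            by (simp add: sym_deg_def sum_mset.distrib degree_colors)
          then have "\<not> s \<in># m" for s
            using sym_deg_pos[of s] by auto
          then have "m = {#}" by (auto simp: multiset_eq_iff not_in_iff)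
          with \<open>coeff gluing_series m \<noteq> 0\<close> show False by (simp add: coeff_gluing_series_empty)
        qed
        moreover have "coeff (mps_Sum Ln {n. n \<ge> 1}) m = (\<Sum>n\<in>{}. coeff (Ln n) m)"
          using False by (intro coeff_mps_Sum_finite) (auto simp: Ln)
        ultimately show ?thesis by simp
      qed
    qed
  qed
  ultimately show ?thesis
    unfolding is_L_def using bi Exp_gluing_series by metis
qed

lemma is_L_coeff_empty:
  assumes "is_L L"
  shows "coeff L {#} = 0"
proof -
  obtain Ln where Ln: "\<forall>n\<ge>1. mps_polynomial (Ln n) \<and> bihomogeneous n n (Ln n)"
    and L: "mps_has_sum Ln {n. n \<ge> 1} L"
    using assms by (auto simp: is_L_def)
  have "coeff (Ln n) {#} = 0" if "n \<ge> 1" for n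
    using Ln that by (force simp: bihomogeneous_def)
  then show ?thesis using L by (auto simp: mps_has_sum_def coeff_mps_Sum)
qed

text \<open>The first Adams operation contributes the coefficient at \<open>m\<close> itself, and
  every other one a coefficient at \<open>m\<close> with its indices divided by \<open>k\<close>.
  This triangular system determines the series.\<close>

lemma Exp_log_inj:
  fixes F G :: "gen lring"
  assumes "coeff F {#} = 0" "coeff G {#} = 0" "Exp_log F = Exp_log G"
  shows "F = G"
proof (rule mps_eqI)
  fix m
  show "coeff F m = coeff G m"
  \<comment> \<open>Adams operations keep the size of a monomial, so the induction uses the sum of
    the indices, which shrinks under division by \<open>k > 1\<close>.\<close>
  proof (induction m rule: measure_induct_rule[of "\<lambda>m. \<Sum>s\<in>#m. numeral (fst s) :: nat"])
    case (less m)
    show ?case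
    proof (cases "m = {#}")
      case False
      let ?K = "{k. numeral k dvd mono_gcd m}"
      have "coeff (adams k F) m / numeral k = coeff (adams k G) m / numeral k"
        if k: "k \<in> ?K - {num.One}" for k
      proof -
        from k obtain m' where m': "m = pscale k m'" using pscale_divides by blast
        have eq: "(\<Sum>s\<in>#m. numeral (fst s) :: nat) = numeral k * (\<Sum>s\<in>#m'. numeral (fst s))"
          unfolding m' pscale_def
          by (induction m') (auto simp: numeral_mult distrib_left simp del: numeral_times_numeral)
        have "(numeral k :: nat) > 1" using k by (cases k) auto
        moreover have "(\<Sum>s\<in>#m'. numeral (fst s) :: nat) > 0"
          using False m' by (auto elim!: multiset_nonemptyE dest!: multi_member_split)
        ultimately have "(\<Sum>s\<in>#m'. numeral (fst s) :: nat) < (\<Sum>s\<in>#m. numeral (fst s))"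
          unfolding eq by simp
        from less[OF this] show ?thesis by (simp add: m' coeff_adams_pscale)
      qed
      then have "(\<Sum>k\<in>?K - {num.One}. coeff (adams k F) m / numeral k) =
          (\<Sum>k\<in>?K - {num.One}. coeff (adams k G) m / numeral k)"
        by (rule sum.cong[OF refl])
      moreover have "(\<Sum>k\<in>?K. coeff (adams k F) m / numeral k) = (\<Sum>k\<in>?K. coeff (adams k G) m / numeral k)"
        unfolding coeff_Exp_log[OF False, symmetric] assms(3) ..
      moreover have "(\<Sum>k\<in>?K. g k) = g num.One + (\<Sum>k\<in>?K - {num.One}. g k)" for g :: "num \<Rightarrow> rat"
        by (rule sum.remove[OF finite_num_dvd[OF mono_gcd_pos[OF False]]]) simp
      ultimately have "coeff (adams num.One F) m / numeral num.One = coeff (adams num.One G) m / numeral num.One"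
        by (metis (no_types, lifting) add_right_cancel)
      then show ?thesis by (simp add: adams_One)
    qed (simp add: assms)
  qed
qed

lemma is_L_unique:
  assumes "is_L L"
  shows "L = gluing_series"
proof (rule Exp_log_inj)
  show "coeff L {#} = 0" "coeff gluing_series {#} = 0"
    using assms is_L_gluing_series by (auto intro: is_L_coeff_empty)
  moreover have "mps_exp (Exp_log L) = mps_exp (Exp_log gluing_series)"
    unfolding Exp_eq[symmetric] using assms is_L_gluing_series by (simp add: is_L_def)
  ultimately show "Exp_log L = Exp_log gluing_series"
    by (rule mps_exp_inj[OF coeff_Exp_log_empty coeff_Exp_log_empty])
qed

section \<open>From gluings to isomorphism classes of graphs\<close>

section \<open>Isomorphisms of graphs\<close>

lemma graph_isoD:
  assumes "graph_iso \<Gamma> \<Delta> \<sigma> \<tau>"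
  shows "bij_betw \<sigma> (verts \<Gamma>) (verts \<Delta>)" "bij_betw \<tau> (edges \<Gamma>) (edges \<Delta>)"
    "\<sigma> ` verts1 \<Gamma> = verts1 \<Delta>" "\<sigma> ` verts2 \<Gamma> = verts2 \<Delta>"
    "\<And>e. e \<in> edges \<Gamma> \<Longrightarrow> end1 \<Delta> (\<tau> e) = \<sigma> (end1 \<Gamma> e)"
    "\<And>e. e \<in> edges \<Gamma> \<Longrightarrow> end2 \<Delta> (\<tau> e) = \<sigma> (end2 \<Gamma> e)"
    "\<And>v. v \<in> verts \<Gamma> \<Longrightarrow> vcol \<Delta> (\<sigma> v) = vcol \<Gamma> v"
    "\<And>e. e \<in> edges \<Gamma> \<Longrightarrow> ecol \<Delta> (\<tau> e) = ecol \<Gamma> e"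
    "\<And>v. v \<in> verts \<Gamma> \<Longrightarrow> \<sigma> v \<in> verts \<Delta>" "\<And>e. e \<in> edges \<Gamma> \<Longrightarrow> \<tau> e \<in> edges \<Delta>"
  using assms unfolding graph_iso_def by (auto dest: bij_betwE)

lemma colored_bipartiteD:
  assumes "colored_bipartite \<Gamma>"
  shows "finite (verts \<Gamma>)" "finite (edges \<Gamma>)" "verts1 \<Gamma> \<inter> verts2 \<Gamma> = {}"
    "\<And>e. e \<in> edges \<Gamma> \<Longrightarrow> end1 \<Gamma> e \<in> verts1 \<Gamma>" "\<And>e. e \<in> edges \<Gamma> \<Longrightarrow> end2 \<Gamma> e \<in> verts2 \<Gamma>"
    "\<And>e. e \<in> edges \<Gamma> \<Longrightarrow> end1 \<Gamma> e \<in> verts \<Gamma>" "\<And>e. e \<in> edges \<Gamma> \<Longrightarrow> end2 \<Gamma> e \<in> verts \<Gamma>"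
    "\<And>v. v \<in> verts \<Gamma> \<Longrightarrow> vcol \<Gamma> v > 0" "\<And>e. e \<in> edges \<Gamma> \<Longrightarrow> ecol \<Gamma> e > 0"
  using assms unfolding colored_bipartite_def by (auto simp: verts_def)

lemma graph_iso_comp:
  assumes "graph_iso \<Gamma> \<Delta> \<sigma> \<tau>" "graph_iso \<Delta> \<Theta> \<sigma>' \<tau>'"
  shows "graph_iso \<Gamma> \<Theta> (\<lambda>v. \<sigma>' (\<sigma> v)) (\<lambda>e. \<tau>' (\<tau> e))"
  unfolding graph_iso_def
proof (intro conjI ballI)
  note 1 = graph_isoD[OF assms(1)] and 2 = graph_isoD[OF assms(2)]
  show "bij_betw (\<lambda>v. \<sigma>' (\<sigma> v)) (verts \<Gamma>) (verts \<Theta>)"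
    using bij_betw_trans[OF 1(1) 2(1)] by (simp add: comp_def)
  show "bij_betw (\<lambda>e. \<tau>' (\<tau> e)) (edges \<Gamma>) (edges \<Theta>)"
    using bij_betw_trans[OF 1(2) 2(2)] by (simp add: comp_def)
  show "(\<lambda>v. \<sigma>' (\<sigma> v)) ` verts1 \<Gamma> = verts1 \<Theta>" "(\<lambda>v. \<sigma>' (\<sigma> v)) ` verts2 \<Gamma> = verts2 \<Theta>"
    using 1(3,4) 2(3,4) by (metis image_image)+
qed (simp_all add: graph_isoD[OF assms(1)] graph_isoD[OF assms(2)])

lemma graph_iso_cong:
  assumes "colored_bipartite \<Gamma>" "\<And>v. v \<in> verts \<Gamma> \<Longrightarrow> \<sigma> v = \<sigma>' v" "\<And>e. e \<in> edges \<Gamma> \<Longrightarrow> \<tau> e = \<tau>' e"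
    and iso: "graph_iso \<Gamma> \<Delta> \<sigma> \<tau>"
  shows "graph_iso \<Gamma> \<Delta> \<sigma>' \<tau>'"
  unfolding graph_iso_def
proof (intro conjI ballI)
  note 1 = graph_isoD[OF iso] and c = colored_bipartiteD[OF assms(1)]
  show "bij_betw \<sigma>' (verts \<Gamma>) (verts \<Delta>)"
    using 1(1) bij_betw_cong[of "verts \<Gamma>" \<sigma> \<sigma>'] assms(2) by blast
  show "bij_betw \<tau>' (edges \<Gamma>) (edges \<Delta>)"
    using 1(2) bij_betw_cong[of "edges \<Gamma>" \<tau> \<tau>'] assms(3) by blast
  show "\<sigma>' ` verts1 \<Gamma> = verts1 \<Delta>" "\<sigma>' ` verts2 \<Gamma> = verts2 \<Delta>"
    unfolding 1(3,4)[symmetric] by (auto simp: assms(2) verts_def intro!: image_cong[THEN equalityD1, THEN subsetD])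
  fix e assume e: "e \<in> edges \<Gamma>"
  show "end1 \<Delta> (\<tau>' e) = \<sigma>' (end1 \<Gamma> e)" "end2 \<Delta> (\<tau>' e) = \<sigma>' (end2 \<Gamma> e)" "ecol \<Delta> (\<tau>' e) = ecol \<Gamma> e"
    using 1(5,6,8)[OF e] c(6,7)[OF e] assms(2,3) e by metis+
next
  fix v assume "v \<in> verts \<Gamma>"
  then show "vcol \<Delta> (\<sigma>' v) = vcol \<Gamma> v"
    using graph_isoD(7)[OF iso] assms(2) by metis
qed

lemma graph_iso_inv:
  assumes c: "colored_bipartite \<Gamma>" and iso: "graph_iso \<Gamma> \<Delta> \<sigma> \<tau>"
  shows "graph_iso \<Delta> \<Gamma> (inv_into (verts \<Gamma>) \<sigma>) (inv_into (edges \<Gamma>) \<tau>)"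
  unfolding graph_iso_def
proof (intro conjI ballI)
  note 1 = graph_isoD[OF iso] and c = colored_bipartiteD[OF c]
  have inj: "inj_on \<sigma> (verts \<Gamma>)" "inj_on \<tau> (edges \<Gamma>)" using 1 by (auto simp: bij_betw_def)
  show "bij_betw (inv_into (verts \<Gamma>) \<sigma>) (verts \<Delta>) (verts \<Gamma>)"
    "bij_betw (inv_into (edges \<Gamma>) \<tau>) (edges \<Delta>) (edges \<Gamma>)"
    using 1(1,2) by (auto intro: bij_betw_inv_into)
  show "inv_into (verts \<Gamma>) \<sigma> ` verts1 \<Delta> = verts1 \<Gamma>" "inv_into (verts \<Gamma>) \<sigma> ` verts2 \<Delta> = verts2 \<Gamma>"
    unfolding 1(3,4)[symmetric] by (rule inv_into_image_cancel[OF inj(1)]; simp add: verts_def)+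
  fix e' assume "e' \<in> edges \<Delta>"
  then obtain e where e: "e \<in> edges \<Gamma>" "e' = \<tau> e" using 1(2) by (auto simp: bij_betw_def)
  then show "end1 \<Gamma> (inv_into (edges \<Gamma>) \<tau> e') = inv_into (verts \<Gamma>) \<sigma> (end1 \<Delta> e')"
    "end2 \<Gamma> (inv_into (edges \<Gamma>) \<tau> e') = inv_into (verts \<Gamma>) \<sigma> (end2 \<Delta> e')"
    "ecol \<Gamma> (inv_into (edges \<Gamma>) \<tau> e') = ecol \<Delta> e'"
    using inj c(6,7)[OF e(1)] 1(5,6,8)[OF e(1)] by simp_all
next
  note 1 = graph_isoD[OF iso]
  fix v' assume "v' \<in> verts \<Delta>"
  then obtain v where v: "v \<in> verts \<Gamma>" "v' = \<sigma> v" using 1(1) by (auto simp: bij_betw_def)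
  then show "vcol \<Gamma> (inv_into (verts \<Gamma>) \<sigma> v') = vcol \<Delta> v'"
    using 1(1) 1(7)[OF v(1)] by (simp add: bij_betw_def)
qed

definition cut_closed :: "('v, 'e) cbgraph \<Rightarrow> 'v set \<Rightarrow> bool" where
  "cut_closed \<Gamma> T \<longleftrightarrow> (\<forall>e\<in>edges \<Gamma>. end1 \<Gamma> e \<in> T \<longleftrightarrow> end2 \<Gamma> e \<in> T)"

text \<open>The set reachable from a vertex is cut-closed, and a cut-closed set contains everything
  reachable from its members. This brings graph connectedness into the form used for
  gluings.\<close>

lemma connected_graph_iff_cut:
  assumes "colored_bipartite \<Gamma>"
  shows "connected_graph \<Gamma> \<longleftrightarrow>
    verts \<Gamma> \<noteq> {} \<and> (\<forall>T\<subseteq>verts \<Gamma>. cut_closed \<Gamma> T \<longrightarrow> T = {} \<or> T = verts \<Gamma>)"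
proof
  assume conn: "connected_graph \<Gamma>"
  have "T = verts \<Gamma>" if T: "T \<subseteq> verts \<Gamma>" "cut_closed \<Gamma> T" "u \<in> T" for T u
  proof -
    have "v \<in> T" if "(u, v) \<in> (adjacency \<Gamma>)\<^sup>*" for v
      using that
    proof (induction rule: rtrancl_induct)
      case (step y z)
      from step.hyps(2) obtain e where "e \<in> edges \<Gamma>"
        "end1 \<Gamma> e = y \<and> end2 \<Gamma> e = z \<or> end1 \<Gamma> e = z \<and> end2 \<Gamma> e = y"
        unfolding adjacency_def by blast
      with T(2) step.IH show ?case unfolding cut_closed_def by blast
    qed (rule T(3))
    then show ?thesis using conn T(1,3) unfolding connected_graph_def by blast
  qed
  then show "verts \<Gamma> \<noteq> {} \<and> (\<forall>T\<subseteq>verts \<Gamma>. cut_closed \<Gamma> T \<longrightarrow> T = {} \<or> T = verts \<Gamma>)"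
    using conn unfolding connected_graph_def by blast
next
  assume cut: "verts \<Gamma> \<noteq> {} \<and> (\<forall>T\<subseteq>verts \<Gamma>. cut_closed \<Gamma> T \<longrightarrow> T = {} \<or> T = verts \<Gamma>)"
  have "(u, v) \<in> (adjacency \<Gamma>)\<^sup>*" if "u \<in> verts \<Gamma>" "v \<in> verts \<Gamma>" for u v
  proof -
    let ?T = "{v \<in> verts \<Gamma>. (u, v) \<in> (adjacency \<Gamma>)\<^sup>*}"
    have "cut_closed \<Gamma> ?T"
      unfolding cut_closed_def
    proof
      fix e assume e: "e \<in> edges \<Gamma>"
      then have "(end1 \<Gamma> e, end2 \<Gamma> e) \<in> adjacency \<Gamma>" "(end2 \<Gamma> e, end1 \<Gamma> e) \<in> adjacency \<Gamma>"
        unfolding adjacency_def by blast+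
      then have "(u, end1 \<Gamma> e) \<in> (adjacency \<Gamma>)\<^sup>* \<longleftrightarrow> (u, end2 \<Gamma> e) \<in> (adjacency \<Gamma>)\<^sup>*"
        by (meson rtrancl.rtrancl_into_rtrancl)
      then show "end1 \<Gamma> e \<in> ?T \<longleftrightarrow> end2 \<Gamma> e \<in> ?T"
        using colored_bipartiteD(6,7)[OF assms e] by blast
    qed
    moreover have "?T \<subseteq> verts \<Gamma>" "u \<in> ?T" using that(1) by simp_all
    ultimately have "?T = verts \<Gamma>" using cut by (metis (no_types, lifting) empty_iff)
    with that(2) show ?thesis by blast
  qed
  with cut show "connected_graph \<Gamma>" unfolding connected_graph_def by blast
qed

lemma incident_edges_iso:
  assumes "colored_bipartite \<Gamma>" "graph_iso \<Gamma> \<Delta> \<sigma> \<tau>" "v \<in> verts \<Gamma>"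
  shows "incident_edges \<Delta> (\<sigma> v) = \<tau> ` incident_edges \<Gamma> v"
proof -
  note 1 = graph_isoD[OF assms(2)] and c = colored_bipartiteD[OF assms(1)]
  have inj: "\<sigma> u = \<sigma> v \<longleftrightarrow> u = v" if "u \<in> verts \<Gamma>" for u
    using 1(1) that assms(3) by (auto simp: bij_betw_def inj_on_def)
  have "edges \<Delta> = \<tau> ` edges \<Gamma>" using 1(2) by (simp add: bij_betw_def)
  then show ?thesis
    unfolding incident_edges_def by (auto simp: 1(5,6) inj c(6,7))
qed

lemma vpartition_iso:
  assumes "colored_bipartite \<Gamma>" "graph_iso \<Gamma> \<Delta> \<sigma> \<tau>" "v \<in> verts \<Gamma>"
  shows "vpartition \<Delta> (\<sigma> v) = vpartition \<Gamma> v"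
proof -
  note 1 = graph_isoD[OF assms(2)]
  have sub: "incident_edges \<Gamma> v \<subseteq> edges \<Gamma>" by (auto simp: incident_edges_def)
  have "inj_on \<tau> (incident_edges \<Gamma> v)"
    using 1(2) sub by (auto simp: bij_betw_def intro: inj_on_subset)
  then have img: "mset_set (\<tau> ` incident_edges \<Gamma> v) = image_mset \<tau> (mset_set (incident_edges \<Gamma> v))"
    by (rule image_mset_mset_set[symmetric])
  have "finite (incident_edges \<Gamma> v)"
    using sub colored_bipartiteD(2)[OF assms(1)] by (rule finite_subset)
  then have "ecol \<Delta> (\<tau> e) = ecol \<Gamma> e" if "e \<in># mset_set (incident_edges \<Gamma> v)" for e
    using 1(8) sub that by (simp add: subset_iff)
  then show ?thesis
    unfolding vpartition_def incident_edges_iso[OF assms] 1(7)[OF assms(3)] img multiset.map_comp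
    by (intro image_mset_cong) simp
qed

text \<open>The condition of \<open>conn_graphs\<close> at arbitrary types, because the graph of a
  gluing has half-edges as its edges.\<close>

definition conn_graph :: "('v, 'e) cbgraph \<Rightarrow> bool" where
  "conn_graph \<Gamma> \<longleftrightarrow> colored_bipartite \<Gamma> \<and> connected_graph \<Gamma> \<and> admissible_star \<Gamma>"

lemma colored_bipartite_iso:
  assumes "colored_bipartite \<Gamma>" "graph_iso \<Gamma> \<Delta> \<sigma> \<tau>"
  shows "colored_bipartite \<Delta>"
proof -
  note 1 = graph_isoD[OF assms(2)] and c = colored_bipartiteD[OF assms(1)]
  have V: "verts \<Delta> = \<sigma> ` verts \<Gamma>" and E: "edges \<Delta> = \<tau> ` edges \<Gamma>" and inj: "inj_on \<sigma> (verts \<Gamma>)"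
    using 1(1,2) by (simp_all add: bij_betw_def)
  have "verts1 \<Delta> \<inter> verts2 \<Delta> = {}"
    unfolding 1(3,4)[symmetric] using inj c(3)
    by (subst inj_on_image_Int[symmetric, of _ "verts \<Gamma>"]) (auto simp: verts_def)
  then show ?thesis
    unfolding colored_bipartite_def V E using c 1(3,4,5,6,7,8) by auto
qed

lemma conn_graph_iso:
  assumes "conn_graph \<Gamma>" "graph_iso \<Gamma> \<Delta> \<sigma> \<tau>"
  shows "conn_graph \<Delta>"
proof -
  have cb: "colored_bipartite \<Gamma>" using assms(1) by (simp add: conn_graph_def)
  note 1 = graph_isoD[OF assms(2)] and c = colored_bipartiteD[OF cb]
  have V: "verts \<Delta> = \<sigma> ` verts \<Gamma>" and E: "edges \<Delta> = \<tau> ` edges \<Gamma>" and inj: "inj_on \<sigma> (verts \<Gamma>)"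
    using 1(1,2) by (simp_all add: bij_betw_def)
  have cb': "colored_bipartite \<Delta>" by (rule colored_bipartite_iso[OF cb assms(2)])
  have "admissible_star \<Delta>"
    unfolding admissible_star_def admissible_def V
  proof (intro conjI ballI)
    fix v' e' assume "v' \<in> \<sigma> ` verts \<Gamma>" "e' \<in> incident_edges \<Delta> v'"
    then obtain v e where v: "v \<in> verts \<Gamma>" "v' = \<sigma> v" and e: "e \<in> incident_edges \<Gamma> v" "e' = \<tau> e"
      using incident_edges_iso[OF cb assms(2)] by blast
    then have "vcol \<Gamma> v dvd ecol \<Gamma> e"
      using assms(1) unfolding conn_graph_def admissible_star_def admissible_def by blast
    moreover have "e \<in> edges \<Gamma>" using e(1) by (simp add: incident_edges_def)
    ultimately show "vcol \<Delta> v' dvd ecol \<Delta> e'" by (simp add: v(2) e(2) 1(7)[OF v(1)] 1(8))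
  next
    fix v' assume "v' \<in> \<sigma> ` verts \<Gamma>"
    then obtain v where v: "v \<in> verts \<Gamma>" "v' = \<sigma> v" by blast
    then show "incident_edges \<Delta> v' \<noteq> {}"
      using assms(1) incident_edges_iso[OF cb assms(2) v(1)] by (simp add: conn_graph_def admissible_star_def)
  qed
  moreover have "connected_graph \<Delta>"
    unfolding connected_graph_iff_cut[OF cb']
  proof (intro conjI allI impI)
    show "verts \<Delta> \<noteq> {}" using assms(1) by (simp add: conn_graph_def connected_graph_def V)
    fix T assume T: "T \<subseteq> verts \<Delta>" "cut_closed \<Delta> T"
    let ?S = "{v \<in> verts \<Gamma>. \<sigma> v \<in> T}"
    have TS: "T = \<sigma> ` ?S" using T V by auto
    have closed: "cut_closed \<Gamma> ?S"
      unfolding cut_closed_def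
    proof
      fix e assume e: "e \<in> edges \<Gamma>"
      have "\<sigma> (end1 \<Gamma> e) \<in> T \<longleftrightarrow> \<sigma> (end2 \<Gamma> e) \<in> T"
        using T(2) 1(10)[OF e] unfolding cut_closed_def 1(5)[OF e, symmetric] 1(6)[OF e, symmetric] by blast
      then show "end1 \<Gamma> e \<in> ?S \<longleftrightarrow> end2 \<Gamma> e \<in> ?S" using c(6,7)[OF e] by simp
    qed
    have cut: "\<forall>T\<subseteq>verts \<Gamma>. cut_closed \<Gamma> T \<longrightarrow> T = {} \<or> T = verts \<Gamma>"
      using assms(1) connected_graph_iff_cut[OF cb] by (simp add: conn_graph_def)
    have "?S = {} \<or> ?S = verts \<Gamma>" by (rule cut[rule_format, OF _ closed]) simp
    then show "T = {} \<or> T = verts \<Delta>" using TS V by auto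
  qed
  ultimately show ?thesis using cb' by (simp add: conn_graph_def)
qed

text \<open>Extensional representatives, so that an isomorphism is counted by its values on the
  graph alone.\<close>

definition graph_isos ::
  "('v, 'e) cbgraph \<Rightarrow> ('w, 'f) cbgraph \<Rightarrow> (('v \<Rightarrow> 'w) \<times> ('e \<Rightarrow> 'f)) set" where
  "graph_isos \<Gamma> \<Delta> = {(\<sigma>, \<tau>). \<sigma> \<in> extensional (verts \<Gamma>) \<and> \<tau> \<in> extensional (edges \<Gamma>) \<and> graph_iso \<Gamma> \<Delta> \<sigma> \<tau>}"

text \<open>Isomorphisms form a torsor under the automorphism group: automorphisms are composed with
  the given isomorphism. The case distinctions convert between maps that are the identity outside
  the graph and maps that are \<open>undefined\<close> there.\<close>

lemma card_graph_isos:
  assumes c: "colored_bipartite \<Gamma>" and iso: "graph_iso \<Gamma> \<Delta> \<sigma> \<tau>"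
  shows "card (graph_isos \<Gamma> \<Delta>) = card (graph_aut \<Gamma>)"
proof -
  let ?V = "verts \<Gamma>" and ?E = "edges \<Gamma>"
  note 1 = graph_isoD[OF iso]
  have V: "verts \<Delta> = \<sigma> ` ?V" and E: "edges \<Delta> = \<tau> ` ?E" and inj: "inj_on \<sigma> ?V" "inj_on \<tau> ?E"
    using 1(1,2) by (simp_all add: bij_betw_def)
  let ?f = "\<lambda>(a, b). (restrict (\<lambda>v. \<sigma> (a v)) ?V, restrict (\<lambda>e. \<tau> (b e)) ?E)"
  let ?g = "\<lambda>(a, b). (\<lambda>v. if v \<in> ?V then inv_into ?V \<sigma> (a v) else v,
      \<lambda>e. if e \<in> ?E then inv_into ?E \<tau> (b e) else e)"
  have "bij_betw ?f (graph_aut \<Gamma>) (graph_isos \<Gamma> \<Delta>)"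
  proof (rule bij_betw_byWitness[where f' = ?g])
    show "\<forall>p\<in>graph_aut \<Gamma>. ?g (?f p) = p"
    proof
      fix p assume "p \<in> graph_aut \<Gamma>"
      then obtain a b where p: "p = (a, b)" "a permutes ?V" "b permutes ?E"
        by (auto simp: graph_aut_def)
      then show "?g (?f p) = p"
        using inj by (auto simp: fun_eq_iff permutes_in_image permutes_not_in)
    qed
    show "\<forall>p\<in>graph_isos \<Gamma> \<Delta>. ?f (?g p) = p"
    proof
      fix p assume "p \<in> graph_isos \<Gamma> \<Delta>"
      then obtain a b where p: "p = (a, b)" "a \<in> extensional ?V" "b \<in> extensional ?E" "graph_iso \<Gamma> \<Delta> a b"
        by (auto simp: graph_isos_def)
      have "a v \<in> \<sigma> ` ?V" if "v \<in> ?V" for v using graph_isoD(9)[OF p(4) that] V by simp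
      moreover have "b e \<in> \<tau> ` ?E" if "e \<in> ?E" for e using graph_isoD(10)[OF p(4) that] E by simp
      ultimately show "?f (?g p) = p"
        using p(2,3) by (auto simp: p(1) fun_eq_iff restrict_def f_inv_into_f extensional_def)
    qed
    show "?f ` graph_aut \<Gamma> \<subseteq> graph_isos \<Gamma> \<Delta>"
    proof (rule image_subsetI)
      fix p assume "p \<in> graph_aut \<Gamma>"
      then obtain a b where p: "p = (a, b)" "graph_iso \<Gamma> \<Gamma> a b"
        by (auto simp: graph_aut_def)
      have "graph_iso \<Gamma> \<Delta> (restrict (\<lambda>v. \<sigma> (a v)) ?V) (restrict (\<lambda>e. \<tau> (b e)) ?E)"
        by (rule graph_iso_cong[OF c _ _ graph_iso_comp[OF p(2) iso]]) auto
      then show "?f p \<in> graph_isos \<Gamma> \<Delta>" by (simp add: p(1) graph_isos_def)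
    qed
    show "?g ` graph_isos \<Gamma> \<Delta> \<subseteq> graph_aut \<Gamma>"
    proof (rule image_subsetI)
      fix p assume "p \<in> graph_isos \<Gamma> \<Delta>"
      then obtain a b where p: "p = (a, b)" "graph_iso \<Gamma> \<Delta> a b"
        by (auto simp: graph_isos_def)
      have "graph_iso \<Gamma> \<Gamma> (\<lambda>v. if v \<in> ?V then inv_into ?V \<sigma> (a v) else v)
          (\<lambda>e. if e \<in> ?E then inv_into ?E \<tau> (b e) else e)"
        by (rule graph_iso_cong[OF c _ _ graph_iso_comp[OF p(2) graph_iso_inv[OF c iso]]]) auto
      moreover from graph_isoD(1,2)[OF this]
      have "(\<lambda>v. if v \<in> ?V then inv_into ?V \<sigma> (a v) else v) permutes ?V"
        "(\<lambda>e. if e \<in> ?E then inv_into ?E \<tau> (b e) else e) permutes ?E"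
        by (auto intro!: bij_imp_permutes)
      ultimately show "?g p \<in> graph_aut \<Gamma>" by (simp add: p(1) graph_aut_def)
    qed
  qed
  then show ?thesis by (simp add: bij_betw_same_card)
qed

lemma finite_graph_isos:
  assumes "finite (verts \<Gamma>)" "finite (edges \<Gamma>)" "finite (verts \<Delta>)" "finite (edges \<Delta>)"
  shows "finite (graph_isos \<Gamma> \<Delta>)"
proof (rule finite_subset)
  show "graph_isos \<Gamma> \<Delta> \<subseteq> (verts \<Gamma> \<rightarrow>\<^sub>E verts \<Delta>) \<times> (edges \<Gamma> \<rightarrow>\<^sub>E edges \<Delta>)"
    by (auto simp: graph_isos_def PiE_def dest: graph_isoD(9,10))
qed (use assms in \<open>auto intro: finite_PiE\<close>)

lemma conn_graphs_eq: "conn_graphs = {\<Gamma>. conn_graph \<Gamma>}"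
  by (simp add: conn_graphs_def conn_graph_def)

lemma graph_iso_refl: "graph_iso \<Gamma> \<Gamma> (\<lambda>v. v) (\<lambda>e. e)"
  by (simp add: graph_iso_def bij_betw_def)

lemma equiv_iso_rel: "equiv conn_graphs iso_rel"
proof (rule equivI)
  show "iso_rel \<subseteq> conn_graphs \<times> conn_graphs" by (auto simp: iso_rel_def)
  show "refl_on conn_graphs iso_rel"
    by (auto simp: refl_on_def iso_rel_def intro: graph_iso_refl)
  show "sym iso_rel"
    by (rule symI) (auto simp: iso_rel_def conn_graphs_eq conn_graph_def intro: graph_iso_inv)
  show "trans iso_rel"
    by (rule transI) (auto simp: iso_rel_def intro: graph_iso_comp)
qed

section \<open>Graphs and gluings\<close>

definition edge_num :: "('v, 'e) cbgraph \<Rightarrow> 'e \<Rightarrow> num" where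
  "edge_num \<Gamma> e = num_of_nat (ecol \<Gamma> e)"

definition graph_sym :: "('v, 'e) cbgraph \<Rightarrow> 'v \<Rightarrow> num \<times> gen" where
  "graph_sym \<Gamma> v = (num_of_nat (vcol \<Gamma> v),
     (if v \<in> verts1 \<Gamma> then GenA else GenB) (nepartition (vpartition \<Gamma> v)))"

definition graph_mono :: "('v, 'e) cbgraph \<Rightarrow> (num \<times> gen) multiset" where
  "graph_mono \<Gamma> = image_mset (graph_sym \<Gamma>) (mset_set (verts \<Gamma>))"

text \<open>What an edge must share with a half-edge that represents one of its ends: the vertex
  there and the color.\<close>

definition half_label :: "('v \<Rightarrow> num \<times> gen) \<Rightarrow> 'v half_edge \<Rightarrow> 'v \<times> num" where
  "half_label t h = (fst h, half_color t h)"

text \<open>By \<open>card_partition_aut\<close>, the product of the orders of the groups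
  Aut(lambda) over the vertices.\<close>

definition aut_prod :: "(num \<times> gen) multiset \<Rightarrow> nat" where
  "aut_prod m = (\<Prod>s\<in>#m. mfact (gen_parts (snd s)))"

lemma numeral_num_of_nat: "n > 0 \<Longrightarrow> numeral (num_of_nat n) = (n :: nat)"
  by (metis nat_of_num_numeral num_of_nat_inverse)

lemma num_of_nat_numeral [simp]: "num_of_nat (numeral k) = k"
  by (metis nat_of_num_inverse nat_of_num_numeral)

lemma sideA_graph_sym [simp]: "sideA (graph_sym \<Gamma> v) \<longleftrightarrow> v \<in> verts1 \<Gamma>"
  by (auto simp: graph_sym_def)

lemma graph_sym_iso:
  assumes "colored_bipartite \<Gamma>" "graph_iso \<Gamma> \<Delta> \<sigma> \<tau>" "v \<in> verts \<Gamma>"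
  shows "graph_sym \<Delta> (\<sigma> v) = graph_sym \<Gamma> v"
proof -
  note 1 = graph_isoD[OF assms(2)]
  have "\<sigma> v \<in> \<sigma> ` verts1 \<Gamma> \<longleftrightarrow> v \<in> verts1 \<Gamma>"
    using 1(1) assms(3) by (intro inj_on_image_mem_iff[of \<sigma> "verts \<Gamma>"]) (auto simp: bij_betw_def verts_def)
  then show ?thesis
    unfolding graph_sym_def vpartition_iso[OF assms] 1(7)[OF assms(3)] 1(3)[symmetric] by simp
qed

lemma conn_graph_vpartition:
  assumes "conn_graph \<Gamma>" "v \<in> verts \<Gamma>"
  shows "vpartition \<Gamma> v \<noteq> {#}" "gen_parts (snd (graph_sym \<Gamma> v)) = vpartition \<Gamma> v"
proof -
  have "finite (incident_edges \<Gamma> v)"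
    using assms unfolding conn_graph_def incident_edges_def by (auto dest: colored_bipartiteD(2))
  then show "vpartition \<Gamma> v \<noteq> {#}"
    using assms by (auto simp: conn_graph_def admissible_star_def vpartition_def mset_set_empty_iff)
  then show "gen_parts (snd (graph_sym \<Gamma> v)) = vpartition \<Gamma> v"
    by (simp add: graph_sym_def nepartition_inverse)
qed

text \<open>By admissibility, the vertex color times the quotient m(e) / m(v) gives back
  m(e).\<close>

lemma sym_colors_graph_sym:
  assumes "conn_graph \<Gamma>" "v \<in> verts \<Gamma>"
  shows "sym_colors (graph_sym \<Gamma> v) = image_mset (edge_num \<Gamma>) (mset_set (incident_edges \<Gamma> v))"
proof -
  have cb: "colored_bipartite \<Gamma>" using assms(1) by (simp add: conn_graph_def)
  have fin: "finite (incident_edges \<Gamma> v)"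
    using colored_bipartiteD(2)[OF cb] unfolding incident_edges_def by auto
  have "num_of_nat (vcol \<Gamma> v) * num_of_nat (ecol \<Gamma> e div vcol \<Gamma> v) = edge_num \<Gamma> e"
    if e: "e \<in> incident_edges \<Gamma> v" for e
  proof -
    have "vcol \<Gamma> v dvd ecol \<Gamma> e"
      using assms e unfolding conn_graph_def admissible_star_def admissible_def by blast
    then obtain q where q: "ecol \<Gamma> e = vcol \<Gamma> v * q" by (auto simp: dvd_def)
    have "vcol \<Gamma> v > 0" "ecol \<Gamma> e > 0"
      using colored_bipartiteD(8)[OF cb assms(2)] colored_bipartiteD(9)[OF cb] e
      by (auto simp: incident_edges_def)
    moreover from this q have "q > 0" by (intro gr0I) simp
    ultimately show ?thesis
      by (simp add: q edge_num_def num_eq_iff nat_of_num_mult num_of_nat_inverse)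
  qed
  then show ?thesis
    unfolding sym_colors_def conn_graph_vpartition(2)[OF assms] vpartition_def multiset.map_comp
    using fin by (intro image_mset_cong) (simp add: graph_sym_def)
qed

lemma image_mset_pair_eqI:
  fixes p :: "'x \<Rightarrow> 'u" and c :: "'x \<Rightarrow> 'k"
  assumes "finite X" "finite Y"
    and "\<And>u. image_mset c (mset_set {x \<in> X. p x = u}) = image_mset d (mset_set {y \<in> Y. q y = u})"
  shows "image_mset (\<lambda>x. (p x, c x)) (mset_set X) = image_mset (\<lambda>y. (q y, d y)) (mset_set Y)"
proof (rule multiset_eqI)
  fix z :: "'u \<times> 'k"
  obtain u a where z: "z = (u, a)" by (cases z)
  have "count (image_mset c (mset_set {x \<in> X. p x = u})) a =
      count (image_mset d (mset_set {y \<in> Y. q y = u})) a"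
    using assms(3) by simp
  then show "count (image_mset (\<lambda>x. (p x, c x)) (mset_set X)) z =
      count (image_mset (\<lambda>y. (q y, d y)) (mset_set Y)) z"
    using assms(1,2) by (simp add: z count_image_mset_set conj_assoc)
qed

text \<open>Equal pairs lie over the same \<open>u\<close>, so the multiplicities factor over the
  fibers of \<open>p\<close>.\<close>

lemma mfact_image_pair:
  fixes p :: "'x \<Rightarrow> 'u" and c :: "'x \<Rightarrow> 'k"
  assumes "finite X" "finite U"
  shows "mfact (image_mset (\<lambda>x. (p x, c x)) (mset_set {x \<in> X. p x \<in> U})) =
    (\<Prod>u\<in>U. mfact (image_mset c (mset_set {x \<in> X. p x = u})))"
  using assms(2)
proof (induction U rule: finite_induct)
  case (insert u U)
  let ?F = "\<lambda>Z. image_mset (\<lambda>x. (p x, c x)) (mset_set Z)"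
  have "{x \<in> X. p x \<in> insert u U} = {x \<in> X. p x = u} \<union> {x \<in> X. p x \<in> U}" by auto
  moreover have "{x \<in> X. p x = u} \<inter> {x \<in> X. p x \<in> U} = {}" using insert.hyps by auto
  ultimately have "?F {x \<in> X. p x \<in> insert u U} = ?F {x \<in> X. p x = u} + ?F {x \<in> X. p x \<in> U}"
    using assms(1) by (simp add: mset_set_Union)
  moreover have "mfact (?F {x \<in> X. p x = u} + ?F {x \<in> X. p x \<in> U}) =
      mfact (?F {x \<in> X. p x = u}) * mfact (?F {x \<in> X. p x \<in> U})"
    by (rule mfact_union_disjoint) (use insert.hyps assms(1) in auto)
  moreover have "?F {x \<in> X. p x = u} = image_mset (Pair u) (image_mset c (mset_set {x \<in> X. p x = u}))"
    unfolding multiset.map_comp using assms(1) by (intro image_mset_cong) auto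
  moreover have "mfact (image_mset (Pair u) M) = mfact M" for M :: "'k multiset"
    by (rule mfact_image_inj) (simp add: inj_def)
  ultimately show ?case using insert by simp
qed simp

lemma half_edges_at: "{h \<in> half_edges P t V. fst h = u} = (if u \<in> V then half_edges P t {u} else {})"
  by (auto simp: half_edges_def)

lemma half_colors_at:
  "image_mset (half_color t) (mset_set (half_edges P t {u})) = (if P (t u) then sym_colors (t u) else {#})"
  by (simp add: half_colors)

lemma mfact_half_label:
  assumes "finite V"
  shows "mfact (image_mset (half_label t) (mset_set (half_edges P t V))) =
    (\<Prod>u\<in>V. if P (t u) then mfact (gen_parts (snd (t u))) else 1)"
proof -
  have "{h \<in> half_edges P t V. fst h \<in> V} = half_edges P t V" by (auto simp: half_edges_def)
  then have "mfact (image_mset (half_label t) (mset_set (half_edges P t V))) =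
      (\<Prod>u\<in>V. mfact (image_mset (half_color t) (mset_set {h \<in> half_edges P t V. fst h = u})))"
    using mfact_image_pair[OF finite_half_edges[OF assms] assms, of fst "half_color t" P t]
    by (simp add: half_label_def[abs_def])
  also have "\<dots> = (\<Prod>u\<in>V. if P (t u) then mfact (gen_parts (snd (t u))) else 1)"
  proof (rule prod.cong[OF refl])
    fix u assume "u \<in> V"
    moreover have "mfact (sym_colors (t u)) = mfact (gen_parts (snd (t u)))"
      unfolding sym_colors_def by (rule mfact_image_inj) (simp add: inj_def num_mult_left_cancel)
    ultimately show "mfact (image_mset (half_color t) (mset_set {h \<in> half_edges P t V. fst h = u})) =
        (if P (t u) then mfact (gen_parts (snd (t u))) else 1)"
      by (simp add: half_edges_at half_colors_at)
  qed
  finally show ?thesis .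
qed

text \<open>The comparison is made vertex by vertex: symbols agree under \<open>\<alpha>\<close>,
  hence edges and half-edges at a vertex have the same colors. The end map
  \<open>\<epsilon>\<close>, its vertex class \<open>W\<close> and the side \<open>P\<close> are
  kept general to treat both ends at once.\<close>

lemma edge_labels:
  assumes \<Gamma>: "conn_graph \<Gamma>" and \<alpha>: "\<alpha> \<in> cbij (verts \<Gamma>) V (graph_sym \<Gamma>) t" and "finite V"
    and W: "W \<subseteq> verts \<Gamma>" "\<And>e. e \<in> edges \<Gamma> \<Longrightarrow> \<epsilon> e \<in> W"
      "\<And>v. v \<in> W \<Longrightarrow> {e \<in> edges \<Gamma>. \<epsilon> e = v} = incident_edges \<Gamma> v"
      "\<And>v. v \<in> verts \<Gamma> \<Longrightarrow> P (graph_sym \<Gamma> v) \<longleftrightarrow> v \<in> W"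
  shows "image_mset (\<lambda>e. (\<alpha> (\<epsilon> e), edge_num \<Gamma> e)) (mset_set (edges \<Gamma>)) =
    image_mset (half_label t) (mset_set (half_edges P t V))"
  unfolding half_label_def[abs_def]
proof (rule image_mset_pair_eqI)
  show "finite (edges \<Gamma>)" using \<Gamma> by (auto simp: conn_graph_def dest: colored_bipartiteD(2))
  show "finite (half_edges P t V)" by (rule finite_half_edges[OF \<open>finite V\<close>])
  note bij = cbijD(1)[OF \<alpha>]
  fix u
  show "image_mset (edge_num \<Gamma>) (mset_set {e \<in> edges \<Gamma>. \<alpha> (\<epsilon> e) = u}) =
      image_mset (half_color t) (mset_set {h \<in> half_edges P t V. fst h = u})"
  proof (cases "u \<in> V")
    case True
    then obtain v where v: "v \<in> verts \<Gamma>" "u = \<alpha> v" using bij by (auto simp: bij_betw_def)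
    have tu: "t u = graph_sym \<Gamma> v" using cbijD(3)[OF \<alpha> v(1)] v(2) by simp
    have "\<alpha> (\<epsilon> e) = \<alpha> v \<longleftrightarrow> \<epsilon> e = v" if "e \<in> edges \<Gamma>" for e
      using bij W(1) W(2)[OF that] v(1) by (auto simp: bij_betw_def inj_on_def)
    then have E: "{e \<in> edges \<Gamma>. \<alpha> (\<epsilon> e) = u} = {e \<in> edges \<Gamma>. \<epsilon> e = v}" using v(2) by auto
    show ?thesis
    proof (cases "v \<in> W")
      case vW: True
      then have "P (t u)" using W(4)[OF v(1)] tu by simp
      then show ?thesis
        unfolding E W(3)[OF vW] half_edges_at half_colors_at
        using True by (simp add: half_colors_at tu sym_colors_graph_sym[OF \<Gamma> v(1)])
    next
      case False
      then have "\<not> P (t u)" and E0: "{e \<in> edges \<Gamma>. \<epsilon> e = v} = {}"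
        using W(2) W(4)[OF v(1)] tu by auto
      then show ?thesis unfolding E E0 half_edges_at using True by (simp add: half_colors_at)
    qed
  next
    case False
    then have E0: "{e \<in> edges \<Gamma>. \<alpha> (\<epsilon> e) = u} = {}"
      using W(1,2) cbijD(2)[OF \<alpha>] by blast
    show ?thesis unfolding E0 half_edges_at using False by simp
  qed
qed

lemma edge_labels_ends:
  assumes "conn_graph \<Gamma>" "\<alpha> \<in> cbij (verts \<Gamma>) V (graph_sym \<Gamma>) t" "finite V"
  shows "image_mset (\<lambda>e. (\<alpha> (end1 \<Gamma> e), edge_num \<Gamma> e)) (mset_set (edges \<Gamma>)) =
      image_mset (half_label t) (mset_set (halfA t V))"
    "image_mset (\<lambda>e. (\<alpha> (end2 \<Gamma> e), edge_num \<Gamma> e)) (mset_set (edges \<Gamma>)) =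
      image_mset (half_label t) (mset_set (halfB t V))"
proof -
  have cb: "colored_bipartite \<Gamma>" using assms(1) by (simp add: conn_graph_def)
  note c = colored_bipartiteD[OF cb]
  show "image_mset (\<lambda>e. (\<alpha> (end1 \<Gamma> e), edge_num \<Gamma> e)) (mset_set (edges \<Gamma>)) =
      image_mset (half_label t) (mset_set (halfA t V))"
    by (rule edge_labels[OF assms, of "verts1 \<Gamma>"])
      (use c(3,4,5) in \<open>auto simp: verts_def incident_edges_def\<close>)
  show "image_mset (\<lambda>e. (\<alpha> (end2 \<Gamma> e), edge_num \<Gamma> e)) (mset_set (edges \<Gamma>)) =
      image_mset (half_label t) (mset_set (halfB t V))"
    by (rule edge_labels[OF assms, of "verts2 \<Gamma>"])
      (use c(3,4,5) in \<open>auto simp: verts_def incident_edges_def simp del: range_eqI\<close>)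
qed

text \<open>An edge is represented by its half-edge on the A side; the gluing supplies the other
  end.\<close>

definition glue_graph ::
  "('v \<Rightarrow> num \<times> gen) \<Rightarrow> 'v set \<Rightarrow> ('v half_edge \<Rightarrow> 'v half_edge) \<Rightarrow> ('v, 'v half_edge) cbgraph" where
  "glue_graph t V \<sigma> = \<lparr>verts1 = {v \<in> V. sideA (t v)}, verts2 = {v \<in> V. \<not> sideA (t v)},
     edges = halfA t V, end1 = fst, end2 = (\<lambda>h. fst (\<sigma> h)),
     vcol = (\<lambda>v. numeral (fst (t v))), ecol = (\<lambda>h. numeral (half_color t h))\<rparr>"

lemma glue_graph_simps [simp]:
  "verts1 (glue_graph t V \<sigma>) = {v \<in> V. sideA (t v)}"
  "verts2 (glue_graph t V \<sigma>) = {v \<in> V. \<not> sideA (t v)}"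
  "edges (glue_graph t V \<sigma>) = halfA t V" "end1 (glue_graph t V \<sigma>) = fst"
  "end2 (glue_graph t V \<sigma>) = (\<lambda>h. fst (\<sigma> h))"
  "vcol (glue_graph t V \<sigma>) = (\<lambda>v. numeral (fst (t v)))"
  "ecol (glue_graph t V \<sigma>) = (\<lambda>h. numeral (half_color t h))"
  "verts (glue_graph t V \<sigma>) = V"
  by (auto simp: glue_graph_def verts_def)

lemma half_edges_side: "h \<in> half_edges P t V \<Longrightarrow> P (t (fst h))"
  by (auto simp: half_edges_def)

lemma colored_bipartite_glue_graph:
  assumes "finite V" "\<sigma> \<in> glue t V"
  shows "colored_bipartite (glue_graph t V \<sigma>)"
  unfolding colored_bipartite_def glue_graph_simps
proof (intro conjI ballI)
  fix h assume h: "h \<in> halfA t V"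
  show "fst h \<in> {v \<in> V. sideA (t v)}" using fst_half_edges[OF h] half_edges_side[OF h] by simp
  show "fst (\<sigma> h) \<in> {v \<in> V. \<not> sideA (t v)}"
    using fst_half_edges[OF glueD(2)[OF assms(2) h]] half_edges_side[OF glueD(2)[OF assms(2) h]] by simp
qed (use assms(1) in \<open>auto simp: finite_half_edges\<close>)

lemma connected_glue_graph_iff:
  assumes "finite V" "\<sigma> \<in> glue t V"
  shows "connected_graph (glue_graph t V \<sigma>) \<longleftrightarrow> glue_conn \<sigma> (halfA t V) V"
  unfolding connected_graph_iff_cut[OF colored_bipartite_glue_graph[OF assms]]
  by (simp add: glue_conn_def cut_closed_def glue_closed_def)

lemma parts_half_edges:
  "image_mset (\<lambda>h. fst (snd h)) (mset_set (half_edges P t {v})) =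
    (if P (t v) then gen_parts (snd (t v)) else {#})"
proof (cases "P (t v)")
  case True
  let ?m = "gen_parts (snd (t v))"
  have "mset_set (half_edges P t {v}) =
      image_mset (Pair v) (mset_set (SIGMA c:set_mset ?m. {..<count ?m c}))"
    using True by (simp add: half_edges_single image_mset_mset_set inj_on_def)
  then show ?thesis
    using True by (simp add: multiset.map_comp comp_def image_fst_SIGMA_count)
qed (simp add: half_edges_single)

text \<open>At an A-vertex the incident edges are its half-edges; at a B-vertex they correspond to
  its half-edges through \<open>\<sigma>\<close>, which preserves colors. Either way the edge color
  is the vertex color times a part.\<close>

lemma vpartition_glue_graph:
  assumes "finite V" "\<sigma> \<in> glue t V" "v \<in> V"
  shows "vpartition (glue_graph t V \<sigma>) v = gen_parts (snd (t v))" (is ?part)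
    and "h \<in> incident_edges (glue_graph t V \<sigma>) v \<Longrightarrow>
      numeral (fst (t v)) dvd (numeral (half_color t h) :: nat)"
proof -
  let ?I = "incident_edges (glue_graph t V \<sigma>) v"
  have quot: "num_of_nat (numeral (k * c) div numeral k) = c" for k c :: num
    unfolding numeral_mult by (subst nonzero_mult_div_cancel_left) simp_all
  have dvd: "numeral k dvd (numeral (k * c) :: nat)" for k c :: num
    unfolding numeral_mult by (rule dvd_triv_left)
  have fin: "finite ?I"
    using finite_half_edges[OF assms(1)] by (simp add: incident_edges_def)
  have "\<exists>f. (\<forall>h\<in>?I. half_color t h = fst (t v) * f h) \<and>
    image_mset f (mset_set ?I) = gen_parts (snd (t v))"
  proof (cases "sideA (t v)")
    case True
    have "fst (\<sigma> h) \<noteq> v" if "h \<in> halfA t V" for h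
      using half_edges_side[OF glueD(2)[OF assms(2) that]] True by blast
    then have "?I = {h \<in> halfA t V. fst h = v}"
      by (auto simp: incident_edges_def)
    then have I: "?I = halfA t {v}"
      using assms(3) by (simp add: half_edges_at)
    have "half_color t h = fst (t v) * fst (snd h)" if "h \<in> ?I" for h
      using fst_half_edges[of h sideA t "{v}"] that unfolding I by (simp add: half_color_def)
    moreover have "image_mset (\<lambda>h. fst (snd h)) (mset_set ?I) = gen_parts (snd (t v))"
      unfolding I parts_half_edges using True by simp
    ultimately show ?thesis by (intro exI[of _ "\<lambda>h. fst (snd h)"] conjI ballI)
  next
    case False
    have "fst h \<noteq> v" if "h \<in> halfA t V" for h
      using half_edges_side[OF that] False by blast
    then have I: "?I = {h \<in> halfA t V. fst (\<sigma> h) = v}"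
      by (auto simp: incident_edges_def)
    have B: "halfB t V = \<sigma> ` halfA t V"
      using glueD(1)[OF assms(2)] unfolding bij_betw_def by simp
    have "\<sigma> ` ?I = {h \<in> halfB t V. fst h = v}"
      unfolding I B by blast
    then have \<sigma>I: "\<sigma> ` ?I = halfB t {v}"
      using assms(3) by (simp add: half_edges_at)
    have "?I \<subseteq> halfA t V" unfolding I by blast
    then have inj: "inj_on \<sigma> ?I"
      using glueD(1)[OF assms(2)] unfolding bij_betw_def by (meson inj_on_subset)
    have "half_color t h = fst (t v) * fst (snd (\<sigma> h))" if "h \<in> ?I" for h
      using that glueD(3)[OF assms(2), of h] unfolding I by (simp add: half_color_def)
    moreover have "image_mset (\<lambda>h. fst (snd (\<sigma> h))) (mset_set ?I) = gen_parts (snd (t v))"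
    proof -
      have "image_mset (\<lambda>h. fst (snd (\<sigma> h))) (mset_set ?I) =
          image_mset (\<lambda>h. fst (snd h)) (image_mset \<sigma> (mset_set ?I))"
        by (simp add: multiset.map_comp comp_def)
      also have "image_mset \<sigma> (mset_set ?I) = mset_set (halfB t {v})"
        unfolding image_mset_mset_set[OF inj] \<sigma>I ..
      finally show ?thesis using False by (simp add: parts_half_edges)
    qed
    ultimately show ?thesis by (intro exI[of _ "\<lambda>h. fst (snd (\<sigma> h))"] conjI ballI)
  qed
  then obtain f where f: "\<And>h. h \<in> ?I \<Longrightarrow> half_color t h = fst (t v) * f h"
    "image_mset f (mset_set ?I) = gen_parts (snd (t v))" by (elim exE conjE) blast
  show ?part
    unfolding f(2)[symmetric] vpartition_def glue_graph_simps
  proof (rule image_mset_cong)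
    fix h assume "h \<in># mset_set ?I"
    then have "h \<in> ?I" using fin by simp
    from f(1)[OF this] show "num_of_nat (numeral (half_color t h) div numeral (fst (t v))) = f h"
      by (simp only: quot)
  qed
  show "h \<in> ?I \<Longrightarrow> numeral (fst (t v)) dvd (numeral (half_color t h) :: nat)"
    unfolding f(1) by (rule dvd)
qed

lemma graph_sym_glue_graph:
  assumes "finite V" "\<sigma> \<in> glue t V" "v \<in> V"
  shows "graph_sym (glue_graph t V \<sigma>) v = t v"
  unfolding graph_sym_def vpartition_glue_graph(1)[OF assms]
  using assms(3) by (cases "t v"; cases "snd (t v)") (auto simp: parts_inverse)

lemma gen_parts_ne: "gen_parts g \<noteq> {#}"
  using parts by (cases g) auto

lemma conn_graph_glue_graph:
  assumes "finite V" "\<sigma> \<in> cglue t V"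
  shows "conn_graph (glue_graph t V \<sigma>)"
proof -
  have \<sigma>: "\<sigma> \<in> glue t V" "glue_conn \<sigma> (halfA t V) V" using assms(2) by (auto simp: cglue_def)
  have "admissible_star (glue_graph t V \<sigma>)"
    unfolding admissible_star_def admissible_def glue_graph_simps
  proof (intro conjI ballI)
    fix v assume v: "v \<in> V"
    show "incident_edges (glue_graph t V \<sigma>) v \<noteq> {}"
      using vpartition_glue_graph(1)[OF assms(1) \<sigma>(1) v] gen_parts_ne[of "snd (t v)"]
      by (auto simp: vpartition_def)
    fix h assume "h \<in> incident_edges (glue_graph t V \<sigma>) v"
    then show "numeral (fst (t v)) dvd (numeral (half_color t h) :: nat)"
      by (rule vpartition_glue_graph(2)[OF assms(1) \<sigma>(1) v])
  qed
  then show ?thesis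
    unfolding conn_graph_def
    using colored_bipartite_glue_graph[OF assms(1) \<sigma>(1)] connected_glue_graph_iff[OF assms(1) \<sigma>(1)] \<sigma>(2)
    by blast
qed

section \<open>Counting the gluings in an isomorphism class\<close>

text \<open>Given \<open>\<alpha>\<close>, the two edge labellings are chosen independently of each
  other, which makes the set easy to count.\<close>

definition labelled_isos ::
  "('w, 'e) cbgraph \<Rightarrow> ('v \<Rightarrow> num \<times> gen) \<Rightarrow> 'v set \<Rightarrow>
   (('w \<Rightarrow> 'v) \<times> ('e \<Rightarrow> 'v half_edge) \<times> ('e \<Rightarrow> 'v half_edge)) set" where
  "labelled_isos \<Gamma> t V =
     (SIGMA \<alpha>:cbij (verts \<Gamma>) V (graph_sym \<Gamma>) t.
        cbij (edges \<Gamma>) (halfA t V) (\<lambda>e. (\<alpha> (end1 \<Gamma> e), edge_num \<Gamma> e)) (half_label t) \<times>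
        cbij (edges \<Gamma>) (halfB t V) (\<lambda>e. (\<alpha> (end2 \<Gamma> e), edge_num \<Gamma> e)) (half_label t))"

text \<open>Edge labellings differ by permuting, at each vertex, the half-edges of equal color,
  which gives \<open>mfact\<close> of its partition. Every vertex lies on one side, so both sides
  together give \<open>aut_prod\<close>, whatever the vertex labelling.\<close>

lemma card_labelled_isos:
  assumes "conn_graph \<Gamma>" "finite V" "graph_mono \<Gamma> = image_mset t (mset_set V)"
  shows "card (labelled_isos \<Gamma> t V) = mfact (graph_mono \<Gamma>) * aut_prod (graph_mono \<Gamma>)"
proof -
  have cb: "colored_bipartite \<Gamma>" using assms(1) by (simp add: conn_graph_def)
  note c = colored_bipartiteD(1,2)[OF cb]
  note fin = c assms(2) finite_half_edges[OF assms(2)]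
  let ?S = "cbij (verts \<Gamma>) V (graph_sym \<Gamma>) t"
  let ?A = "\<lambda>\<alpha>. cbij (edges \<Gamma>) (halfA t V) (\<lambda>e. (\<alpha> (end1 \<Gamma> e), edge_num \<Gamma> e)) (half_label t)"
  let ?B = "\<lambda>\<alpha>. cbij (edges \<Gamma>) (halfB t V) (\<lambda>e. (\<alpha> (end2 \<Gamma> e), edge_num \<Gamma> e)) (half_label t)"
  have "card (?A \<alpha> \<times> ?B \<alpha>) = aut_prod (graph_mono \<Gamma>)" if \<alpha>: "\<alpha> \<in> ?S" for \<alpha>
  proof -
    have "card (?A \<alpha>) = (\<Prod>u\<in>V. if sideA (t u) then mfact (gen_parts (snd (t u))) else 1)"
      unfolding card_cbij[OF c(2) finite_half_edges[OF assms(2)]] edge_labels_ends(1)[OF assms(1) \<alpha> assms(2)]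
      by (simp only: refl if_True mfact_half_label[OF assms(2)])
    moreover have "card (?B \<alpha>) = (\<Prod>u\<in>V. if \<not> sideA (t u) then mfact (gen_parts (snd (t u))) else 1)"
      unfolding card_cbij[OF c(2) finite_half_edges[OF assms(2)]] edge_labels_ends(2)[OF assms(1) \<alpha> assms(2)]
      by (simp only: refl if_True mfact_half_label[OF assms(2)])
    ultimately have "card (?A \<alpha> \<times> ?B \<alpha>) = (\<Prod>u\<in>V. mfact (gen_parts (snd (t u))))"
      unfolding card_cartesian_product by (simp only: prod.distrib[symmetric]) (rule prod.cong, auto)
    also have "\<dots> = aut_prod (graph_mono \<Gamma>)"
      unfolding assms(3) aut_prod_def by (simp add: prod_unfold_prod_mset multiset.map_comp comp_def)
    finally show ?thesis .
  qed
  moreover have "card (labelled_isos \<Gamma> t V) = (\<Sum>\<alpha>\<in>?S. card (?A \<alpha> \<times> ?B \<alpha>))"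
    unfolding labelled_isos_def
    by (rule card_SigmaI) (auto intro!: finite_cbij finite_cartesian_product fin)
  moreover have "card ?S = mfact (graph_mono \<Gamma>)"
    using card_cbij[OF c(1) assms(2), of "graph_sym \<Gamma>" t] assms(3) by (simp add: graph_mono_def)
  ultimately show ?thesis by simp
qed

text \<open>For a fixed gluing the labelling on the B side is forced: it is \<open>\<sigma>\<close>
  after \<open>\<tau>\<close>.\<close>

lemma graph_iso_glue_graph_iff:
  assumes \<Gamma>: "conn_graph \<Gamma>" and "finite V" and \<sigma>: "\<sigma> \<in> glue t V"
    and ext: "\<alpha> \<in> extensional (verts \<Gamma>)" "\<tau> \<in> extensional (edges \<Gamma>)"
  shows "graph_iso \<Gamma> (glue_graph t V \<sigma>) \<alpha> \<tau> \<longleftrightarrow>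
    (\<alpha>, \<tau>, restrict (\<lambda>e. \<sigma> (\<tau> e)) (edges \<Gamma>)) \<in> labelled_isos \<Gamma> t V"
proof
  let ?\<Delta> = "glue_graph t V \<sigma>"
  have cb: "colored_bipartite \<Gamma>" using \<Gamma> by (simp add: conn_graph_def)
  assume iso: "graph_iso \<Gamma> ?\<Delta> \<alpha> \<tau>"
  note 1 = graph_isoD[OF iso, unfolded glue_graph_simps]
  have col: "half_color t (\<tau> e) = edge_num \<Gamma> e" if "e \<in> edges \<Gamma>" for e
    unfolding edge_num_def 1(8)[OF that, symmetric] by simp
  have "\<alpha> \<in> cbij (verts \<Gamma>) V (graph_sym \<Gamma>) t"
  proof (rule cbijI[OF 1(1)])
    fix v assume v: "v \<in> verts \<Gamma>"
    show "t (\<alpha> v) = graph_sym \<Gamma> v"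
      using graph_sym_iso[OF cb iso v] graph_sym_glue_graph[OF assms(2) \<sigma> 1(9)[OF v]] by simp
  qed (use ext in \<open>auto simp: extensional_def\<close>)
  moreover have \<tau>: "\<tau> \<in> cbij (edges \<Gamma>) (halfA t V) (\<lambda>e. (\<alpha> (end1 \<Gamma> e), edge_num \<Gamma> e)) (half_label t)"
    by (rule cbijI[OF 1(2)]) (use ext 1(5) col in \<open>auto simp: half_label_def extensional_def\<close>)
  moreover have "restrict (\<lambda>e. \<sigma> (\<tau> e)) (edges \<Gamma>) \<in>
      cbij (edges \<Gamma>) (halfB t V) (\<lambda>e. (\<alpha> (end2 \<Gamma> e), edge_num \<Gamma> e)) (half_label t)"
  proof (rule cbijI)
    have "bij_betw (\<lambda>e. \<sigma> (\<tau> e)) (edges \<Gamma>) (halfB t V)"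
      using bij_betw_trans[OF 1(2) glueD(1)[OF \<sigma>]] by (simp add: comp_def)
    then show "bij_betw (restrict (\<lambda>e. \<sigma> (\<tau> e)) (edges \<Gamma>)) (edges \<Gamma>) (halfB t V)"
      by (simp cong: bij_betw_cong)
    fix e assume e: "e \<in> edges \<Gamma>"
    show "half_label t (restrict (\<lambda>e. \<sigma> (\<tau> e)) (edges \<Gamma>) e) = (\<alpha> (end2 \<Gamma> e), edge_num \<Gamma> e)"
      using e 1(6)[OF e] col[OF e] glueD(3)[OF \<sigma> 1(10)[OF e]] by (simp add: half_label_def)
  qed simp
  ultimately show "(\<alpha>, \<tau>, restrict (\<lambda>e. \<sigma> (\<tau> e)) (edges \<Gamma>)) \<in> labelled_isos \<Gamma> t V"
    by (simp add: labelled_isos_def)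
next
  let ?\<Delta> = "glue_graph t V \<sigma>"
  have cb: "colored_bipartite \<Gamma>" using \<Gamma> by (simp add: conn_graph_def)
  note c = colored_bipartiteD[OF cb]
  assume "(\<alpha>, \<tau>, restrict (\<lambda>e. \<sigma> (\<tau> e)) (edges \<Gamma>)) \<in> labelled_isos \<Gamma> t V"
  then have \<alpha>: "\<alpha> \<in> cbij (verts \<Gamma>) V (graph_sym \<Gamma>) t"
    and \<tau>: "\<tau> \<in> cbij (edges \<Gamma>) (halfA t V) (\<lambda>e. (\<alpha> (end1 \<Gamma> e), edge_num \<Gamma> e)) (half_label t)"
    and \<rho>: "restrict (\<lambda>e. \<sigma> (\<tau> e)) (edges \<Gamma>) \<in>
      cbij (edges \<Gamma>) (halfB t V) (\<lambda>e. (\<alpha> (end2 \<Gamma> e), edge_num \<Gamma> e)) (half_label t)"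
    by (simp_all add: labelled_isos_def)
  have img: "V = \<alpha> ` verts \<Gamma>" using cbijD(1)[OF \<alpha>] by (simp add: bij_betw_def)
  have side: "sideA (t (\<alpha> v)) \<longleftrightarrow> v \<in> verts1 \<Gamma>" if "v \<in> verts \<Gamma>" for v
    using cbijD(3)[OF \<alpha> that] by simp
  show "graph_iso \<Gamma> ?\<Delta> \<alpha> \<tau>"
    unfolding graph_iso_def glue_graph_simps
  proof (intro conjI ballI)
    show "bij_betw \<alpha> (verts \<Gamma>) V" by (rule cbijD(1)[OF \<alpha>])
    show "bij_betw \<tau> (edges \<Gamma>) (halfA t V)" by (rule cbijD(1)[OF \<tau>])
    show "\<alpha> ` verts1 \<Gamma> = {v \<in> V. sideA (t v)}"
    proof (intro set_eqI iffI)
      fix u assume "u \<in> \<alpha> ` verts1 \<Gamma>"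
      then obtain v where "v \<in> verts1 \<Gamma>" "u = \<alpha> v" by blast
      then show "u \<in> {v \<in> V. sideA (t v)}" using side[of v] img by (auto simp: verts_def)
    next
      fix u assume u: "u \<in> {v \<in> V. sideA (t v)}"
      then obtain v where "v \<in> verts \<Gamma>" "u = \<alpha> v" using img by blast
      then show "u \<in> \<alpha> ` verts1 \<Gamma>" using side[of v] u by simp
    qed
    show "\<alpha> ` verts2 \<Gamma> = {v \<in> V. \<not> sideA (t v)}"
    proof (intro set_eqI iffI)
      fix u assume "u \<in> \<alpha> ` verts2 \<Gamma>"
      then obtain v where v: "v \<in> verts2 \<Gamma>" "u = \<alpha> v" by blast
      then have "v \<notin> verts1 \<Gamma>" "v \<in> verts \<Gamma>" using c(3) by (auto simp: verts_def)
      with v side[of v] img show "u \<in> {v \<in> V. \<not> sideA (t v)}" by simp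
    next
      fix u assume u: "u \<in> {v \<in> V. \<not> sideA (t v)}"
      then obtain v where v: "v \<in> verts \<Gamma>" "u = \<alpha> v" using img by blast
      then have "v \<notin> verts1 \<Gamma>" using side[of v] u by simp
      then show "u \<in> \<alpha> ` verts2 \<Gamma>" using v by (auto simp: verts_def)
    qed
  next
    fix v assume v: "v \<in> verts \<Gamma>"
    have "fst (t (\<alpha> v)) = num_of_nat (vcol \<Gamma> v)" using cbijD(3)[OF \<alpha> v] by (simp add: graph_sym_def)
    then show "numeral (fst (t (\<alpha> v))) = vcol \<Gamma> v" by (simp add: numeral_num_of_nat c(8)[OF v])
  next
    fix e assume e: "e \<in> edges \<Gamma>"
    show "fst (\<tau> e) = \<alpha> (end1 \<Gamma> e)" using cbijD(3)[OF \<tau> e] by (simp add: half_label_def)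
    show "fst (\<sigma> (\<tau> e)) = \<alpha> (end2 \<Gamma> e)" using cbijD(3)[OF \<rho> e] e by (simp add: half_label_def)
    have "half_color t (\<tau> e) = edge_num \<Gamma> e" using cbijD(3)[OF \<tau> e] by (simp add: half_label_def)
    then show "numeral (half_color t (\<tau> e)) = ecol \<Gamma> e"
      by (simp add: edge_num_def numeral_num_of_nat c(9)[OF e])
  qed
qed

text \<open>The gluing is recovered as \<open>\<rho>\<close> after the inverse of
  \<open>\<tau>\<close>. It is connected because the isomorphism transports connectedness from
  \<open>\<Gamma>\<close>.\<close>

lemma glue_of_labelled_iso:
  assumes \<Gamma>: "conn_graph \<Gamma>" and "finite V" and mem: "(\<alpha>, \<tau>, \<rho>) \<in> labelled_isos \<Gamma> t V"
  defines "\<sigma> \<equiv> restrict (\<lambda>h. \<rho> (inv_into (edges \<Gamma>) \<tau> h)) (halfA t V)"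
  shows "\<sigma> \<in> cglue t V" "restrict (\<lambda>e. \<sigma> (\<tau> e)) (edges \<Gamma>) = \<rho>" "graph_iso \<Gamma> (glue_graph t V \<sigma>) \<alpha> \<tau>"
proof -
  from mem have \<alpha>: "\<alpha> \<in> cbij (verts \<Gamma>) V (graph_sym \<Gamma>) t"
    and \<tau>: "\<tau> \<in> cbij (edges \<Gamma>) (halfA t V) (\<lambda>e. (\<alpha> (end1 \<Gamma> e), edge_num \<Gamma> e)) (half_label t)"
    and \<rho>: "\<rho> \<in> cbij (edges \<Gamma>) (halfB t V) (\<lambda>e. (\<alpha> (end2 \<Gamma> e), edge_num \<Gamma> e)) (half_label t)"
    by (simp_all add: labelled_isos_def)
  have inv\<tau>: "bij_betw (inv_into (edges \<Gamma>) \<tau>) (halfA t V) (edges \<Gamma>)"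
    by (rule bij_betw_inv_into[OF cbijD(1)[OF \<tau>]])
  have inj\<tau>: "inj_on \<tau> (edges \<Gamma>)" using cbijD(1)[OF \<tau>] by (simp add: bij_betw_def)
  have \<sigma>\<tau>: "\<sigma> (\<tau> e) = \<rho> e" if "e \<in> edges \<Gamma>" for e
    using cbijD(2)[OF \<tau> that] inv_into_f_f[OF inj\<tau> that] by (simp add: \<sigma>_def)
  show eq: "restrict (\<lambda>e. \<sigma> (\<tau> e)) (edges \<Gamma>) = \<rho>"
  proof
    fix e
    show "restrict (\<lambda>e. \<sigma> (\<tau> e)) (edges \<Gamma>) e = \<rho> e"
      by (cases "e \<in> edges \<Gamma>") (simp_all add: \<sigma>\<tau> cbijD(4)[OF \<rho>])
  qed
  have \<sigma>: "\<sigma> \<in> glue t V"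
    unfolding glue_def
  proof (rule cbijI)
    have "bij_betw (\<lambda>h. \<rho> (inv_into (edges \<Gamma>) \<tau> h)) (halfA t V) (halfB t V)"
      using bij_betw_trans[OF inv\<tau> cbijD(1)[OF \<rho>]] by (simp add: comp_def)
    then show "bij_betw \<sigma> (halfA t V) (halfB t V)" unfolding \<sigma>_def by (simp cong: bij_betw_cong)
    fix h assume "h \<in> halfA t V"
    then obtain e where e: "e \<in> edges \<Gamma>" "h = \<tau> e" using cbijD(1)[OF \<tau>] by (auto simp: bij_betw_def)
    then show "half_color t (\<sigma> h) = half_color t h"
      using cbijD(3)[OF \<tau> e(1)] cbijD(3)[OF \<rho> e(1)] by (simp add: \<sigma>\<tau> half_label_def)
  qed (simp add: \<sigma>_def)
  have ext: "\<alpha> \<in> extensional (verts \<Gamma>)" "\<tau> \<in> extensional (edges \<Gamma>)"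
    using cbijD(4)[OF \<alpha>] cbijD(4)[OF \<tau>] by (auto simp: extensional_def)
  show iso: "graph_iso \<Gamma> (glue_graph t V \<sigma>) \<alpha> \<tau>"
    using mem unfolding graph_iso_glue_graph_iff[OF \<Gamma> assms(2) \<sigma> ext] eq .
  have "conn_graph (glue_graph t V \<sigma>)" by (rule conn_graph_iso[OF \<Gamma> iso])
  then show "\<sigma> \<in> cglue t V"
    using \<sigma> connected_glue_graph_iff[OF assms(2) \<sigma>] by (simp add: cglue_def conn_graph_def)
qed

text \<open>
  A vertex labelling of \<open>\<Gamma>\<close> together with labellings of its edges by the half-edges on both
  sides amounts to a gluing and an isomorphism from \<open>\<Gamma>\<close> to its graph.
\<close>

lemma labelled_isos_count:
  assumes \<Gamma>: "conn_graph \<Gamma>" and V: "finite V" "graph_mono \<Gamma> = image_mset t (mset_set V)"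
  shows "card {\<sigma> \<in> cglue t V. \<exists>\<alpha> \<tau>. graph_iso \<Gamma> (glue_graph t V \<sigma>) \<alpha> \<tau>} * card (graph_aut \<Gamma>) =
    mfact (graph_mono \<Gamma>) * aut_prod (graph_mono \<Gamma>)"
proof -
  have cb: "colored_bipartite \<Gamma>" using \<Gamma> by (simp add: conn_graph_def)
  let ?I = "\<lambda>\<sigma>. graph_isos \<Gamma> (glue_graph t V \<sigma>)"
  let ?R = "\<lambda>\<sigma>. \<exists>\<alpha> \<tau>. graph_iso \<Gamma> (glue_graph t V \<sigma>) \<alpha> \<tau>"
  let ?f = "\<lambda>(\<alpha>, \<tau>, \<rho>). (restrict (\<lambda>h. \<rho> (inv_into (edges \<Gamma>) \<tau> h)) (halfA t V), \<alpha>, \<tau>)"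
  let ?g = "\<lambda>(\<sigma>, \<alpha>, \<tau>). (\<alpha>, \<tau>, restrict (\<lambda>e. \<sigma> (\<tau> e)) (edges \<Gamma>))"
  have ext: "\<alpha> \<in> extensional (verts \<Gamma>)" "\<tau> \<in> extensional (edges \<Gamma>)"
    if "(\<alpha>, \<tau>, \<rho>) \<in> labelled_isos \<Gamma> t V" for \<alpha> \<tau> \<rho>
    using that by (auto simp: labelled_isos_def extensional_def dest: cbijD(4))
  have "bij_betw ?f (labelled_isos \<Gamma> t V) (SIGMA \<sigma>:cglue t V. ?I \<sigma>)"
  proof (rule bij_betw_byWitness[where f' = ?g])
    show "\<forall>p\<in>labelled_isos \<Gamma> t V. ?g (?f p) = p"
      using glue_of_labelled_iso(2)[OF \<Gamma> V(1)] by auto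
    show "\<forall>q\<in>SIGMA \<sigma>:cglue t V. ?I \<sigma>. ?f (?g q) = q"
    proof
      fix q assume "q \<in> (SIGMA \<sigma>:cglue t V. ?I \<sigma>)"
      then obtain \<sigma> \<alpha> \<tau> where q: "q = (\<sigma>, \<alpha>, \<tau>)" "\<sigma> \<in> glue t V" "graph_iso \<Gamma> (glue_graph t V \<sigma>) \<alpha> \<tau>"
        by (auto simp: graph_isos_def cglue_def)
      have bij: "\<tau> ` edges \<Gamma> = halfA t V" using graph_isoD(2)[OF q(3)] by (simp add: bij_betw_def)
      have "restrict (\<lambda>h. restrict (\<lambda>e. \<sigma> (\<tau> e)) (edges \<Gamma>) (inv_into (edges \<Gamma>) \<tau> h)) (halfA t V) h = \<sigma> h" for h
      proof (cases "h \<in> halfA t V")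
        case True
        then show ?thesis
          using inv_into_into[of h \<tau> "edges \<Gamma>"] f_inv_into_f[of h \<tau> "edges \<Gamma>"] by (simp add: bij)
      qed (simp add: glueD(4)[OF q(2)])
      then show "?f (?g q) = q" by (simp add: q(1) fun_eq_iff)
    qed
    show "?f ` labelled_isos \<Gamma> t V \<subseteq> (SIGMA \<sigma>:cglue t V. ?I \<sigma>)"
    proof (rule image_subsetI)
      fix p assume p: "p \<in> labelled_isos \<Gamma> t V"
      obtain \<alpha> \<tau> \<rho> where p_eq: "p = (\<alpha>, \<tau>, \<rho>)" by (cases p)
      show "?f p \<in> (SIGMA \<sigma>:cglue t V. ?I \<sigma>)"
        using glue_of_labelled_iso(1,3)[OF \<Gamma> V(1) p[unfolded p_eq]] ext[OF p[unfolded p_eq]]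
        by (simp add: p_eq graph_isos_def)
    qed
    show "?g ` (SIGMA \<sigma>:cglue t V. ?I \<sigma>) \<subseteq> labelled_isos \<Gamma> t V"
    proof (rule image_subsetI)
      fix q assume "q \<in> (SIGMA \<sigma>:cglue t V. ?I \<sigma>)"
      then obtain \<sigma> \<alpha> \<tau> where q: "q = (\<sigma>, \<alpha>, \<tau>)" "\<sigma> \<in> glue t V"
        "\<alpha> \<in> extensional (verts \<Gamma>)" "\<tau> \<in> extensional (edges \<Gamma>)" "graph_iso \<Gamma> (glue_graph t V \<sigma>) \<alpha> \<tau>"
        by (auto simp: graph_isos_def cglue_def)
      show "?g q \<in> labelled_isos \<Gamma> t V"
        using q(5) unfolding graph_iso_glue_graph_iff[OF \<Gamma> V(1) q(2-4)] by (simp add: q(1))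
    qed
  qed
  then have "card (labelled_isos \<Gamma> t V) = card (SIGMA \<sigma>:cglue t V. ?I \<sigma>)"
    by (rule bij_betw_same_card)
  also have "\<dots> = (\<Sum>\<sigma>\<in>cglue t V. card (?I \<sigma>))"
    by (rule card_SigmaI)
      (use V(1) colored_bipartiteD(1,2)[OF cb] in \<open>auto intro!: finite_graph_isos simp: finite_cglue finite_half_edges\<close>)
  \<comment> \<open>The fiber over a gluing is empty or has the size of the automorphism group of
    \<open>\<Gamma>\<close>.\<close>
  also have "\<dots> = (\<Sum>\<sigma>\<in>cglue t V. if ?R \<sigma> then card (graph_aut \<Gamma>) else 0)"
  proof (rule sum.cong[OF refl])
    fix \<sigma>
    show "card (?I \<sigma>) = (if ?R \<sigma> then card (graph_aut \<Gamma>) else 0)"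
    proof (cases "?R \<sigma>")
      case True
      then show ?thesis using card_graph_isos[OF cb] by auto
    next
      case False
      then have "?I \<sigma> = {}" by (auto simp: graph_isos_def)
      with False show ?thesis by simp
    qed
  qed
  also have "\<dots> = card {\<sigma> \<in> cglue t V. ?R \<sigma>} * card (graph_aut \<Gamma>)"
    using finite_cglue[OF V(1)] by (simp add: sum.If_cases Int_def)
  finally show ?thesis using card_labelled_isos[OF assms] by simp
qed

section \<open>The coefficients of the graph sum\<close>

text \<open>Changing the value outside \<open>A\<close> from the identity to
  \<open>undefined\<close> turns these permutations into \<open>cbij A A c c\<close>.\<close>

lemma card_color_permutations:
  assumes "finite A"
  shows "card {\<pi>. \<pi> permutes A \<and> (\<forall>i\<in>A. c (\<pi> i) = c i)} = mfact (image_mset c (mset_set A))"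
proof -
  have "bij_betw (\<lambda>\<pi>. restrict \<pi> A) {\<pi>. \<pi> permutes A \<and> (\<forall>i\<in>A. c (\<pi> i) = c i)} (cbij A A c c)"
  proof (rule bij_betw_byWitness[where f' = "\<lambda>f i. if i \<in> A then f i else i"])
    show "\<forall>\<pi>\<in>{\<pi>. \<pi> permutes A \<and> (\<forall>i\<in>A. c (\<pi> i) = c i)}. (\<lambda>i. if i \<in> A then restrict \<pi> A i else i) = \<pi>"
      by (auto simp: fun_eq_iff permutes_not_in)
    show "\<forall>f\<in>cbij A A c c. restrict (\<lambda>i. if i \<in> A then f i else i) A = f"
      by (auto simp: fun_eq_iff dest: cbijD(4))
    show "(\<lambda>\<pi>. restrict \<pi> A) ` {\<pi>. \<pi> permutes A \<and> (\<forall>i\<in>A. c (\<pi> i) = c i)} \<subseteq> cbij A A c c"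
      by (auto intro!: cbijI simp: permutes_imp_bij cong: bij_betw_cong)
    show "(\<lambda>f i. if i \<in> A then f i else i) ` cbij A A c c \<subseteq> {\<pi>. \<pi> permutes A \<and> (\<forall>i\<in>A. c (\<pi> i) = c i)}"
    proof (rule image_subsetI)
      fix f assume f: "f \<in> cbij A A c c"
      have "bij_betw (\<lambda>i. if i \<in> A then f i else i) A A"
        using cbijD(1)[OF f] by (subst bij_betw_cong[of _ _ f]) auto
      then have "(\<lambda>i. if i \<in> A then f i else i) permutes A" by (rule bij_imp_permutes) simp
      then show "(\<lambda>i. if i \<in> A then f i else i) \<in> {\<pi>. \<pi> permutes A \<and> (\<forall>i\<in>A. c (\<pi> i) = c i)}"
        using cbijD(3)[OF f] by simp
    qed
  qed
  then show ?thesis by (simp add: bij_betw_same_card card_cbij assms)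
qed

lemma card_partition_aut: "card (partition_aut l) = mfact l"
proof -
  define ps where "ps = rev (sorted_list_of_multiset l)"
  have ps: "mset ps = l" by (simp add: ps_def)
  then have len: "length ps = size l" by auto
  have "image_mset ((!) ps) (mset_set {..<size l}) = mset (map ((!) ps) [0..<size l])"
    by (simp only: mset_map mset_upt atLeast0LessThan)
  also have "\<dots> = l" by (simp only: len[symmetric] map_nth ps)
  finally show ?thesis
    using card_color_permutations[of "{..<size l}" "(!) ps"]
    by (simp add: partition_aut_def ps_def Ball_def Let_def)
qed

text \<open>Every edge has exactly one end in the first class. The label identity for the identity
  labelling, with the vertices forgotten, leaves the colors.\<close>

lemma colorsA_graph_mono:
  assumes "conn_graph \<Gamma>"
  shows "colorsA (graph_mono \<Gamma>) = image_mset (edge_num \<Gamma>) (mset_set (edges \<Gamma>))"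
proof -
  let ?V = "verts \<Gamma>" and ?t = "graph_sym \<Gamma>"
  have fin: "finite ?V" using assms by (auto simp: conn_graph_def dest: colored_bipartiteD(1))
  have "restrict (\<lambda>v. v) ?V \<in> cbij ?V ?V ?t ?t"
    by (rule cbijI) (auto simp: bij_betw_def inj_on_def)
  from edge_labels_ends(1)[OF assms this fin]
  have "image_mset snd (image_mset (half_label ?t) (mset_set (halfA ?t ?V))) =
      image_mset snd (image_mset (\<lambda>e. (restrict (\<lambda>v. v) ?V (end1 \<Gamma> e), edge_num \<Gamma> e)) (mset_set (edges \<Gamma>)))"
    by simp
  then have "image_mset (half_color ?t) (mset_set (halfA ?t ?V)) = image_mset (edge_num \<Gamma>) (mset_set (edges \<Gamma>))"
    unfolding multiset.map_comp comp_def half_label_def snd_conv .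
  then show ?thesis unfolding half_colors[OF fin] colorsA_def graph_mono_def .
qed

lemma numeral_num_of_nat_rat: "n > 0 \<Longrightarrow> numeral (num_of_nat n) = (of_nat n :: rat)"
  by (metis numeral_num_of_nat of_nat_numeral)

lemma graph_products:
  assumes "conn_graph \<Gamma>"
  shows "(\<Prod>e\<in>edges \<Gamma>. of_nat (ecol \<Gamma> e)) = color_prod (colorsA (graph_mono \<Gamma>))"
    and "(\<Prod>v\<in>verts \<Gamma>. of_nat (vcol \<Gamma> v)) = index_prod (graph_mono \<Gamma>)"
    and "(\<Prod>v\<in>verts \<Gamma>. of_nat (card (partition_aut (vpartition \<Gamma> v)))) = (of_nat (aut_prod (graph_mono \<Gamma>)) :: rat)"
proof -
  have cb: "colored_bipartite \<Gamma>" using assms by (simp add: conn_graph_def)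
  note c = colored_bipartiteD[OF cb]
  have "color_prod (colorsA (graph_mono \<Gamma>)) = (\<Prod>e\<in>edges \<Gamma>. numeral (edge_num \<Gamma> e))"
    unfolding colorsA_graph_mono[OF assms] color_prod_def
    by (simp add: multiset.map_comp comp_def prod_unfold_prod_mset)
  also have "\<dots> = (\<Prod>e\<in>edges \<Gamma>. of_nat (ecol \<Gamma> e))"
    by (rule prod.cong[OF refl]) (simp add: edge_num_def numeral_num_of_nat_rat c(9))
  finally show "(\<Prod>e\<in>edges \<Gamma>. of_nat (ecol \<Gamma> e)) = color_prod (colorsA (graph_mono \<Gamma>))" ..
  have "index_prod (graph_mono \<Gamma>) = (\<Prod>v\<in>verts \<Gamma>. numeral (num_of_nat (vcol \<Gamma> v)))"
    unfolding graph_mono_def index_prod_def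
    by (simp add: multiset.map_comp comp_def prod_unfold_prod_mset graph_sym_def)
  also have "\<dots> = (\<Prod>v\<in>verts \<Gamma>. of_nat (vcol \<Gamma> v))"
    by (rule prod.cong[OF refl]) (simp add: numeral_num_of_nat_rat c(8))
  finally show "(\<Prod>v\<in>verts \<Gamma>. of_nat (vcol \<Gamma> v)) = index_prod (graph_mono \<Gamma>)" ..
  have "aut_prod (graph_mono \<Gamma>) = (\<Prod>v\<in>verts \<Gamma>. mfact (gen_parts (snd (graph_sym \<Gamma> v))))"
    unfolding graph_mono_def aut_prod_def
    by (simp add: multiset.map_comp comp_def prod_unfold_prod_mset)
  also have "\<dots> = (\<Prod>v\<in>verts \<Gamma>. card (partition_aut (vpartition \<Gamma> v)))"
    by (rule prod.cong[OF refl]) (simp add: card_partition_aut conn_graph_vpartition(2)[OF assms])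
  finally show "(\<Prod>v\<in>verts \<Gamma>. of_nat (card (partition_aut (vpartition \<Gamma> v)))) = (of_nat (aut_prod (graph_mono \<Gamma>)) :: rat)"
    by simp
qed

lemma betti_eq_mono_betti: "conn_graph \<Gamma> \<Longrightarrow> betti \<Gamma> = mono_betti (graph_mono \<Gamma>)"
  by (simp add: betti_def mono_betti_def colorsA_graph_mono) (simp add: graph_mono_def)

lemma color_gcd_eq_mono_gcd:
  assumes "conn_graph \<Gamma>"
  shows "color_gcd \<Gamma> = mono_gcd (graph_mono \<Gamma>)"
proof -
  have cb: "colored_bipartite \<Gamma>" using assms by (simp add: conn_graph_def)
  note c = colored_bipartiteD[OF cb]
  have "(\<lambda>s. numeral (fst s) :: nat) ` set_mset (graph_mono \<Gamma>) = vcol \<Gamma> ` verts \<Gamma>"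
    using c(1) by (auto simp: graph_mono_def graph_sym_def image_image numeral_num_of_nat c(8) intro!: image_cong)
  then have mono: "mono_gcd (graph_mono \<Gamma>) = Gcd (vcol \<Gamma> ` verts \<Gamma>)" by (simp add: mono_gcd_def)
  have "Gcd (vcol \<Gamma> ` verts \<Gamma>) dvd ecol \<Gamma> e" if e: "e \<in> edges \<Gamma>" for e
  proof (rule dvd_trans)
    show "Gcd (vcol \<Gamma> ` verts \<Gamma>) dvd vcol \<Gamma> (end1 \<Gamma> e)" using c(6)[OF e] by (intro Gcd_dvd) simp
    show "vcol \<Gamma> (end1 \<Gamma> e) dvd ecol \<Gamma> e"
      using assms e c(6)[OF e]
      by (simp add: conn_graph_def admissible_star_def admissible_def incident_edges_def)
  qed
  then have "Gcd (vcol \<Gamma> ` verts \<Gamma>) dvd color_gcd \<Gamma>"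
    unfolding color_gcd_def by (intro Gcd_greatest) (auto intro: Gcd_dvd)
  moreover have "color_gcd \<Gamma> dvd Gcd (vcol \<Gamma> ` verts \<Gamma>)"
    unfolding color_gcd_def by (intro Gcd_greatest) (auto intro: Gcd_dvd)
  ultimately show ?thesis unfolding mono by (rule dvd_antisym[rotated])
qed

text \<open>The weight is a multiple of the single monomial \<open>graph_mono\<close>, so the graph
  sum can be sorted by monomials.\<close>

lemma coeff_graph_term:
  assumes "conn_graph \<Gamma>"
  shows "coeff (graph_term \<Gamma>) m = (if m = graph_mono \<Gamma>
    then phi (mono_betti m) (mono_gcd m) * color_ratio m * of_nat (aut_prod m) / of_nat (card (graph_aut \<Gamma>))
    else 0)"
proof -
  have cb: "colored_bipartite \<Gamma>" using assms by (simp add: conn_graph_def)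
  note c = colored_bipartiteD[OF cb]
  let ?P1 = "\<Prod>v\<in>verts1 \<Gamma>. psym (num_of_nat (vcol \<Gamma> v)) (GenA (nepartition (vpartition \<Gamma> v)))"
  let ?P2 = "\<Prod>v\<in>verts2 \<Gamma>. psym (num_of_nat (vcol \<Gamma> v)) (GenB (nepartition (vpartition \<Gamma> v)))"
  have "?P1 = (\<Prod>v\<in>verts1 \<Gamma>. mps_var (graph_sym \<Gamma> v))"
    by (rule prod.cong[OF refl]) (simp add: graph_sym_def psym_def)
  moreover have "?P2 = (\<Prod>v\<in>verts2 \<Gamma>. mps_var (graph_sym \<Gamma> v))"
    by (rule prod.cong[OF refl]) (use c(3) in \<open>auto simp: graph_sym_def psym_def\<close>)
  ultimately have "?P1 * ?P2 = (\<Prod>v\<in>verts \<Gamma>. mps_var (graph_sym \<Gamma> v))"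
    using c(1,3) unfolding verts_def by (simp add: prod.union_disjoint)
  also have "\<dots> = (\<Prod>v\<in>#mset_set (verts \<Gamma>). mps_var (graph_sym \<Gamma> v))"
    by (rule prod_unfold_prod_mset)
  finally have "coeff (?P1 * ?P2) m = (if m = graph_mono \<Gamma> then 1 else 0)"
    by (simp only: coeff_prod_mset_var graph_mono_def)
  then show ?thesis
    unfolding graph_term_def weight_def graph_products[OF assms] mult.assoc coeff_const_mult
    by (simp add: betti_eq_mono_betti[OF assms] color_gcd_eq_mono_gcd[OF assms] color_ratio_def ac_simps)
qed

lemma graph_mono_iso:
  assumes "colored_bipartite \<Gamma>" "graph_iso \<Gamma> \<Delta> \<sigma> \<tau>"
  shows "graph_mono \<Delta> = graph_mono \<Gamma>"
proof -
  note 1 = graph_isoD(1)[OF assms(2)]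
  have "mset_set (verts \<Delta>) = image_mset \<sigma> (mset_set (verts \<Gamma>))"
    using 1 by (metis bij_betw_def image_mset_mset_set)
  then show ?thesis
    unfolding graph_mono_def
    using graph_sym_iso[OF assms] colored_bipartiteD(1)[OF assms(1)]
    by (auto simp: multiset.map_comp intro!: image_mset_cong)
qed

lemma graph_mono_glue_graph:
  assumes "finite V" "\<sigma> \<in> glue t V"
  shows "graph_mono (glue_graph t V \<sigma>) = image_mset t (mset_set V)"
  unfolding graph_mono_def glue_graph_simps
  by (rule image_mset_cong) (use assms graph_sym_glue_graph in auto)

text \<open>The vertices are numbers already; the half-edges that serve as edges are renamed by
  numbers.\<close>

lemma conn_graph_nat_copy:
  fixes \<Delta> :: "(nat, 'e) cbgraph"
  assumes "conn_graph \<Delta>"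
  obtains \<Gamma> :: "(nat, nat) cbgraph" and \<sigma> \<tau> where "conn_graph \<Gamma>" "graph_iso \<Delta> \<Gamma> \<sigma> \<tau>"
proof -
  have "finite (edges \<Delta>)" using assms by (auto simp: conn_graph_def dest: colored_bipartiteD(2))
  from ex_bij_betw_finite_nat[OF this] obtain \<beta> :: "'e \<Rightarrow> nat" where \<beta>: "inj_on \<beta> (edges \<Delta>)"
    by (auto simp: bij_betw_def)
  let ?i = "inv_into (edges \<Delta>) \<beta>"
  let ?\<Gamma> = "\<lparr>verts1 = verts1 \<Delta>, verts2 = verts2 \<Delta>, edges = \<beta> ` edges \<Delta>,
    end1 = (\<lambda>e. end1 \<Delta> (?i e)), end2 = (\<lambda>e. end2 \<Delta> (?i e)),
    vcol = vcol \<Delta>, ecol = (\<lambda>e. ecol \<Delta> (?i e))\<rparr>"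
  have "verts ?\<Gamma> = verts \<Delta>" by (simp add: verts_def)
  then have "graph_iso \<Delta> ?\<Gamma> (\<lambda>v. v) \<beta>"
    using \<beta> by (simp add: graph_iso_def bij_betw_def)
  then show thesis using conn_graph_iso[OF assms] that by blast
qed

definition class_rep :: "(nat, nat) cbgraph set \<Rightarrow> (nat, nat) cbgraph" where
  "class_rep C = (SOME \<Gamma>. \<Gamma> \<in> C)"

lemma class_rep:
  assumes "C \<in> iso_classes"
  shows "class_rep C \<in> C" "conn_graph (class_rep C)"
proof -
  show *: "class_rep C \<in> C"
    using in_quotient_imp_non_empty[OF equiv_iso_rel] assms
    unfolding iso_classes_def class_rep_def by (simp add: some_in_eq)
  then show "conn_graph (class_rep C)"
    using in_quotient_imp_subset[OF equiv_iso_rel] assms unfolding iso_classes_def conn_graphs_eq by blast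
qed

lemma aut_prod_pos: "aut_prod m > 0"
  unfolding aut_prod_def by (induction m) auto

text \<open>For a fixed monomial the connected gluings are partitioned by the isomorphism class of
  their graph. A class with automorphism group of order a contains
  \<open>mfact m * aut_prod m\<close> / a of them, so \<open>aut_prod m\<close> / a is its share of
  the gluings divided by \<open>mfact m\<close>.\<close>

lemma class_sum:
  fixes m :: "(num \<times> gen) multiset"
  shows "finite {C \<in> iso_classes. coeff (class_term C) m \<noteq> 0}" (is "finite ?S")
    and "(\<Sum>C\<in>{C \<in> iso_classes. coeff (class_term C) m \<noteq> 0}. coeff (class_term C) m) = coeff gluing_series m"
proof -
  obtain V :: "nat set" and t where V: "finite V" "m = image_mset t (mset_set V)"
    by (rule multiset_labelling)
  define CC where "CC = {C \<in> iso_classes. graph_mono (class_rep C) = m}"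
  define N where "N C = {\<sigma> \<in> cglue t V. \<exists>\<alpha> \<tau>. graph_iso (class_rep C) (glue_graph t V \<sigma>) \<alpha> \<tau>}" for C
  have cglue_glue: "\<sigma> \<in> glue t V" if "\<sigma> \<in> cglue t V" for \<sigma> using that by (simp add: cglue_def)
  have count: "card (N C) * card (graph_aut (class_rep C)) = mfact m * aut_prod m" if "C \<in> CC" for C
    unfolding N_def
    using labelled_isos_count[OF class_rep(2) V(1), of C t] that by (simp add: CC_def V(2))
  have pos: "card (N C) > 0" "card (graph_aut (class_rep C)) > 0" if "C \<in> CC" for C
  proof -
    have "card (N C) * card (graph_aut (class_rep C)) > 0"
      unfolding count[OF that] by (simp add: aut_prod_pos)
    then show "card (N C) > 0" "card (graph_aut (class_rep C)) > 0" by simp_all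
  qed
  have disj: "C = C'" if C: "C \<in> CC" "C' \<in> CC" "\<sigma> \<in> N C" "\<sigma> \<in> N C'" for C C' \<sigma>
  proof -
    have C_cl: "C \<in> iso_classes" "C' \<in> iso_classes" using C by (auto simp: CC_def)
    obtain \<alpha> \<tau> \<alpha>' \<tau>' where iso: "graph_iso (class_rep C) (glue_graph t V \<sigma>) \<alpha> \<tau>"
      "graph_iso (class_rep C') (glue_graph t V \<sigma>) \<alpha>' \<tau>'"
      using C by (auto simp: N_def)
    have "colored_bipartite (class_rep C')" using class_rep(2)[OF C_cl(2)] by (simp add: conn_graph_def)
    from graph_iso_comp[OF iso(1) graph_iso_inv[OF this iso(2)]]
    have "(class_rep C, class_rep C') \<in> iso_rel"
      using class_rep(2)[OF C_cl(1)] class_rep(2)[OF C_cl(2)] unfolding iso_rel_def conn_graphs_eq by blast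
    then show ?thesis
      using quotient_eqI[OF equiv_iso_rel] C_cl class_rep(1) unfolding iso_classes_def by blast
  qed
  have cover: "\<exists>C\<in>CC. \<sigma> \<in> N C" if \<sigma>: "\<sigma> \<in> cglue t V" for \<sigma>
  proof -
    let ?\<Delta> = "glue_graph t V \<sigma>"
    have \<Delta>: "conn_graph ?\<Delta>" by (rule conn_graph_glue_graph[OF V(1) \<sigma>])
    from conn_graph_nat_copy[OF \<Delta>] obtain \<Gamma> :: "(nat, nat) cbgraph" and \<alpha> \<tau>
      where \<Gamma>: "conn_graph \<Gamma>" "graph_iso ?\<Delta> \<Gamma> \<alpha> \<tau>" by blast
    have cb: "colored_bipartite ?\<Delta>" "colored_bipartite \<Gamma>" using \<Delta> \<Gamma>(1) by (auto simp: conn_graph_def)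
    define C where "C = iso_rel `` {\<Gamma>}"
    have C: "C \<in> iso_classes"
      unfolding C_def iso_classes_def by (rule quotientI) (simp add: conn_graphs_eq \<Gamma>(1))
    have "(\<Gamma>, class_rep C) \<in> iso_rel" using class_rep(1)[OF C] by (simp add: C_def)
    then obtain \<alpha>' \<tau>' where iso: "graph_iso \<Gamma> (class_rep C) \<alpha>' \<tau>'" by (auto simp: iso_rel_def)
    note to_rep = graph_iso_comp[OF \<Gamma>(2) iso]
    have "graph_mono (class_rep C) = m"
      using graph_mono_iso[OF cb(1) to_rep] graph_mono_glue_graph[OF V(1) cglue_glue[OF \<sigma>]] V(2) by simp
    then have "C \<in> CC" using C by (simp add: CC_def)
    moreover have "\<sigma> \<in> N C"
      using graph_iso_inv[OF cb(1) to_rep] \<sigma> unfolding N_def by blast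
    ultimately show ?thesis by blast
  qed
  have finN: "finite (N C)" for C using finite_cglue[OF V(1)] by (simp add: N_def)
  \<comment> \<open>The sets \<open>N C\<close> are nonempty, disjoint and contained in the finite
    set \<open>cglue t V\<close>, so only finitely many classes have the monomial
    \<open>m\<close>.\<close>
  have "inj_on N CC"
  proof (rule inj_onI)
    fix C C' assume "C \<in> CC" "C' \<in> CC" "N C = N C'"
    moreover from this pos(1)[of C] obtain \<sigma> where "\<sigma> \<in> N C" by fastforce
    ultimately show "C = C'" using disj by blast
  qed
  moreover have "finite (N ` CC)"
    by (rule finite_subset[of _ "Pow (cglue t V)"]) (auto simp: N_def finite_cglue[OF V(1)])
  ultimately have finCC: "finite CC" by (rule finite_imageD[rotated])
  have "cglue t V = (\<Union>C\<in>CC. N C)"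
  proof
    show "cglue t V \<subseteq> (\<Union>C\<in>CC. N C)" using cover by blast
    show "(\<Union>C\<in>CC. N C) \<subseteq> cglue t V" unfolding N_def by blast
  qed
  moreover have "card (\<Union>C\<in>CC. N C) = (\<Sum>C\<in>CC. card (N C))"
    by (rule card_UN_disjoint[OF finCC]) (use finN disj in blast)+
  ultimately have card_cglue: "card (cglue t V) = (\<Sum>C\<in>CC. card (N C))"
    by simp
  let ?c = "phi (mono_betti m) (mono_gcd m) * color_ratio m"
  have term_C: "coeff (class_term C) m = (if C \<in> CC then ?c * of_nat (card (N C)) / of_nat (mfact m) else 0)"
    if C: "C \<in> iso_classes" for C
  proof (cases "C \<in> CC")
    case True
    have "(of_nat (card (N C)) * of_nat (card (graph_aut (class_rep C))) :: rat) = of_nat (mfact m) * of_nat (aut_prod m)"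
      using count[OF True] by (metis of_nat_mult)
    then have "(of_nat (aut_prod m) / of_nat (card (graph_aut (class_rep C))) :: rat) =
        of_nat (card (N C)) / of_nat (mfact m)"
      using pos(2)[OF True] mfact_pos[of m] by (simp add: frac_eq_eq mult.commute)
    then have "?c * of_nat (aut_prod m) / of_nat (card (graph_aut (class_rep C))) =
        ?c * of_nat (card (N C)) / of_nat (mfact m)"
      unfolding times_divide_eq_right[symmetric] by (rule arg_cong)
    with True show ?thesis
      unfolding class_term_def class_rep_def[symmetric] coeff_graph_term[OF class_rep(2)[OF C]]
      by (simp add: CC_def)
  next
    case False
    with C show ?thesis
      unfolding class_term_def class_rep_def[symmetric] coeff_graph_term[OF class_rep(2)[OF C]]
      by (auto simp: CC_def)
  qed
  have sub: "?S \<subseteq> CC"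
  proof
    fix C assume "C \<in> ?S"
    then show "C \<in> CC" using term_C[of C] by (cases "C \<in> CC") auto
  qed
  then show "finite ?S" using finCC by (rule finite_subset)
  have "(\<Sum>C\<in>?S. coeff (class_term C) m) = (\<Sum>C\<in>CC. coeff (class_term C) m)"
    by (rule sum.mono_neutral_left[OF finCC sub]) (auto simp: CC_def)
  also have "\<dots> = (\<Sum>C\<in>CC. ?c * of_nat (card (N C)) / of_nat (mfact m))"
    by (rule sum.cong[OF refl]) (use term_C in \<open>auto simp: CC_def\<close>)
  also have "\<dots> = ?c * of_nat (card (cglue t V)) / of_nat (mfact m)"
    by (simp add: card_cglue sum_distrib_left sum_divide_distrib)
  also have "\<dots> = phi (mono_betti m) (mono_gcd m) * coeff hall_log m"
    using coeff_hall_log_labelled[OF V(1), of t, folded V(2)] mfact_pos[of m]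
    by (simp add: field_simps)
  finally show "(\<Sum>C\<in>?S. coeff (class_term C) m) = coeff gluing_series m"
    by (simp add: gluing_series.rep_eq)
qed

lemma class_terms_has_sum: "mps_has_sum class_term iso_classes gluing_series"
  unfolding mps_has_sum_def mps_summable_def
  by (auto simp: class_sum(1) intro!: mps_eqI) (simp add: coeff_mps_Sum class_sum(2))

text \<open>Unique existence justifies speaking of \<open>L\<close> as defined by the Hall product,
  and it keeps the expansion from being vacuous.\<close>

theorem theorem3p4:
  shows "(\<exists>!L. is_L L) \<and> (\<forall>L. is_L L \<longrightarrow> mps_has_sum class_term iso_classes L)"
  using is_L_gluing_series is_L_unique class_terms_has_sum by blast

end
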